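(* Let $\Omega$ be a domain in the hemisphere $\mathbb{S}^2_+$, and let $\lambda_1(\Omega)<\lambda_2(\Omega)\le\cdots$ be the eigenvalues of the Dirichlet Laplacian on $\Omega$, repeated according to multiplicity. Then for all $z\geq 0$ $$ R_1^D(z)=\sum_{j\geq 1}(z-\lambda_j(\Omega))_+\leq \frac{1}{8\pi}|\Omega|\left(z-\frac12\right)^2 . $$
   Context: $\mathbb{S}^2_+=\mathbb{S}^2\cap\{x_3>0\}$ is the open hemisphere of the round unit sphere $\mathbb{S}^2\subset\mathbb{R}^3$. A domain is an open connected set; $|\Omega|$ is its surface measure; $a_+=\max(a,0)$. The Dirichlet eigenvalues are understood in the weak sense: $\lambda$ is an eigenvalue if there is $0\neq u\in H^1_0(\Omega)$ (closure of $C_c^\infty(\Omega)$ in $H^1(\Omega)$) with $\int_\Omega\nabla u\cdot\nabla\phi=\lambda\int_\Omega u\phi$ for all $\phi\in H_0^1(\Omega)$. *)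

theory Defs
  imports "HOL-Analysis.Analysis"
begin

abbreviation unit_sphere :: "(real^3) set" where
  "unit_sphere \<equiv> sphere 0 1"

definition open_hemisphere :: "(real^3) set" where
  "open_hemisphere = {x \<in> unit_sphere. 0 < x $ 3}"

text \<open>Surface measure of the unit sphere, as in integration in polar coordinates: a set on the
  sphere gets three times the Lebesgue measure of the cone over it in the unit ball
  (\<open>sgn y\<close> is \<open>y / norm y\<close>).\<close>

definition surface_measure :: "(real^3) measure" where
  "surface_measure = scale_measure 3 (distr (restrict_space lborel (ball 0 1)) borel sgn)"

lemma emeasure_surface_measure:
  assumes "A \<in> sets borel"
  shows "emeasure surface_measure A = 3 * emeasure lborel {y \<in> ball 0 1. sgn y \<in> A}"
proof -
  have m: "sgn \<in> restrict_space lborel (ball (0::real^3) 1) \<rightarrow>\<^sub>M borel"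
    by (intro measurable_restrict_space1) simp
  have "emeasure (distr (restrict_space lborel (ball 0 1)) borel sgn) A =
    emeasure (restrict_space lborel (ball 0 1)) {y \<in> ball 0 1. sgn y \<in> A}"
    using assms by (subst emeasure_distr[OF m])
      (auto simp: space_restrict_space intro!: arg_cong[where f = "emeasure _"])
  also have "\<dots> = emeasure lborel {y \<in> ball 0 1. sgn y \<in> A}"
    by (subst emeasure_restrict_space) auto
  finally show ?thesis
    by (simp add: surface_measure_def)
qed

lemma surface_measure_unit_sphere: "measure surface_measure unit_sphere = 4 * pi"
proof -
  have "emeasure lborel {y \<in> ball 0 1. sgn y \<in> unit_sphere} = emeasure lborel (ball (0::real^3) 1 - {0})"
    by (intro arg_cong[where f = "emeasure _"]) (auto simp: norm_sgn split: if_splits)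
  also have "\<dots> = emeasure lborel (ball (0::real^3) 1)"
    by (intro emeasure_Diff_null_set) auto
  also have "\<dots> = ennreal (4 / 3 * pi)"
    by (simp add: emeasure_ball eval_unit_ball_vol)
  finally have "emeasure surface_measure unit_sphere = 3 * ennreal (4 / 3 * pi)"
    by (simp add: emeasure_surface_measure)
  also have "\<dots> = ennreal (4 * pi)"
    by (subst ennreal_numeral[symmetric], subst ennreal_mult[symmetric]) auto
  finally show ?thesis
    by (simp add: measure_def)
qed

text \<open>A function \<open>u\<close> on the sphere is represented by any function on \<open>real^3\<close> with the prescribed
  values on the sphere. Differential operators act on the degree-zero homogeneous extension
  \<open>\<lambda>y. u (sgn y)\<close>, so they depend on the values on the sphere only; on the sphere the ambient
  gradient of this extension is the tangential gradient of \<open>u\<close>, and the ambient divergence of the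
  extension of a tangent field is its surface divergence.\<close>

definition sphere_grad :: "(real^3 \<Rightarrow> real) \<Rightarrow> real^3 \<Rightarrow> real^3" where
  "sphere_grad u x = (\<Sum>b\<in>Basis. frechet_derivative (\<lambda>y. u (sgn y)) (at x) b *\<^sub>R b)"

lemma sphere_grad_eq_tangential_projection:
  assumes "(F has_derivative (\<lambda>h. D \<bullet> h)) (at x)" "x \<in> unit_sphere"
  shows "sphere_grad F x = D - (D \<bullet> x) *\<^sub>R x"
proof -
  have [simp]: "norm x = 1" "sgn x = x" "x \<noteq> 0" "x \<bullet> x = 1"
    using assms(2) by (auto simp: sgn_div_norm dot_square_norm)
  have "((\<lambda>y. y /\<^sub>R norm y) has_derivative (\<lambda>h. h - (x \<bullet> h) *\<^sub>R x)) (at x)"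
    using has_derivative_norm[OF \<open>x \<noteq> 0\<close>]
    by (auto intro!: derivative_eq_intros simp: fun_eq_iff inner_commute)
  then have s: "(sgn has_derivative (\<lambda>h. h - (x \<bullet> h) *\<^sub>R x)) (at x)"
    by (simp add: sgn_div_norm[abs_def])
  have "((\<lambda>y. F (sgn y)) has_derivative (\<lambda>h. D \<bullet> (h - (x \<bullet> h) *\<^sub>R x))) (at x)"
    using has_derivative_compose[OF s, of F "\<lambda>h. D \<bullet> h"] assms(1) by simp
  then have "frechet_derivative (\<lambda>y. F (sgn y)) (at x) = (\<lambda>h. (D - (D \<bullet> x) *\<^sub>R x) \<bullet> h)"
    by (subst frechet_derivative_at[symmetric], assumption)
      (auto simp: fun_eq_iff inner_diff_left inner_diff_right)
  then show ?thesis
    by (simp add: sphere_grad_def euclidean_representation)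
qed

definition sphere_div :: "(real^3 \<Rightarrow> real^3) \<Rightarrow> real^3 \<Rightarrow> real" where
  "sphere_div X x = (\<Sum>b\<in>Basis. frechet_derivative (\<lambda>y. X (sgn y)) (at x) b \<bullet> b)"

primrec times_differentiable_on ::
  "nat \<Rightarrow> 'a::real_normed_vector set \<Rightarrow> ('a \<Rightarrow> 'b::real_normed_vector) \<Rightarrow> bool" where
  "times_differentiable_on 0 S f \<longleftrightarrow> continuous_on S f"
| "times_differentiable_on (Suc k) S f \<longleftrightarrow> (\<forall>x\<in>S. f differentiable (at x)) \<and>
     (\<forall>v. times_differentiable_on k S (\<lambda>x. frechet_derivative f (at x) v))"

definition smooth_on :: "'a::real_normed_vector set \<Rightarrow> ('a \<Rightarrow> 'b::real_normed_vector) \<Rightarrow> bool" where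
  "smooth_on S f \<longleftrightarrow> (\<forall>k. times_differentiable_on k S f)"

text \<open>Smooth functions on the sphere with compact support in \<open>\<Omega>\<close>; the values may be scalars
  or vectors.\<close>

definition test_functions :: "(real^3) set \<Rightarrow> (real^3 \<Rightarrow> 'b::real_normed_vector) set" where
  "test_functions \<Omega> = {\<phi>. smooth_on (- {0}) (\<lambda>y. \<phi> (sgn y)) \<and>
     (\<exists>K. compact K \<and> K \<subseteq> \<Omega> \<and> (\<forall>x \<in> unit_sphere - K. \<phi> x = 0))}"

definition test_fields :: "(real^3) set \<Rightarrow> (real^3 \<Rightarrow> real^3) set" where
  "test_fields \<Omega> = {X \<in> test_functions \<Omega>. \<forall>x \<in> unit_sphere. X x \<bullet> x = 0}"

definition square_integrable_on ::
  "(real^3) set \<Rightarrow> (real^3 \<Rightarrow> 'b::{second_countable_topology, banach}) \<Rightarrow> bool" where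
  "square_integrable_on \<Omega> f \<longleftrightarrow> set_borel_measurable surface_measure \<Omega> f \<and>
     set_integrable surface_measure \<Omega> (\<lambda>x. (norm (f x))\<^sup>2)"

definition has_weak_gradient ::
  "(real^3) set \<Rightarrow> (real^3 \<Rightarrow> real) \<Rightarrow> (real^3 \<Rightarrow> real^3) \<Rightarrow> bool" where
  "has_weak_gradient \<Omega> u g \<longleftrightarrow>
     (\<forall>x\<in>\<Omega>. g x \<bullet> x = 0) \<and>
     (\<forall>X \<in> test_fields \<Omega>.
        (LINT x:\<Omega>|surface_measure. u x * sphere_div X x) =
        - (LINT x:\<Omega>|surface_measure. g x \<bullet> X x))"

text \<open>A pair \<open>(u, g)\<close> satisfies \<open>sobolev \<Omega> u g\<close> if \<open>u \<in> H\<^sup>1(\<Omega>)\<close> and \<open>g\<close> represents its gradient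
  (unique up to a null set). In \<open>H10\<close>, the infimum of the squared \<open>H\<^sup>1\<close> distances to test functions
  is zero.\<close>

definition sobolev ::
  "(real^3) set \<Rightarrow> (real^3 \<Rightarrow> real) \<Rightarrow> (real^3 \<Rightarrow> real^3) \<Rightarrow> bool" where
  "sobolev \<Omega> u g \<longleftrightarrow> square_integrable_on \<Omega> u \<and> square_integrable_on \<Omega> g \<and> has_weak_gradient \<Omega> u g"

definition H10 :: "(real^3) set \<Rightarrow> (real^3 \<Rightarrow> real) set" where
  "H10 \<Omega> = {u. \<exists>g. sobolev \<Omega> u g \<and>
     (\<forall>\<epsilon>>0. \<exists>\<phi> \<in> test_functions \<Omega>.
        (LINT x:\<Omega>|surface_measure. (u x - \<phi> x)\<^sup>2) +
        (LINT x:\<Omega>|surface_measure. (norm (g x - sphere_grad \<phi> x))\<^sup>2) < \<epsilon>)}"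

definition dirichlet_eigenspace :: "(real^3) set \<Rightarrow> real \<Rightarrow> (real^3 \<Rightarrow> real) set" where
  "dirichlet_eigenspace \<Omega> \<mu> = {u \<in> H10 \<Omega>. \<exists>g. sobolev \<Omega> u g \<and>
     (\<forall>\<phi> \<in> H10 \<Omega>. \<forall>h. sobolev \<Omega> \<phi> h \<longrightarrow>
        (LINT x:\<Omega>|surface_measure. g x \<bullet> h x) =
        \<mu> * (LINT x:\<Omega>|surface_measure. u x * \<phi> x))}"

text \<open>The eigenspace, with functions identified when equal almost everywhere on \<open>\<Omega>\<close>, has
  dimension \<open>n\<close>: there is a basis of \<open>n\<close> elements. The case \<open>n = 0\<close> says that \<open>\<mu>\<close> is
  not an eigenvalue.\<close>

definition has_multiplicity :: "(real^3) set \<Rightarrow> real \<Rightarrow> nat \<Rightarrow> bool" where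
  "has_multiplicity \<Omega> \<mu> n \<longleftrightarrow> (\<exists>f :: nat \<Rightarrow> real^3 \<Rightarrow> real.
     (\<forall>i<n. f i \<in> dirichlet_eigenspace \<Omega> \<mu>) \<and>
     (\<forall>c. (AE x in surface_measure. x \<in> \<Omega> \<longrightarrow> (\<Sum>i<n. c i * f i x) = 0) \<longrightarrow> (\<forall>i<n. c i = 0)) \<and>
     (\<forall>u \<in> dirichlet_eigenspace \<Omega> \<mu>. \<exists>c.
        AE x in surface_measure. x \<in> \<Omega> \<longrightarrow> u x = (\<Sum>i<n. c i * f i x)))"

text \<open>\<open>ev 1 \<le> ev 2 \<le> \<dots>\<close> lists all Dirichlet eigenvalues, each as often as its multiplicity;
  the value \<open>ev 0\<close> is irrelevant.\<close>

definition dirichlet_eigenvalues :: "(real^3) set \<Rightarrow> (nat \<Rightarrow> real) \<Rightarrow> bool" where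
  "dirichlet_eigenvalues \<Omega> ev \<longleftrightarrow> mono_on {1..} ev \<and>
     (\<forall>\<mu>. finite {j \<in> {1..}. ev j = \<mu>} \<and> has_multiplicity \<Omega> \<mu> (card {j \<in> {1..}. ev j = \<mu>}))"

end

theory Submission
  imports Defs
begin

text \<open>The argument is of Berezin type: the eigenfunctions of \<open>\<Omega>\<close> are tested against the spherical harmonics,
which diagonalise the Laplace operator of the whole sphere with eigenvalues \<open>l (l + 1)\<close>, \<open>l = 0, 1, \<dots>\<close>,
of multiplicity \<open>2 l + 1\<close>. Used directly, this only compares \<open>\<Omega>\<close> with the sphere and loses too much.
The gain comes from the antipodal map. As \<open>\<Omega>\<close> lies in an open hemisphere, \<open>\<Omega>\<close> and \<open>-\<Omega>\<close> are disjoint,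
so a function on \<open>\<Omega>\<close> may be extended to the sphere as an even or as an odd function, at will. An extension of
given parity has components only in the degrees of that parity, and these count twice
(\<open>spectral_inequality_antipodal\<close>).

For a threshold \<open>z = L (L + 1)\<close> that is an eigenvalue of the sphere, choose the parity of \<open>L\<close>. Since the kernel of
the projection onto the harmonics of degree \<open>l\<close> has the constant diagonal value \<open>(2 l + 1) / (4 \<pi>)\<close>, Bessel's
inequality for an orthonormal system of eigenfunctions of \<open>\<Omega>\<close> (\<open>trace_inequality\<close>) bounds the Riesz mean
at \<open>z\<close> by \<open>\<bar>\<Omega>\<bar> / (2 \<pi>)\<close> times the sum of \<open>(2 l + 1) (z - l (l + 1))\<close> over the \<open>l < L\<close> of the parity of \<open>L\<close>. This sum
is \<open>z (z - 2) / 4\<close>, so the Riesz mean at \<open>z\<close> is at most \<open>\<bar>\<Omega>\<bar> / (8 \<pi>) \<cdot> z (z - 2)\<close> (\<open>riesz_mean_at_node\<close>). The Riesz mean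
is a convex function of \<open>z\<close>, and the piecewise linear interpolation of \<open>z (z - 2)\<close> between consecutive
eigenvalues of the sphere stays below \<open>(z - 1/2)\<^sup>2\<close>, each of its segments being tangent to this
parabola (\<open>riesz_mean_finite\<close>).

The projections are handled through their kernels \<open>Z (x \<bullet> y)\<close>, multiples of Legendre polynomials, without
a basis of spherical harmonics. One integration by parts, \<open>integral_sphere_directional_derivative\<close>, yields the
symmetry of the Laplace operator, the convolution of zonal functions and their moments; thus the kernels
represent mutually orthogonal projections (\<open>harmonic_kernel_convolution\<close>). Their completeness
(\<open>parseval_le\<close>) comes from the Stone-Weierstrass theorem for the span of the functions \<open>exp (x \<bullet> a)\<close>, and
Bessel's inequality for gradients (\<open>energy_ge\<close>) then gives \<open>spectral_inequality\<close>. Both are proved for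
continuously differentiable functions, and pass to eigenfunctions by approximation in \<open>H\<^sup>1\<close>
(\<open>eigenfunction_approximation\<close>).\<close>

section \<open>Integration over the sphere\<close>

lemma sets_surface_measure [simp, measurable_cong]: "sets surface_measure = sets borel"
  by (simp add: surface_measure_def)

lemma space_surface_measure [simp]: "space surface_measure = UNIV"
  using sets_eq_imp_space_eq[OF sets_surface_measure] by simp

definition area_on :: "(real^3) set \<Rightarrow> (real^3) measure" where
  "area_on A = restrict_space surface_measure A"

abbreviation sint :: "(real^3 \<Rightarrow> real) \<Rightarrow> real" where
  "sint f \<equiv> integral\<^sup>L (area_on unit_sphere) f"

lemma space_area_on [simp]: "space (area_on A) = A"
  by (simp add: area_on_def space_restrict_space)

lemma finite_measure_surface_measure: "finite_measure surface_measure"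
proof
  have "emeasure surface_measure UNIV = 3 * emeasure lborel {y \<in> ball (0::real^3) 1. sgn y \<in> UNIV}"
    by (rule emeasure_surface_measure) simp
  also have "\<dots> = 3 * emeasure lborel (ball (0::real^3) 1)" by (simp add: ball_def)
  also have "\<dots> < \<infinity>"
    using emeasure_lborel_ball_finite[of "0::real^3" 1]
    by (metis ennreal_mult_eq_top_iff ennreal_numeral_less_top infinity_ennreal_def top.not_eq_extremum)
  finally show "emeasure surface_measure (space surface_measure) \<noteq> \<infinity>" by simp
qed

lemma finite_measure_area_on [simp]: "A \<in> sets borel \<Longrightarrow> finite_measure (area_on A)"
  unfolding area_on_def by (intro finite_measure_restrict_space finite_measure_surface_measure) simp_all

lemma set_integral_eq_area_on:
  fixes f :: "real^3 \<Rightarrow> 'b::{banach, second_countable_topology}"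
  assumes "A \<in> sets borel"
  shows "(LINT x:A|surface_measure. f x) = integral\<^sup>L (area_on A) f"
  using assms by (simp add: area_on_def integral_restrict_space set_lebesgue_integral_def)

lemma set_integrable_iff_area_on:
  fixes f :: "real^3 \<Rightarrow> 'b::{banach, second_countable_topology}"
  assumes "A \<in> sets borel"
  shows "set_integrable surface_measure A f \<longleftrightarrow> integrable (area_on A) f"
  using assms by (simp add: area_on_def integrable_restrict_space set_integrable_def)

lemma set_borel_measurable_iff_area_on:
  fixes f :: "real^3 \<Rightarrow> 'b::real_normed_vector"
  assumes "A \<in> sets borel"
  shows "set_borel_measurable surface_measure A f \<longleftrightarrow> f \<in> borel_measurable (area_on A)"
  using assms
  by (simp add: area_on_def set_borel_measurable_def borel_measurable_restrict_space_iff)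

lemma measurable_area_on_continuous:
  fixes f :: "real^3 \<Rightarrow> 'b::topological_space"
  assumes "continuous_on S f" "A \<subseteq> S"
  shows "f \<in> borel_measurable (area_on A)"
proof -
  have "f \<in> borel_measurable (restrict_space borel A)"
    by (intro borel_measurable_continuous_on_restrict continuous_on_subset[OF assms])
  then show ?thesis unfolding area_on_def
    by (subst measurable_cong_sets[OF sets_restrict_space_cong refl]) simp_all
qed

lemma integrable_area_on_continuous:
  fixes f :: "real^3 \<Rightarrow> 'b::{banach, second_countable_topology}"
  assumes "continuous_on unit_sphere f" "A \<subseteq> unit_sphere" "A \<in> sets borel"
  shows "integrable (area_on A) f"
proof -
  interpret finite_measure "area_on A" using assms by simp
  obtain B where B: "\<And>x. x \<in> unit_sphere \<Longrightarrow> norm (f x) \<le> B"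
    using continuous_on_compact_bound[OF compact_sphere assms(1)] by metis
  show ?thesis
    using assms B by (intro integrable_const_bound[where B=B] measurable_area_on_continuous[where S = unit_sphere] AE_I2) auto
qed

text \<open>The degree-zero homogeneous extension of a function on the sphere. It is cut off at the origin, so that
  it is Borel measurable on \<open>\<real>\<^sup>3\<close> whatever values \<open>f\<close> takes away from the sphere.\<close>

definition cone_ext :: "(real^3 \<Rightarrow> real) \<Rightarrow> real^3 \<Rightarrow> real" where
  "cone_ext f y = indicator unit_sphere (sgn y) * f (sgn y)"

lemma cone_ext_nonzero: "y \<noteq> 0 \<Longrightarrow> cone_ext f y = f (sgn y)"
  by (simp add: cone_ext_def norm_sgn)

lemma cone_ext_0 [simp]: "cone_ext f 0 = 0"
  by (simp add: cone_ext_def)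

lemma cone_ext_scale: "r > 0 \<Longrightarrow> cone_ext f (r *\<^sub>R y) = cone_ext f y"
  by (simp add: cone_ext_def sgn_scaleR)

lemma unit_sphere_borel [measurable, simp]: "unit_sphere \<in> sets borel"
  by (simp add: closed_sphere borel_closed)

lemma borel_measurable_cone_ext:
  assumes "continuous_on unit_sphere f"
  shows "cone_ext f \<in> borel_measurable borel"
proof -
  have "(\<lambda>x. indicator unit_sphere x *\<^sub>R f x) \<in> borel_measurable borel"
    by (rule borel_measurable_continuous_on_indicator[OF unit_sphere_borel assms])
  from measurable_compose[OF _ this, of sgn borel] show ?thesis
    by (simp add: cone_ext_def[abs_def])
qed

lemma cone_ext_bounded:
  assumes "continuous_on unit_sphere f"
  obtains B where "0 < B" "\<And>y. \<bar>cone_ext f y\<bar> \<le> B"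
proof -
  obtain B0 where B0: "\<And>x. x \<in> unit_sphere \<Longrightarrow> norm (f x) \<le> B0"
    using continuous_on_compact_bound[OF compact_sphere assms] by metis
  define B where "B = max B0 1"
  have B: "0 < B" "\<And>x. x \<in> unit_sphere \<Longrightarrow> norm (f x) \<le> B"
    using B0 by (force simp: B_def)+
  show ?thesis
  proof (rule that[OF B(1)])
    show "\<bar>cone_ext f y\<bar> \<le> B" for y
      using B(1) B(2)[of "sgn y"] by (cases "sgn y \<in> unit_sphere") (simp_all add: cone_ext_def)
  qed
qed

lemma integral_unit_sphere:
  fixes f :: "real^3 \<Rightarrow> real"
  assumes "continuous_on unit_sphere f"
  shows "sint f = 3 * (\<integral>y. indicator (ball 0 1) y * cone_ext f y \<partial>lborel)"
proof -
  let ?R = "restrict_space lborel (ball (0::real^3) 1)"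
  define g where "g x = indicator unit_sphere x * f x" for x
  have m: "sgn \<in> ?R \<rightarrow>\<^sub>M borel"
    by (intro measurable_restrict_space1) simp
  have g: "g \<in> borel_measurable borel"
    unfolding g_def using borel_measurable_continuous_on_indicator[OF unit_sphere_borel assms] by simp
  have sm: "surface_measure = density (distr ?R borel sgn) (\<lambda>_. ennreal 3)"
    unfolding surface_measure_def
    by (rule measure_eqI) (simp_all add: emeasure_density nn_integral_cmult_indicator)
  have "sint f = integral\<^sup>L surface_measure g"
    by (simp add: set_integral_eq_area_on[symmetric] set_lebesgue_integral_def g_def[abs_def])
  also have "\<dots> = 3 * integral\<^sup>L (distr ?R borel sgn) g"
    unfolding sm using g by (subst integral_density) auto
  also have "integral\<^sup>L (distr ?R borel sgn) g = (\<integral>y. g (sgn y) \<partial>?R)"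
    by (rule integral_distr[OF m g])
  also have "\<dots> = (\<integral>y. indicator (ball 0 1) y * cone_ext f y \<partial>lborel)"
    by (subst integral_restrict_space) (simp_all add: g_def cone_ext_def)
  finally show ?thesis .
qed

lemma integral_unit_sphere_uminus:
  fixes f :: "real^3 \<Rightarrow> real"
  assumes "continuous_on unit_sphere f"
  shows "(\<integral>x. f (- x) \<partial>area_on unit_sphere) = sint f"
proof -
  have c: "continuous_on unit_sphere (\<lambda>x. f (- x))"
    by (rule continuous_on_compose2[OF assms]) (auto intro!: continuous_intros)
  have d: "(lborel :: (real^3) measure) = distr lborel borel uminus"
    using lborel_affine[of "-1" "0::real^3"] by (simp add: density_1 one_ennreal_def[symmetric])
  have "(\<integral>y. indicator (ball 0 1) y * cone_ext f y \<partial>lborel) = (\<integral>y. indicator (ball 0 1) y * cone_ext f y \<partial>distr lborel borel uminus)"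
    using d by simp
  also have "\<dots> = (\<integral>y. indicator (ball 0 1) (- y) * cone_ext f (- y) \<partial>lborel)"
    using borel_measurable_cone_ext[OF assms]
    by (intro integral_distr) (auto intro!: borel_measurable_times borel_measurable_indicator)
  also have "\<dots> = (\<integral>y. indicator (ball 0 1) y * cone_ext (\<lambda>x. f (- x)) y \<partial>lborel)"
    by (intro Bochner_Integration.integral_cong) (auto simp: cone_ext_def sgn_minus indicator_def)
  finally show ?thesis
    using integral_unit_sphere[OF assms] integral_unit_sphere[OF c] by simp
qed

lemma integral_ball_cone_ext:
  fixes f :: "real^3 \<Rightarrow> real"
  assumes "continuous_on unit_sphere f" "r > 0"
  shows "(\<integral>y. indicator (ball 0 r) y * cone_ext f y \<partial>lborel) = r ^ 3 / 3 * sint f"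
proof -
  have m: "(\<lambda>y. indicator (ball 0 r) y * cone_ext f y) \<in> borel_measurable borel"
    using borel_measurable_cone_ext[OF assms(1)] by (intro borel_measurable_times borel_measurable_indicator) auto
  have "(\<integral>y. indicator (ball 0 r) y * cone_ext f y \<partial>lborel) =
     (\<integral>y. indicator (ball 0 r) y * cone_ext f y \<partial>density (distr lborel borel (\<lambda>x. 0 + r *\<^sub>R x)) (\<lambda>_. \<bar>r\<bar>^DIM(real^3)))"
    using lborel_affine[of r "0::real^3"] assms by simp
  also have "\<dots> = (\<integral>y. r ^ 3 * (indicator (ball 0 r) (r *\<^sub>R y) * cone_ext f (r *\<^sub>R y)) \<partial>lborel)"
    using assms m by (subst integral_density) (simp_all add: integral_distr[OF _ m])
  also have "\<dots> = (\<integral>y. r ^ 3 * (indicator (ball 0 1) y * cone_ext f y) \<partial>lborel)"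
    using assms by (intro Bochner_Integration.integral_cong) (auto simp: indicator_def cone_ext_scale)
  finally show ?thesis by (simp add: integral_unit_sphere[OF assms(1)])
qed

definition ball_moment :: "nat \<Rightarrow> (real^3 \<Rightarrow> real) \<Rightarrow> real^3 \<Rightarrow> real" where
  "ball_moment k f y = indicator (ball 0 1) y * (norm y ^ k * cone_ext f y)"

lemma integrable_ball_const: "integrable lborel (\<lambda>y. indicator (ball (0::real^3) r) y * (c::real))"
  using emeasure_lborel_ball_finite[of "0::real^3" r] by (intro integrable_mult_left) auto

lemma integrable_ball_moment:
  assumes f: "continuous_on unit_sphere f"
  shows "integrable lborel (ball_moment k f)"
proof -
  note [measurable] = borel_measurable_cone_ext[OF f]
  obtain B where B: "0 < B" "\<And>y. \<bar>cone_ext f y\<bar> \<le> B" using cone_ext_bounded[OF f] by blast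
  show ?thesis
  proof (rule Bochner_Integration.integrable_bound[OF integrable_ball_const[of 1 B]])
    show "AE y in lborel. norm (ball_moment k f y) \<le> norm (indicator (ball 0 1) y * B)"
      using B by (intro AE_I2) (auto simp: ball_moment_def abs_mult indicator_def power_le_one intro!: order_trans[OF mult_left_le_one_le])
  qed (unfold ball_moment_def indicator_def mem_ball dist_0_norm, measurable)
qed

text \<open>Integration in polar coordinates for the radial weight \<open>r\<^sup>k\<close>. Writing \<open>1 - \<bar>y\<bar>\<^sup>k\<close> as the integral of
  \<open>k r\<^sup>k\<^sup>-\<^sup>1\<close> over those \<open>r\<close> in \<open>[0,1]\<close> with \<open>\<bar>y\<bar> < r\<close> and exchanging the integrals reduces it to balls of
  radius \<open>r\<close>, where homogeneity gives the factor \<open>r\<^sup>3\<close>.\<close>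

lemma integral_ball_moment:
  fixes f :: "real^3 \<Rightarrow> real"
  assumes f: "continuous_on unit_sphere f" and k: "k > 0"
  shows "integral\<^sup>L lborel (ball_moment k f) = sint f / (k + 3)"
proof -
  note [measurable] = borel_measurable_cone_ext[OF f]
  obtain B where B: "0 < B" "\<And>y. \<bar>cone_ext f y\<bar> \<le> B" using cone_ext_bounded[OF f] by blast
  let ?I = "sint f"
  define F where "F r y = indicator {0..1} r * (k * r ^ (k - 1)) * (indicator (ball 0 r) y * cone_ext f y)"
    for r :: real and y :: "real^3"
  have pw: "((\<lambda>r. k * r ^ (k - 1)) has_integral (1 ^ k - s ^ k)) {s..1::real}" if "0 \<le> s" "s \<le> 1" for s
    using that k
    by (intro fundamental_theorem_of_calculus) (auto simp: has_real_derivative_iff_has_vector_derivative[symmetric] intro!: derivative_eq_intros)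
  have in_r: "(\<integral>r. F r y \<partial>lborel) = indicator (ball 0 1) y * ((1 - norm y ^ k) * cone_ext f y)" for y
  proof -
    have "((\<lambda>r. F r y) has_integral (indicator (ball 0 1) y * ((1 - norm y ^ k) * cone_ext f y))) UNIV"
    proof (cases "norm y < 1")
      case True
      have "((\<lambda>r. k * r ^ (k - 1) * cone_ext f y) has_integral ((1 - norm y ^ k) * cone_ext f y)) {norm y..1}"
        using has_integral_mult_left[OF pw[of "norm y"]] True by simp
      then have "((\<lambda>r. if r \<in> {norm y..1} then k * r ^ (k - 1) * cone_ext f y else 0) has_integral ((1 - norm y ^ k) * cone_ext f y)) UNIV"
        by (simp only: has_integral_restrict_UNIV)
      then have "((\<lambda>r. F r y) has_integral ((1 - norm y ^ k) * cone_ext f y)) UNIV"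
        by (rule has_integral_spike[rotated 2, where S = "{norm y}"])
          (use True in \<open>auto simp: F_def indicator_def intro: order_trans[OF norm_ge_zero]\<close>)
      then show ?thesis using True by simp
    next
      case False
      then have "F r y = 0" for r by (auto simp: F_def indicator_def)
      then show ?thesis using False by simp
    qed
    moreover have "integrable lborel (\<lambda>r. F r y)"
    proof (rule Bochner_Integration.integrable_bound)
      show "integrable lborel (\<lambda>r. indicator {0..1::real} r * (k * B))" by (intro integrable_mult_left) auto
      show "AE r in lborel. norm (F r y) \<le> norm (indicator {0..1::real} r * (k * B))"
        using B by (intro AE_I2) (auto simp: F_def abs_mult indicator_def power_le_one intro!: mult_mono mult_left_le)
    qed (unfold F_def indicator_def mem_ball dist_0_norm, measurable)
    ultimately show ?thesis
      by (metis has_integral_integral_lborel has_integral_unique)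
  qed
  have mF: "(\<lambda>z. F (fst z) (snd z)) \<in> borel_measurable (lborel \<Otimes>\<^sub>M lborel)"
    unfolding F_def indicator_def mem_ball dist_0_norm by measurable
  have Fub: "(\<integral>r. (\<integral>y. F r y \<partial>lborel) \<partial>lborel) = (\<integral>y. (\<integral>r. F r y \<partial>lborel) \<partial>lborel)"
  proof (rule lborel_pair.Fubini_integral[symmetric], rule Bochner_Integration.integrable_bound)
    have [simp]: "indicator ({0..1} \<times> ball 0 1) z = indicator {0..1} (fst z) * (indicator (ball 0 1) (snd z) :: real)" for z :: "real \<times> (real^3)"
      by (cases z) (simp add: indicator_times)
    show "integrable (lborel \<Otimes>\<^sub>M lborel) (\<lambda>z::real \<times> (real^3). indicator ({0..1} \<times> ball 0 1) z * (k * B))"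
      using emeasure_lborel_ball_finite[of "0::real^3" 1]
      by (intro integrable_mult_left integrable_real_indicator)
         (auto simp: lborel.emeasure_pair_measure_Times ennreal_mult_less_top)
    show "AE z in lborel \<Otimes>\<^sub>M lborel. norm (case z of (r, y) \<Rightarrow> F r y) \<le> norm (indicator ({0..1} \<times> ball 0 1) z * (k * B))"
      using B by (intro AE_I2) (auto simp: F_def abs_mult indicator_def power_le_one intro!: mult_mono mult_left_le)
  qed (use mF in \<open>simp add: case_prod_unfold\<close>)
  have in_y: "(\<integral>y. F r y \<partial>lborel) = indicator {0..1} r * (r ^ (k + 2) * (k * ?I / 3))" for r
  proof (cases "0 < r")
    case True
    have "(\<integral>y. F r y \<partial>lborel) = indicator {0..1} r * (k * r ^ (k - 1)) * (r ^ 3 / 3 * ?I)"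
      unfolding F_def by (simp only: integral_mult_right_zero integral_ball_cone_ext[OF f True])
    moreover have "r ^ (k + 2) = r ^ (k - 1) * r ^ 3" using k by (simp flip: power_add)
    ultimately show ?thesis by simp
  qed (use k in \<open>auto simp: F_def indicator_def\<close>)
  have "((\<lambda>r. r ^ (k + 2) * (k * ?I / 3)) has_integral ((1 ^ (k + 3) / (k + 3) - 0 ^ (k + 3) / (k + 3)) * (k * ?I / 3))) {0..1::real}"
    by (intro has_integral_mult_left fundamental_theorem_of_calculus)
      (auto simp: has_real_derivative_iff_has_vector_derivative[symmetric] intro!: derivative_eq_intros)
  moreover have "(1 ^ (k + 3) / (k + 3) - 0 ^ (k + 3) / (k + 3)) * (k * ?I / 3) = k * ?I / (3 * (k + 3))"
    by (simp add: power_0_left field_simps)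
  ultimately have "((\<lambda>r. if r \<in> {0..1} then r ^ (k + 2) * (k * ?I / 3) else 0) has_integral (k * ?I / (3 * (k + 3)))) UNIV"
    by (simp only: has_integral_restrict_UNIV)
  moreover have "(\<lambda>r. if r \<in> {0..1} then r ^ (k + 2) * (k * ?I / 3) else 0) = (\<lambda>r. indicator {0..1} r * (r ^ (k + 2) * (k * ?I / 3)))"
    by (auto simp: fun_eq_iff)
  ultimately have hi: "((\<lambda>r. indicator {0..1} r * (r ^ (k + 2) * (k * ?I / 3))) has_integral (k * ?I / (3 * (k + 3)))) UNIV"
    by (simp only:)
  have "continuous_on {0..1} (\<lambda>r::real. r ^ (k + 2) * (k * ?I / 3))" by (intro continuous_intros)
  from borel_integrable_compact[OF compact_Icc this]
  have "integrable lborel (\<lambda>r. indicator {0..1} r * (r ^ (k + 2) * (k * ?I / 3)))" by simp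
  from has_integral_unique[OF has_integral_integral_lborel[OF this] hi]
  have R: "(\<integral>r. (\<integral>y. F r y \<partial>lborel) \<partial>lborel) = k * ?I / (3 * (k + 3))"
    unfolding in_y .
  have "(\<integral>y. (\<integral>r. F r y \<partial>lborel) \<partial>lborel) = (\<integral>y. ball_moment 0 f y - ball_moment k f y \<partial>lborel)"
    unfolding in_r by (intro Bochner_Integration.integral_cong) (auto simp: ball_moment_def algebra_simps)
  also have "\<dots> = ?I / 3 - integral\<^sup>L lborel (ball_moment k f)"
    using integral_unit_sphere[OF f]
    by (subst Bochner_Integration.integral_diff[OF integrable_ball_moment[OF f] integrable_ball_moment[OF f]]) (simp add: ball_moment_def[abs_def])
  finally have "integral\<^sup>L lborel (ball_moment k f) = ?I / 3 - k * ?I / (3 * (k + 3))"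
    using R Fub by simp
  also have "\<dots> = ?I / (k + 3)" by (simp add: field_simps)
  finally show ?thesis .
qed

text \<open>\<open>F\<close> stands for the kernels, which are continuous; the densities need only be integrable.\<close>

lemma Fubini_area_on:
  fixes F :: "real^3 \<Rightarrow> real^3 \<Rightarrow> real"
  assumes F: "continuous_on (unit_sphere \<times> unit_sphere) (\<lambda>(x, y). F x y)"
    and A: "A \<subseteq> unit_sphere" "A \<in> sets borel" and B: "B \<subseteq> unit_sphere" "B \<in> sets borel"
    and u: "integrable (area_on A) u" and v: "integrable (area_on B) v"
  shows "(\<integral>x. (\<integral>y. F x y * (u x * v y) \<partial>area_on B) \<partial>area_on A) = (\<integral>y. (\<integral>x. F x y * (u x * v y) \<partial>area_on A) \<partial>area_on B)"
proof -
  interpret a: finite_measure "area_on A" using A by simp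
  interpret b: finite_measure "area_on B" using B by simp
  interpret pair_sigma_finite "area_on A" "area_on B" ..
  have id: "(\<lambda>x. x) \<in> borel_measurable (area_on C)" for C
    by (rule measurable_area_on_continuous[where S = C]) auto
  obtain M where M: "\<And>x y. x \<in> unit_sphere \<Longrightarrow> y \<in> unit_sphere \<Longrightarrow> \<bar>F x y\<bar> \<le> M"
    using continuous_on_compact_bound[OF compact_Times[OF compact_sphere compact_sphere] F]
    by (smt (verit) case_prod_conv mem_Sigma_iff real_norm_def)
  have m1: "(\<lambda>z. (fst z, snd z)) \<in> area_on A \<Otimes>\<^sub>M area_on B \<rightarrow>\<^sub>M restrict_space borel (unit_sphere \<times> unit_sphere)"
    using A B measurable_compose[OF measurable_fst[of "area_on A" "area_on B"] id] measurable_compose[OF measurable_snd[of "area_on A" "area_on B"] id]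
    by (intro measurable_restrict_space2 borel_measurable_Pair) (auto simp: space_pair_measure)
  have m2: "(\<lambda>z. F (fst z) (snd z)) \<in> borel_measurable (area_on A \<Otimes>\<^sub>M area_on B)"
    using measurable_compose[OF m1 borel_measurable_continuous_on_restrict[OF F]] by simp
  have iu: "integrable (area_on A \<Otimes>\<^sub>M area_on B) (\<lambda>z. u (fst z) * v (snd z))"
  proof (rule Fubini_integrable)
    have [measurable]: "u \<in> borel_measurable (area_on A)" "v \<in> borel_measurable (area_on B)"
      using u v by auto
    show "(\<lambda>z. u (fst z) * v (snd z)) \<in> borel_measurable (area_on A \<Otimes>\<^sub>M area_on B)"
      by measurable
  qed (use u v in \<open>auto simp: abs_mult\<close>)
  have "integrable (area_on A \<Otimes>\<^sub>M area_on B) (\<lambda>z. F (fst z) (snd z) * (u (fst z) * v (snd z)))"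
  proof (rule Bochner_Integration.integrable_bound[OF integrable_mult_right[OF iu, of M]])
    show "AE z in area_on A \<Otimes>\<^sub>M area_on B. norm (F (fst z) (snd z) * (u (fst z) * v (snd z))) \<le> norm (M * (u (fst z) * v (snd z)))"
      using M A B by (intro AE_I2) (auto simp: space_pair_measure abs_mult intro!: mult_right_mono order_trans[OF M abs_ge_self])
  qed (use m2 iu in auto)
  then show ?thesis
    by (intro Fubini_integral[symmetric]) (simp add: case_prod_unfold)
qed

lemma continuous_on_kernel_integral:
  fixes F :: "real^3 \<Rightarrow> real^3 \<Rightarrow> real" and u :: "real^3 \<Rightarrow> 'b::{banach, second_countable_topology}"
  assumes F: "continuous_on (unit_sphere \<times> unit_sphere) (\<lambda>(x, y). F x y)"
    and A: "A \<subseteq> unit_sphere" "A \<in> sets borel" and u: "integrable (area_on A) u"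
  shows "continuous_on unit_sphere (\<lambda>x. \<integral>y. F x y *\<^sub>R u y \<partial>area_on A)"
proof -
  obtain M where M: "\<And>x y. x \<in> unit_sphere \<Longrightarrow> y \<in> unit_sphere \<Longrightarrow> \<bar>F x y\<bar> \<le> M"
    using continuous_on_compact_bound[OF compact_Times[OF compact_sphere compact_sphere] F]
    by (smt (verit) case_prod_conv mem_Sigma_iff real_norm_def)
  have cF: "continuous_on unit_sphere (\<lambda>y. F x y)" if "x \<in> unit_sphere" for x
    using continuous_on_compose2[OF F, of unit_sphere "\<lambda>y. (x, y)"] that
    by (simp add: continuous_on_Pair continuous_on_const continuous_on_id image_subset_iff)
  have cF': "continuous_on unit_sphere (\<lambda>x. F x y)" if "y \<in> unit_sphere" for y
    using continuous_on_compose2[OF F, of unit_sphere "\<lambda>x. (x, y)"] that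
    by (simp add: continuous_on_Pair continuous_on_const continuous_on_id image_subset_iff)
  show ?thesis unfolding continuous_on_sequentially comp_def
  proof (safe)
    fix X :: "nat \<Rightarrow> real^3" and x assume X: "\<forall>n. X n \<in> unit_sphere" and x: "x \<in> unit_sphere" and lim: "X \<longlonglongrightarrow> x"
    have [measurable]: "u \<in> borel_measurable (area_on A)" using u by auto
    have m: "(\<lambda>y. F x y *\<^sub>R u y) \<in> borel_measurable (area_on A)" if "x \<in> unit_sphere" for x
      using measurable_area_on_continuous[OF cF[OF that] A(1)] by measurable
    show "(\<lambda>n. \<integral>y. F (X n) y *\<^sub>R u y \<partial>area_on A) \<longlonglongrightarrow> (\<integral>y. F x y *\<^sub>R u y \<partial>area_on A)"
    proof (rule integral_dominated_convergence[where w="\<lambda>y. M * norm (u y)"])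
      show "AE y in area_on A. (\<lambda>n. F (X n) y *\<^sub>R u y) \<longlonglongrightarrow> F x y *\<^sub>R u y"
        using A X x lim cF' by (intro AE_I2 tendsto_scaleR tendsto_const) (auto simp: continuous_on_sequentially comp_def subset_iff)
      show "AE y in area_on A. norm (F (X n) y *\<^sub>R u y) \<le> M * norm (u y)" for n
        using X A M by (intro AE_I2) (auto intro!: mult_right_mono)
    qed (use u m X x in auto)
  qed
qed


section \<open>Differentiable functions on the sphere and the divergence theorem\<close>

text \<open>\<open>G\<close> is the tangential gradient of \<open>h\<close>, and it is continuous on the sphere. The derivative is that of
  the degree-zero homogeneous extension, in accordance with \<^const>\<open>sphere_grad\<close>.\<close>

definition sphere_C1 :: "(real^3 \<Rightarrow> real) \<Rightarrow> (real^3 \<Rightarrow> real^3) \<Rightarrow> bool" where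
  "sphere_C1 h G \<longleftrightarrow> continuous_on unit_sphere G \<and>
     (\<forall>x\<in>unit_sphere. ((\<lambda>y. h (sgn y)) has_derivative (\<lambda>v. G x \<bullet> v)) (at x))"

lemma sphere_C1_has_derivative:
  assumes "sphere_C1 h G" "y \<noteq> 0"
  shows "((\<lambda>z. h (sgn z)) has_derivative (\<lambda>v. G (sgn y) \<bullet> v / norm y)) (at y)"
proof -
  have d1: "((\<lambda>z. h (sgn z)) has_derivative (\<lambda>v. G (sgn y) \<bullet> v)) (at ((1 / norm y) *\<^sub>R y))"
    using assms by (auto simp: sphere_C1_def norm_sgn sgn_div_norm inverse_eq_divide)
  have d2: "((\<lambda>z. (1 / norm y) *\<^sub>R z) has_derivative (\<lambda>v. (1 / norm y) *\<^sub>R v)) (at y)"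
    by (auto intro!: derivative_eq_intros)
  have "((\<lambda>z. h (sgn ((1 / norm y) *\<^sub>R z))) has_derivative (\<lambda>v. G (sgn y) \<bullet> ((1 / norm y) *\<^sub>R v))) (at y)"
    by (rule has_derivative_compose[OF d2 d1])
  then show ?thesis using assms(2) by (simp add: sgn_scaleR)
qed

lemma sphere_C1_imp_continuous_on:
  assumes "sphere_C1 h G" shows "continuous_on unit_sphere h"
proof -
  have "continuous_on unit_sphere (\<lambda>y. h (sgn y))"
    using assms by (intro continuous_at_imp_continuous_on ballI) (auto simp: sphere_C1_def intro: has_derivative_continuous)
  moreover have "sgn y = y" if "y \<in> unit_sphere" for y :: "real^3"
    using that by (simp add: sgn_div_norm)
  ultimately show ?thesis by (metis (no_types, lifting) continuous_on_eq)
qed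

lemma sphere_C1_tangential:
  assumes "sphere_C1 h G" "x \<in> unit_sphere" shows "G x \<bullet> x = 0"
proof -
  have [simp]: "sgn x = x" "x \<noteq> 0" using assms by (auto simp: sgn_div_norm)
  have "((\<lambda>t. h (sgn (t *\<^sub>R x))) has_derivative (\<lambda>t. G x \<bullet> (t *\<^sub>R x))) (at 1)"
    using assms by (intro has_derivative_compose[where g = "\<lambda>y. h (sgn y)" and f = "\<lambda>t. t *\<^sub>R x"])
      (auto simp: sphere_C1_def intro!: derivative_eq_intros)
  moreover have "((\<lambda>t. h (sgn (t *\<^sub>R x))) has_derivative (\<lambda>t. 0)) (at 1)"
    by (rule has_derivative_transform_within_open[where s = "{0<..}" and f = "\<lambda>_. h x"]) (auto simp: sgn_scaleR)
  ultimately have "(\<lambda>t. G x \<bullet> (t *\<^sub>R x)) = (\<lambda>t. 0)" by (rule has_derivative_unique)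
  from fun_cong[OF this, of 1] show ?thesis by simp
qed

lemma has_derivative_zero_of_quadratic_bound:
  fixes F :: "'a::real_normed_vector \<Rightarrow> real"
  assumes "F y = 0" "\<And>z. \<bar>F z\<bar> \<le> B * norm (z - y) ^ 2"
  shows "(F has_derivative (\<lambda>_. 0)) (at y)"
proof (rule has_derivativeI_sandwich[where e = 1 and H = "\<lambda>z. B * norm (z - y)"])
  show "norm (F z - F y - 0) / norm (z - y) \<le> B * norm (z - y)" if "z \<noteq> y" for z
    using assms(1) assms(2)[of z] that by (simp add: field_simps power2_eq_square)
  show "((\<lambda>z. B * norm (z - y)) \<longlongrightarrow> 0) (at y)"
    by (auto intro!: tendsto_eq_intros)
qed auto

text \<open>The divergence theorem for the tangential part of the constant field \<open>a\<close>, whose divergence is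
  \<open>- 2 (x \<bullet> a)\<close>. It follows from the invariance of Lebesgue measure under translations: the integral of
  \<open>F (y + t a) - F y\<close> vanishes for \<open>F y = \<psi>(\<bar>y\<bar>) h (y / \<bar>y\<bar>)\<close>, so the integral of the derivative of \<open>F\<close> in
  the direction \<open>a\<close> vanishes as well, and the radial integrals separate. All integrations by parts
  on the sphere used below are instances of this identity.\<close>

lemma integral_sphere_directional_derivative:
  assumes h: "sphere_C1 h G"
  shows "(\<integral>x. G x \<bullet> a \<partial>area_on unit_sphere) = 2 * (\<integral>x. h x * (x \<bullet> a) \<partial>area_on unit_sphere)"
proof -
  have ch: "continuous_on unit_sphere h" and cG: "continuous_on unit_sphere G"
    using h sphere_C1_imp_continuous_on by (auto simp: sphere_C1_def)
  obtain B where B: "0 \<le> B" "\<And>x. x \<in> unit_sphere \<Longrightarrow> \<bar>h x\<bar> \<le> B"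
    using continuous_on_compact_bound[OF compact_sphere ch] by (metis real_norm_def)
  obtain C where C: "0 \<le> C" "\<And>x. x \<in> unit_sphere \<Longrightarrow> norm (G x) \<le> C"
    using continuous_on_compact_bound[OF compact_sphere cG] by metis
  \<comment> \<open>The profile \<open>r\<^sup>2 (1 - r)\<^sup>2\<close> vanishes to second order at both ends, so that \<open>F\<close> is differentiable everywhere.\<close>
  define F where "F y = (if norm y < 1 then (norm y ^ 2 * (1 - norm y) ^ 2) * h (sgn y) else 0)" for y :: "real^3"
  define F' where "F' y v = (if y \<noteq> 0 \<and> norm y < 1 then
      (2 * norm y - 6 * norm y ^ 2 + 4 * norm y ^ 3) * (h (sgn y) * (sgn y \<bullet> v))
      + (norm y - 2 * norm y ^ 2 + norm y ^ 3) * (G (sgn y) \<bullet> v) else 0)" for y v :: "real^3"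
  have hB: "\<bar>h (sgn y)\<bar> \<le> B" if "y \<noteq> 0" for y using B(2)[of "sgn y"] that by (simp add: norm_sgn)
  have GC: "norm (G (sgn y)) \<le> C" if "y \<noteq> 0" for y using C(2)[of "sgn y"] that by (simp add: norm_sgn)
  have F0: "\<bar>F z\<bar> \<le> B * norm z ^ 2" for z
  proof (cases "z = 0 \<or> norm z \<ge> 1")
    case False
    then have "(1 - norm z) ^ 2 \<le> 1" by (intro power_le_one) auto
    with False hB[of z] B show ?thesis
      by (auto simp: F_def abs_mult mult.commute[of _ B] intro!: mult_mono order_trans[OF mult_left_le_one_le])
  qed (use B in \<open>auto simp: F_def\<close>)
  have F1: "\<bar>F z\<bar> \<le> B * norm (z - y) ^ 2" if "norm y = 1" for y z
  proof (cases "z = 0 \<or> norm z \<ge> 1")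
    case False
    then have "norm z ^ 2 \<le> 1" by (intro power_le_one) auto
    moreover have "(1 - norm z) ^ 2 \<le> norm (z - y) ^ 2"
      using norm_triangle_ineq3[of y z] that False by (intro power_mono) (auto simp: norm_minus_commute)
    ultimately have "norm z ^ 2 * (1 - norm z) ^ 2 \<le> 1 * norm (z - y) ^ 2"
      by (intro mult_mono) auto
    then have "(norm z ^ 2 * (1 - norm z) ^ 2) * \<bar>h (sgn z)\<bar> \<le> norm (z - y) ^ 2 * B"
      using False hB[of z] by (intro mult_mono) auto
    with False show ?thesis by (simp add: F_def abs_mult mult.commute[of B])
  qed (use B in \<open>auto simp: F_def\<close>)
  have der: "(F has_derivative F' y) (at y)" for y
  proof -
    consider "y = 0" | "norm y = 1" | "norm y > 1" | "y \<noteq> 0" "norm y < 1" by fastforce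
    then show ?thesis
    proof cases
      case 1
      then show ?thesis using has_derivative_zero_of_quadratic_bound[of F y B] F0 by (simp add: F'_def[abs_def] F_def)
    next
      case 2
      then show ?thesis using has_derivative_zero_of_quadratic_bound[of F y B] F1[OF 2] by (simp add: F'_def[abs_def] F_def)
    next
      case 3
      then have "(F has_derivative (\<lambda>_. 0)) (at y)"
        by (intro has_derivative_transform_within_open[OF has_derivative_const, where s = "- cball 0 1"])
          (use 3 in \<open>auto simp: F_def\<close>)
      then show ?thesis using 3 by (simp add: F'_def[abs_def])
    next
      case 4
      have "((\<lambda>z. (norm z ^ 2 * (1 - norm z) ^ 2) * h (sgn z)) has_derivative F' y) (at y)"
        by (rule derivative_eq_intros has_derivative_norm sphere_C1_has_derivative[OF h] refl 4)+
          (use 4 in \<open>auto simp: F'_def fun_eq_iff field_simps power2_eq_square power3_eq_cube inner_commute[of _ "sgn y"]\<close>)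
      then show ?thesis
        by (rule has_derivative_transform_within_open[where s = "ball 0 1"]) (use 4 in \<open>auto simp: F_def\<close>)
    qed
  qed
  define M where "M = 12 * B + 4 * C"
  have bnd: "\<bar>F' y v\<bar> \<le> M * norm v" for y v
  proof (cases "y \<noteq> 0 \<and> norm y < 1")
    case True
    then have p: "0 \<le> norm y ^ k" "norm y ^ k \<le> 1" for k by (auto intro: power_le_one)
    have "\<bar>2 * norm y - 6 * norm y ^ 2 + 4 * norm y ^ 3\<bar> \<le> 12"
      using p[of 1] p[of 2] p[of 3] unfolding abs_le_iff power_one_right by linarith
    moreover have "\<bar>norm y - 2 * norm y ^ 2 + norm y ^ 3\<bar> \<le> 4"
      using p[of 1] p[of 2] p[of 3] unfolding abs_le_iff power_one_right by linarith
    moreover have "\<bar>h (sgn y) * (sgn y \<bullet> v)\<bar> \<le> B * norm v"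
      using True hB[of y] Cauchy_Schwarz_ineq2[of "sgn y" v] B by (auto simp: abs_mult norm_sgn intro!: mult_mono)
    moreover have "\<bar>G (sgn y) \<bullet> v\<bar> \<le> C * norm v"
      using True GC[of y] Cauchy_Schwarz_ineq2[of "G (sgn y)" v] by (meson mult_right_mono norm_ge_zero order_trans)
    ultimately have "\<bar>F' y v\<bar> \<le> 12 * (B * norm v) + 4 * (C * norm v)"
      using True B C unfolding F'_def
      by (auto simp: abs_mult intro!: order_trans[OF abs_triangle_ineq] add_mono mult_mono)
    then show ?thesis by (simp add: M_def algebra_simps)
  qed (use B C in \<open>auto simp: F'_def M_def\<close>)
  have lip: "\<bar>F y - F z\<bar> \<le> M * norm (y - z)" for y z
    using differentiable_bound[of UNIV F F' M y z] der bnd by (simp add: onorm_le)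
  have F_cont: "continuous_on UNIV F"
    using der has_derivative_continuous by (intro continuous_at_imp_continuous_on) blast
  then have F_meas [measurable]: "F \<in> borel_measurable borel" by (rule borel_measurable_continuous_onI)
  have F_supp: "F y = 0" if "norm y \<ge> 1" for y using that by (simp add: F_def)
  have F_int: "integrable lborel F"
  proof (rule Bochner_Integration.integrable_bound[OF integrable_ball_const[of 1 B]])
    have "\<bar>F y\<bar> \<le> indicator (ball 0 1) y * B" for y
      using F0[of y] B power_le_one[of "norm y" 2] F_supp[of y]
      by (cases "norm y < 1") (auto intro: order_trans[OF _ mult_left_le])
    then show "AE y in lborel. norm (F y) \<le> norm (indicator (ball 0 1) y * B)"
      using B by (intro AE_I2) (simp add: abs_mult)
  qed simp
  have "(\<lambda>n. \<integral>y. (F (y + (1 / Suc n) *\<^sub>R a) - F y) * Suc n \<partial>lborel) \<longlonglongrightarrow> (\<integral>y. F' y a \<partial>lborel)"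
  proof (rule integral_dominated_convergence[OF _ _ integrable_ball_const[of "1 + norm a" "M * norm a"]])
    have *: "(\<lambda>n. (F (y + (1 / Suc n) *\<^sub>R a) - F y) * Suc n) \<longlonglongrightarrow> F' y a" for y
    proof -
      have "((\<lambda>t. F (y + t *\<^sub>R a)) has_derivative (\<lambda>t. F' y (t *\<^sub>R a))) (at 0)"
        using der by (intro has_derivative_compose[where g = F and f = "\<lambda>t. y + t *\<^sub>R a"]) (auto intro!: derivative_eq_intros)
      moreover have "F' y (t *\<^sub>R a) = F' y a * t" for t by (simp add: F'_def algebra_simps)
      ultimately have "((\<lambda>t. F (y + t *\<^sub>R a)) has_real_derivative F' y a) (at 0)"
        by (simp add: has_field_derivative_def)
      then have "((\<lambda>t. (F (y + t *\<^sub>R a) - F y) / t) \<longlongrightarrow> F' y a) (at 0)"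
        by (simp add: has_field_derivative_iff)
      moreover have "filterlim (\<lambda>n. 1 / real (Suc n)) (at 0) sequentially"
        using LIMSEQ_Suc[OF lim_1_over_n[where 'a=real]] by (auto simp: filterlim_at)
      ultimately have "(\<lambda>n. (F (y + (1 / Suc n) *\<^sub>R a) - F y) / (1 / Suc n)) \<longlonglongrightarrow> F' y a"
        by (rule filterlim_compose)
      then show ?thesis by (simp only: divide_divide_eq_right div_by_1)
    qed
    then show "AE y in lborel. (\<lambda>n. (F (y + (1 / Suc n) *\<^sub>R a) - F y) * Suc n) \<longlonglongrightarrow> F' y a" by simp
    show "(\<lambda>y. F' y a) \<in> borel_measurable lborel"
      by (rule borel_measurable_LIMSEQ_real[OF *]) measurable
    show "AE y in lborel. norm ((F (y + (1 / Suc n) *\<^sub>R a) - F y) * Suc n) \<le> indicator (ball 0 (1 + norm a)) y * (M * norm a)" for n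
    proof (intro AE_I2)
      fix y :: "real^3"
      have 1: "norm ((F (y + (1 / Suc n) *\<^sub>R a) - F y) * Suc n) \<le> M * norm a"
      proof -
        have "\<bar>F (y + (1 / Suc n) *\<^sub>R a) - F y\<bar> \<le> M * norm a / Suc n"
          using lip[of "y + (1 / Suc n) *\<^sub>R a" y] by simp
        then have "\<bar>F (y + (1 / Suc n) *\<^sub>R a) - F y\<bar> * Suc n \<le> M * norm a"
          by (subst (asm) pos_le_divide_eq) simp_all
        then show ?thesis by (simp only: real_norm_def abs_mult abs_of_nat)
      qed
      show "norm ((F (y + (1 / Suc n) *\<^sub>R a) - F y) * Suc n) \<le> indicator (ball 0 (1 + norm a)) y * (M * norm a)"
      proof (cases "norm y < 1 + norm a")
        case False
        have "norm ((1 / Suc n) *\<^sub>R a) \<le> norm a" by (simp add: field_simps)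
        then have "norm (y + (1 / Suc n) *\<^sub>R a) \<ge> 1"
          using False norm_triangle_ineq2[of y "- ((1 / Suc n) *\<^sub>R a)"] by simp
        moreover have "norm y \<ge> 1" using False norm_ge_zero[of a] by linarith
        ultimately show ?thesis using False by (simp add: F_supp)
      qed (use 1 in simp)
    qed
  qed measurable
  moreover have "(\<integral>y. (F (y + (1 / Suc n) *\<^sub>R a) - F y) * Suc n \<partial>lborel) = 0" for n
  proof -
    let ?c = "(1 / Suc n) *\<^sub>R a"
    have "integrable (distr lborel borel ((+) ?c)) F" using F_int by (simp only: lborel_distr_plus)
    then have 1: "integrable lborel (\<lambda>y. F (y + ?c))"
      by (subst (asm) integrable_distr_eq) (auto simp: add.commute)
    have "(\<integral>y. F (y + ?c) \<partial>lborel) = integral\<^sup>L (distr lborel borel ((+) ?c)) F"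
      by (subst integral_distr) (auto simp: add.commute)
    then have "(\<integral>y. F (y + ?c) \<partial>lborel) = integral\<^sup>L lborel F" by (simp only: lborel_distr_plus)
    then show ?thesis using 1 F_int by simp
  qed
  ultimately have Z: "(\<integral>y. F' y a \<partial>lborel) = 0" by (simp add: LIMSEQ_const_iff)
  define h1 where "h1 x = h x * (x \<bullet> a)" for x
  define h2 where "h2 x = G x \<bullet> a" for x
  have c1: "continuous_on unit_sphere h1" unfolding h1_def by (intro continuous_intros ch)
  have c2: "continuous_on unit_sphere h2" unfolding h2_def by (intro continuous_intros cG)
  have "F' y a = (2 * ball_moment 1 h1 y - 6 * ball_moment 2 h1 y + 4 * ball_moment 3 h1 y) + (ball_moment 1 h2 y - 2 * ball_moment 2 h2 y + ball_moment 3 h2 y)" for y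
    by (cases "y = 0") (simp_all add: F'_def ball_moment_def cone_ext_nonzero h1_def h2_def indicator_def algebra_simps)
  then have "(\<integral>y. F' y a \<partial>lborel) = (2 * (integral\<^sup>L lborel (ball_moment 1 h1)) - 6 * (integral\<^sup>L lborel (ball_moment 2 h1)) + 4 * (integral\<^sup>L lborel (ball_moment 3 h1)))
    + (integral\<^sup>L lborel (ball_moment 1 h2) - 2 * integral\<^sup>L lborel (ball_moment 2 h2) + integral\<^sup>L lborel (ball_moment 3 h2))"
    using integrable_ball_moment[OF c1] integrable_ball_moment[OF c2] by simp
  \<comment> \<open>The moments of order 1, 2, 3 are 1/4, 1/5, 1/6: \<open>2/4 - 6/5 + 4/6 = -1/30\<close> and \<open>1/4 - 2/5 + 1/6 = 1/60\<close>.\<close>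
  then have "0 = - sint h1 / 30 + sint h2 / 60"
    unfolding Z using integral_ball_moment[OF c1] integral_ball_moment[OF c2] by simp
  then show ?thesis by (simp add: h1_def[abs_def] h2_def[abs_def])
qed

lemma integrable_sphere [simp]:
  fixes f :: "real^3 \<Rightarrow> 'b::{banach, second_countable_topology}"
  shows "continuous_on unit_sphere f \<Longrightarrow> integrable (area_on unit_sphere) f"
  by (rule integrable_area_on_continuous) auto

lemma sint_cong: "(\<And>x. x \<in> unit_sphere \<Longrightarrow> f x = g x) \<Longrightarrow> sint f = sint g"
  by (rule Bochner_Integration.integral_cong) auto

lemma continuous_on_zonal [continuous_intros]:
  "continuous_on A f \<Longrightarrow> continuous_on A g \<Longrightarrow> continuous_on A (\<lambda>x. poly p (f x \<bullet> g x))" for f g :: "'a::topological_space \<Rightarrow> real^3"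
  by (intro continuous_on_poly continuous_on_inner)

section \<open>Zonal functions and Green's formula\<close>

lemma sphere_C1_mult:
  assumes "sphere_C1 f F" "sphere_C1 g G"
  shows "sphere_C1 (\<lambda>x. f x * g x) (\<lambda>x. f x *\<^sub>R G x + g x *\<^sub>R F x)"
  unfolding sphere_C1_def
proof
  show "continuous_on unit_sphere (\<lambda>x. f x *\<^sub>R G x + g x *\<^sub>R F x)"
    using assms sphere_C1_imp_continuous_on[OF assms(1)] sphere_C1_imp_continuous_on[OF assms(2)]
    by (auto simp: sphere_C1_def intro!: continuous_intros)
  show "\<forall>x\<in>unit_sphere. ((\<lambda>y. f (sgn y) * g (sgn y)) has_derivative (\<lambda>v. (f x *\<^sub>R G x + g x *\<^sub>R F x) \<bullet> v)) (at x)"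
  proof
    fix x :: "real^3" assume x: "x \<in> unit_sphere"
    then have [simp]: "sgn x = x" by (simp add: sgn_div_norm)
    have "((\<lambda>y. f (sgn y) * g (sgn y)) has_derivative (\<lambda>v. f (sgn x) * (G x \<bullet> v) + (F x \<bullet> v) * g (sgn x))) (at x)"
      using assms x by (intro has_derivative_mult) (auto simp: sphere_C1_def)
    then show "((\<lambda>y. f (sgn y) * g (sgn y)) has_derivative (\<lambda>v. (f x *\<^sub>R G x + g x *\<^sub>R F x) \<bullet> v)) (at x)"
      by (simp add: inner_left_distrib mult.commute)
  qed
qed

lemma sphere_C1_uminus:
  assumes "sphere_C1 f F"
  shows "sphere_C1 (\<lambda>x. f (- x)) (\<lambda>x. - F (- x))"
  unfolding sphere_C1_def
proof
  show "continuous_on unit_sphere (\<lambda>x. - F (- x))"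
    using assms by (auto simp: sphere_C1_def intro!: continuous_intros continuous_on_compose2[of unit_sphere F])
  show "\<forall>x\<in>unit_sphere. ((\<lambda>y. f (- sgn y)) has_derivative (\<lambda>v. - F (- x) \<bullet> v)) (at x)"
  proof
    fix x :: "real^3" assume x: "x \<in> unit_sphere"
    have 1: "((\<lambda>y. f (sgn y)) has_derivative (\<lambda>v. F (- x) \<bullet> v)) (at (- x))"
      using assms x by (auto simp: sphere_C1_def)
    have 2: "((\<lambda>y. - y) has_derivative (\<lambda>v. - v)) (at x)" by (auto intro!: derivative_eq_intros)
    show "((\<lambda>y. f (- sgn y)) has_derivative (\<lambda>v. - F (- x) \<bullet> v)) (at x)"
      using has_derivative_compose[OF 2 1] by (simp add: sgn_minus)
  qed
qed

lemma sphere_C1_add_cmult: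
  assumes "sphere_C1 f F" "sphere_C1 g G"
  shows "sphere_C1 (\<lambda>x. f x + c * g x) (\<lambda>x. F x + c *\<^sub>R G x)"
  using assms unfolding sphere_C1_def
  by (auto intro!: continuous_intros derivative_eq_intros simp: inner_left_distrib)

lemma sphere_C1_zonal:
  "sphere_C1 (\<lambda>x. poly p (x \<bullet> a)) (\<lambda>x. poly (pderiv p) (x \<bullet> a) *\<^sub>R (a - (x \<bullet> a) *\<^sub>R x))"
  unfolding sphere_C1_def
proof (intro conjI ballI)
  fix x :: "real^3" assume x: "x \<in> unit_sphere"
  have [simp]: "norm x = 1" "sgn x = x" "x \<noteq> 0" "x \<bullet> x = 1"
    using x by (auto simp: sgn_div_norm dot_square_norm)
  have "((\<lambda>y. y /\<^sub>R norm y) has_derivative (\<lambda>h. h - (x \<bullet> h) *\<^sub>R x)) (at x)"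
    using has_derivative_norm[OF \<open>x \<noteq> 0\<close>]
    by (auto intro!: derivative_eq_intros simp: fun_eq_iff inner_commute)
  then have s: "(sgn has_derivative (\<lambda>h. h - (x \<bullet> h) *\<^sub>R x)) (at x)"
    by (simp add: sgn_div_norm[abs_def])
  then have s2: "((\<lambda>y. sgn y \<bullet> a) has_derivative (\<lambda>h. (h - (x \<bullet> h) *\<^sub>R x) \<bullet> a)) (at x)"
    by (rule has_derivative_inner_left)
  have p: "(poly p has_derivative (\<lambda>h. poly (pderiv p) (x \<bullet> a) * h)) (at (sgn x \<bullet> a))"
    using poly_DERIV[of p "x \<bullet> a"] by (simp add: has_field_derivative_def)
  show "((\<lambda>y. poly p (sgn y \<bullet> a)) has_derivative (\<lambda>v. poly (pderiv p) (x \<bullet> a) *\<^sub>R (a - (x \<bullet> a) *\<^sub>R x) \<bullet> v)) (at x)"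
  proof -
    have "(\<lambda>v. poly (pderiv p) (x \<bullet> a) * ((v - (x \<bullet> v) *\<^sub>R x) \<bullet> a)) = (\<lambda>v. poly (pderiv p) (x \<bullet> a) *\<^sub>R (a - (x \<bullet> a) *\<^sub>R x) \<bullet> v)"
      by (auto simp: fun_eq_iff inner_diff_left inner_diff_right inner_commute[of a] algebra_simps)
    then show ?thesis using has_derivative_compose[OF s2 p] by simp
  qed
qed (intro continuous_intros)

text \<open>The Laplace operator of the sphere acting on zonal functions \<open>p (x \<bullet> a)\<close>, as an operator on the
  profile \<open>p\<close>.\<close>

definition legendre_op :: "real poly \<Rightarrow> real poly" where
  "legendre_op p = [:1, 0, -1:] * pderiv (pderiv p) - [:0, 2:] * pderiv p"

text \<open>Apply the divergence theorem to \<open>f p' (x \<bullet> a)\<close> in the direction \<open>a\<close>: since \<open>G\<close> is tangential, only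
  the component of \<open>G\<close> along \<open>a\<close> meets the gradient of the zonal function.\<close>

lemma Green_zonal:
  assumes f: "sphere_C1 f G" and a: "a \<in> unit_sphere"
  shows "sint (\<lambda>x. G x \<bullet> (poly (pderiv p) (x \<bullet> a) *\<^sub>R (a - (x \<bullet> a) *\<^sub>R x))) = - sint (\<lambda>x. f x * poly (legendre_op p) (x \<bullet> a))"
proof -
  have aa: "a \<bullet> a = 1" using a by (simp add: dot_square_norm)
  have cf: "continuous_on unit_sphere f" and cG: "continuous_on unit_sphere G"
    using f sphere_C1_imp_continuous_on by (auto simp: sphere_C1_def)
  let ?q = "pderiv p" and ?r = "pderiv (pderiv p)"
  have "sint (\<lambda>x. (f x *\<^sub>R (poly ?r (x \<bullet> a) *\<^sub>R (a - (x \<bullet> a) *\<^sub>R x)) + poly ?q (x \<bullet> a) *\<^sub>R G x) \<bullet> a) = 2 * sint (\<lambda>x. f x * poly ?q (x \<bullet> a) * (x \<bullet> a))"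
    by (rule integral_sphere_directional_derivative[OF sphere_C1_mult[OF f sphere_C1_zonal]])
  moreover have "sint (\<lambda>x. (f x *\<^sub>R (poly ?r (x \<bullet> a) *\<^sub>R (a - (x \<bullet> a) *\<^sub>R x)) + poly ?q (x \<bullet> a) *\<^sub>R G x) \<bullet> a)
     = sint (\<lambda>x. f x * (poly ?r (x \<bullet> a) * (1 - (x \<bullet> a)^2))) + sint (\<lambda>x. poly ?q (x \<bullet> a) * (G x \<bullet> a))"
    by (subst Bochner_Integration.integral_add[symmetric])
      (auto intro!: integrable_sphere continuous_intros cf cG sint_cong simp: inner_left_distrib inner_diff_left aa power2_eq_square)
  moreover have "sint (\<lambda>x. f x * poly (legendre_op p) (x \<bullet> a)) =
     sint (\<lambda>x. f x * (poly ?r (x \<bullet> a) * (1 - (x \<bullet> a)^2)) - 2 * (f x * poly ?q (x \<bullet> a) * (x \<bullet> a)))"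
    by (rule sint_cong) (simp add: legendre_op_def algebra_simps power2_eq_square)
  moreover have "\<dots> = sint (\<lambda>x. f x * (poly ?r (x \<bullet> a) * (1 - (x \<bullet> a)^2))) - 2 * sint (\<lambda>x. f x * poly ?q (x \<bullet> a) * (x \<bullet> a))"
    by (subst Bochner_Integration.integral_diff)
      (auto intro!: integrable_sphere continuous_intros cf)
  moreover have "sint (\<lambda>x. G x \<bullet> (poly ?q (x \<bullet> a) *\<^sub>R (a - (x \<bullet> a) *\<^sub>R x))) = sint (\<lambda>x. poly ?q (x \<bullet> a) * (G x \<bullet> a))"
    by (rule sint_cong) (simp add: inner_diff_right sphere_C1_tangential[OF f])
  ultimately show ?thesis by simp
qed

text \<open>The divergence theorem for \<open>(w \<bullet> x)\<^sup>j (w \<bullet> a)\<^sup>k\<close> in the direction \<open>a\<close>. The recursion replaces rotation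
  invariance of the surface measure: it shows that such integrals depend on \<open>x \<bullet> a\<close> only. For \<open>j = 0\<close>
  or \<open>k = 0\<close> the truncated exponents come with the coefficient 0.\<close>

lemma moment_recursion:
  assumes x: "x \<in> unit_sphere" and a: "a \<in> unit_sphere"
  shows "(real j + real k + 2) * sint (\<lambda>w. (w \<bullet> x) ^ j * (w \<bullet> a) ^ Suc k) =
    j * (x \<bullet> a) * sint (\<lambda>w. (w \<bullet> x) ^ (j - 1) * (w \<bullet> a) ^ k) + k * sint (\<lambda>w. (w \<bullet> x) ^ j * (w \<bullet> a) ^ (k - 1))"
proof -
  have aa: "a \<bullet> a = 1" using a by (simp add: dot_square_norm)
  have z: "sphere_C1 (\<lambda>w. (w \<bullet> b) ^ n) (\<lambda>w. (n * (w \<bullet> b) ^ (n - 1)) *\<^sub>R (b - (w \<bullet> b) *\<^sub>R w))" for b and n :: nat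
    using sphere_C1_zonal[of "monom 1 n" b] by (simp add: pderiv_monom poly_monom)
  define A where "A j k w = (w \<bullet> x) ^ j * (w \<bullet> a) ^ k" for j k w
  have i: "integrable (area_on unit_sphere) (A j k)" for j k
    unfolding A_def[abs_def] by (intro integrable_sphere continuous_intros)
  have e1: "s ^ j * (k * t ^ (k - 1) * (1 - t * t)) + t ^ k * (j * s ^ (j - 1) * (c - s * t))
    = k * (s ^ j * t ^ (k - 1)) - k * (s ^ j * t ^ Suc k) + j * c * (s ^ (j - 1) * t ^ k) - j * (s ^ j * t ^ Suc k)" for s t c :: real
    by (cases j; cases k) (simp_all add: algebra_simps)
  have "sint (\<lambda>w. ((w \<bullet> x) ^ j *\<^sub>R ((k * (w \<bullet> a) ^ (k - 1)) *\<^sub>R (a - (w \<bullet> a) *\<^sub>R w))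
      + (w \<bullet> a) ^ k *\<^sub>R ((j * (w \<bullet> x) ^ (j - 1)) *\<^sub>R (x - (w \<bullet> x) *\<^sub>R w))) \<bullet> a)
    = 2 * sint (\<lambda>w. (w \<bullet> x) ^ j * (w \<bullet> a) ^ k * (w \<bullet> a))"
    by (rule integral_sphere_directional_derivative[OF sphere_C1_mult[OF z z]])
  moreover have "((w \<bullet> x) ^ j *\<^sub>R ((k * (w \<bullet> a) ^ (k - 1)) *\<^sub>R (a - (w \<bullet> a) *\<^sub>R w))
      + (w \<bullet> a) ^ k *\<^sub>R ((j * (w \<bullet> x) ^ (j - 1)) *\<^sub>R (x - (w \<bullet> x) *\<^sub>R w))) \<bullet> a
    = k * ((w \<bullet> x) ^ j * (w \<bullet> a) ^ (k - 1)) - k * ((w \<bullet> x) ^ j * (w \<bullet> a) ^ Suc k)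
      + j * (x \<bullet> a) * ((w \<bullet> x) ^ (j - 1) * (w \<bullet> a) ^ k) - j * ((w \<bullet> x) ^ j * (w \<bullet> a) ^ Suc k)" for w
    by (subst e1[symmetric]) (simp add: inner_left_distrib inner_diff_left aa)
  ultimately have "sint (\<lambda>w. k * A j (k - 1) w - k * A j (Suc k) w + j * (x \<bullet> a) * A (j - 1) k w - j * A j (Suc k) w) = 2 * sint (\<lambda>w. A j (Suc k) w)"
    by (simp add: A_def mult.assoc mult.commute[of "(_ \<bullet> a) ^ k"])
  then have "k * sint (A j (k - 1)) - k * sint (A j (Suc k)) + j * (x \<bullet> a) * sint (A (j - 1) k) - j * sint (A j (Suc k)) = 2 * sint (A j (Suc k))"
    using i by simp
  then show ?thesis by (simp add: algebra_simps A_def[abs_def])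
qed

section \<open>Convolution of zonal functions\<close>

lemma integral_monomials_zonal:
  "\<exists>m. degree m \<le> j \<and> (\<forall>x\<in>unit_sphere. \<forall>a\<in>unit_sphere. sint (\<lambda>w. (w \<bullet> x) ^ j * (w \<bullet> a) ^ k) = poly m (x \<bullet> a))"
proof -
  have base: "\<exists>c. \<forall>a\<in>unit_sphere. sint (\<lambda>w. (w \<bullet> a) ^ k) = c" for k
  proof (induction k rule: less_induct)
    case (less k)
    show ?case
    proof (cases k)
      case (Suc n)
      have "n - 1 < k" using Suc by simp
      from less[OF this] obtain c where c: "\<forall>a\<in>unit_sphere. sint (\<lambda>w. (w \<bullet> a) ^ (n - 1)) = c"
        by blast
      have "\<forall>a\<in>unit_sphere. sint (\<lambda>w. (w \<bullet> a) ^ Suc n) = n * c / (n + 2)"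
        using moment_recursion[of a a 0 n for a] c by (auto simp: field_simps)
      then show ?thesis using Suc by blast
    qed simp
  qed
  show ?thesis
  proof (induction "j + k" arbitrary: j k rule: less_induct)
    case less
    show ?case
    proof (cases k)
      case 0
      obtain c where "\<forall>a\<in>unit_sphere. sint (\<lambda>w. (w \<bullet> a) ^ j) = c" using base by blast
      then show ?thesis using 0 by (intro exI[of _ "[:c:]"]) auto
    next
      case (Suc n)
      have "j + (n - 1) < j + k" "(j - 1) + n < j + k" using Suc by auto
      note IH = less[OF this(1)] less[OF this(2)]
      from IH(1) obtain m1 where m1: "degree m1 \<le> j" "\<forall>x\<in>unit_sphere. \<forall>a\<in>unit_sphere. sint (\<lambda>w. (w \<bullet> x) ^ j * (w \<bullet> a) ^ (n - 1)) = poly m1 (x \<bullet> a)"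
        by blast
      from IH(2) obtain m2 where m2: "degree m2 \<le> j - 1" "\<forall>x\<in>unit_sphere. \<forall>a\<in>unit_sphere. sint (\<lambda>w. (w \<bullet> x) ^ (j - 1) * (w \<bullet> a) ^ n) = poly m2 (x \<bullet> a)"
        by blast
      define m where "m = smult (1 / (real j + real n + 2)) (smult j (pCons 0 m2) + smult n m1)"
      have d1: "degree (smult j (pCons 0 m2)) \<le> j"
        using m2(1) degree_pCons_le[of 0 m2] by (cases j) (auto intro: order_trans[OF degree_smult_le])
      have d2: "degree (smult n m1) \<le> j"
        using m1(1) degree_smult_le order_trans by blast
      have "degree m \<le> j"
        unfolding m_def by (rule order_trans[OF degree_smult_le degree_add_le[OF d1 d2]])
      moreover have "sint (\<lambda>w. (w \<bullet> x) ^ j * (w \<bullet> a) ^ k) = poly m (x \<bullet> a)" if "x \<in> unit_sphere" "a \<in> unit_sphere" for x a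
      proof -
        have "(real j + real n + 2) * sint (\<lambda>w. (w \<bullet> x) ^ j * (w \<bullet> a) ^ Suc n) = j * (x \<bullet> a) * poly m2 (x \<bullet> a) + n * poly m1 (x \<bullet> a)"
          using moment_recursion[OF that, of j n] m1(2) m2(2) that by simp
        then have "sint (\<lambda>w. (w \<bullet> x) ^ j * (w \<bullet> a) ^ Suc n) = (j * (x \<bullet> a) * poly m2 (x \<bullet> a) + n * poly m1 (x \<bullet> a)) / (real j + real n + 2)"
          by (simp add: eq_divide_eq mult.commute[of _ "real j + real n + 2"])
        then show ?thesis unfolding Suc m_def by (simp add: mult.assoc)
      qed
      ultimately show ?thesis by blast
    qed
  qed
qed

text \<open>The bound on the degree is what later identifies the convolution of two Legendre polynomials by
  orthogonality.\<close>

lemma zonal_convolution_exists: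
  "\<exists>m. degree m \<le> degree p \<and> (\<forall>x\<in>unit_sphere. \<forall>a\<in>unit_sphere. sint (\<lambda>w. poly p (w \<bullet> x) * poly q (w \<bullet> a)) = poly m (x \<bullet> a))"
proof -
  define m where "m j k = (SOME m. degree m \<le> j \<and> (\<forall>x\<in>unit_sphere. \<forall>a\<in>unit_sphere. sint (\<lambda>w. (w \<bullet> x) ^ j * (w \<bullet> a) ^ k) = poly m (x \<bullet> a)))" for j k
  have m: "degree (m j k) \<le> j" "x \<in> unit_sphere \<Longrightarrow> a \<in> unit_sphere \<Longrightarrow> sint (\<lambda>w. (w \<bullet> x) ^ j * (w \<bullet> a) ^ k) = poly (m j k) (x \<bullet> a)" for j k x a
    using someI_ex[OF integral_monomials_zonal[of j k]] unfolding m_def by blast+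
  define M where "M = (\<Sum>i\<le>degree p. \<Sum>k\<le>degree q. smult (coeff p i * coeff q k) (m i k))"
  have "degree M \<le> degree p"
    unfolding M_def using m(1)
    by (intro degree_sum_le finite_atMost order_trans[OF degree_smult_le]) (meson atMost_iff order_trans)
  moreover have "sint (\<lambda>w. poly p (w \<bullet> x) * poly q (w \<bullet> a)) = poly M (x \<bullet> a)" if "x \<in> unit_sphere" "a \<in> unit_sphere" for x a
  proof -
    have i: "integrable (area_on unit_sphere) (\<lambda>w. c * ((w \<bullet> x) ^ j * (w \<bullet> a) ^ k))" for c j k
      by (intro integrable_sphere continuous_intros)
    have "sint (\<lambda>w. poly p (w \<bullet> x) * poly q (w \<bullet> a)) = sint (\<lambda>w. \<Sum>i\<le>degree p. \<Sum>k\<le>degree q. (coeff p i * coeff q k) * ((w \<bullet> x) ^ i * (w \<bullet> a) ^ k))"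
      by (simp add: poly_altdef sum_product algebra_simps)
    also have "\<dots> = (\<Sum>i\<le>degree p. \<Sum>k\<le>degree q. (coeff p i * coeff q k) * poly (m i k) (x \<bullet> a))"
      using i m(2)[OF that] by simp
    finally show ?thesis by (simp add: M_def poly_sum)
  qed
  ultimately show ?thesis by blast
qed

section \<open>Legendre polynomials and the kernels of the harmonic projections\<close>

text \<open>The polynomials of Rodrigues' formula, without the usual factor \<open>1 / (2\<^sup>l l!)\<close>.\<close>

definition legendre :: "nat \<Rightarrow> real poly" where
  "legendre l = (pderiv ^^ l) ([:-1, 0, 1:] ^ l)"

lemma degree_higher_pderiv: "degree ((pderiv ^^ n) p) = degree p - n" for p :: "real poly"
  by (induction n) (auto simp: degree_pderiv)

lemma degree_legendre: "degree (legendre l) = l"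
  by (simp add: legendre_def degree_higher_pderiv degree_power_eq)

abbreviation eigval :: "nat \<Rightarrow> real" where
  "eigval l \<equiv> real l * (real l + 1)"

text \<open>With \<open>v = (t\<^sup>2 - 1)\<^sup>l\<close> one has \<open>(t\<^sup>2 - 1) v' = 2 l t v\<close>; differentiating this \<open>l + 1\<close> times gives the
  Legendre equation for the \<open>l\<close>-th derivative of \<open>v\<close>.\<close>

lemma legendre_ode: "legendre_op (legendre l) = smult (- eigval l) (legendre l)"
proof -
  define Q X :: "real poly" where "Q = [:-1, 0, 1:]" and "X = [:0, 1:]"
  have dQ: "pderiv Q = smult 2 X" and dX: "pderiv X = 1"
    by (simp_all add: Q_def X_def pderiv_pCons one_pCons)
  have pQ: "poly Q t = t * t - 1" and pX: "poly X t = t" for t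
    by (simp_all add: Q_def X_def)
  define v where "v = Q ^ l"
  have v0: "Q * pderiv v = smult (2 * real l) (X * v)"
    unfolding v_def by (cases l) (simp_all add: pderiv_power_Suc dQ algebra_simps del: power_Suc, simp add: algebra_simps)
  have E: "Q * (pderiv ^^ (n + 2)) v + smult (2 * (real n + 1 - real l)) (X * (pderiv ^^ (n + 1)) v)
     + smult ((real n + 1) * real n - 2 * real l * (real n + 1)) ((pderiv ^^ n) v) = 0" for n
  proof (induction n)
    case 0
    from arg_cong[OF v0, of pderiv] show ?case
      by (simp add: pderiv_mult pderiv_smult dQ dX poly_eq_poly_eq_iff[symmetric] fun_eq_iff pQ pX algebra_simps)
  next
    case (Suc n)
    from arg_cong[OF Suc, of pderiv] show ?case
      by (simp add: pderiv_mult pderiv_smult pderiv_add dQ dX poly_eq_poly_eq_iff[symmetric] fun_eq_iff pQ pX algebra_simps)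
  qed
  have lg: "legendre l = (pderiv ^^ l) v" by (simp add: legendre_def v_def Q_def)
  from arg_cong[OF E[of l], of poly] show ?thesis
    unfolding lg by (simp add: legendre_op_def poly_eq_poly_eq_iff[symmetric] fun_eq_iff pQ pX algebra_simps)
qed

lemma legendre_uminus: "poly (legendre l) (- t) = (-1) ^ l * poly (legendre l) t"
proof -
  let ?v = "[:-1, 0, 1:: real:] ^ l"
  have "pcompose ((pderiv ^^ n) ?v) [:0, -1:] = smult ((-1) ^ n) ((pderiv ^^ n) ?v)" for n
  proof (induction n)
    case 0
    show ?case by (simp add: poly_eq_poly_eq_iff[symmetric] fun_eq_iff poly_pcompose)
  next
    case (Suc n)
    from arg_cong[OF Suc, of pderiv]
    have "smult (-1) (pcompose ((pderiv ^^ Suc n) ?v) [:0, -1:]) = smult ((-1) ^ n) ((pderiv ^^ Suc n) ?v)"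
      by (simp add: pderiv_pcompose pderiv_smult pderiv_pCons)
    then have "smult (-1) (smult (-1) (pcompose ((pderiv ^^ Suc n) ?v) [:0, -1:])) = smult (-1) (smult ((-1) ^ n) ((pderiv ^^ Suc n) ?v))"
      by (rule arg_cong)
    then show ?case by simp
  qed
  from arg_cong[OF this[of l], of "\<lambda>p. poly p t"] show ?thesis
    by (simp add: legendre_def poly_pcompose)
qed

text \<open>Near \<open>t = 1\<close> the polynomial \<open>(t\<^sup>2 - 1)\<^sup>l\<close> is \<open>(t - 1)\<^sup>l\<close> times a factor that does not vanish, and every
  derivative has to fall on a power of \<open>t - 1\<close>.\<close>

lemma legendre_at_1: "poly (legendre l) 1 \<noteq> 0"
proof -
  have "poly ((pderiv ^^ n) ([:-1, 1:] ^ n * q)) 1 = fact n * poly q 1" for n and q :: "real poly"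
  proof (induction n arbitrary: q)
    case (Suc n)
    have "pderiv ([:-1, 1:] ^ Suc n * q) = [:-1, 1:] ^ n * (smult (real (Suc n)) q + [:-1, 1:] * pderiv q)"
      unfolding pderiv_mult pderiv_power_Suc by (simp add: pderiv_pCons algebra_simps)
    then have eq: "(pderiv ^^ Suc n) ([:-1, 1:] ^ Suc n * q) = (pderiv ^^ n) ([:-1, 1:] ^ n * (smult (real (Suc n)) q + [:-1, 1:] * pderiv q))"
      by (simp only: funpow_Suc_right comp_def)
    show ?case unfolding eq Suc by simp
  qed simp
  from this[of l "[:1, 1:] ^ l"] have "poly ((pderiv ^^ l) (([:-1, 1:] * [:1, 1:]) ^ l)) 1 \<noteq> (0::real)"
    unfolding power_mult_distrib by simp
  moreover have "[:-1, 1:] * [:1, 1:] = [:-1, 0, 1::real:]" by simp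
  ultimately show ?thesis unfolding legendre_def by (simp only: not_False_eq_True)
qed

lemma legendre_basis: "degree g \<le> n \<Longrightarrow> \<exists>c. g = (\<Sum>k\<le>n. smult (c k) (legendre k))"
proof (induction n arbitrary: g)
  case 0
  then obtain a where "g = [:a:]" by (metis degree_eq_zeroE le_zero_eq)
  then show ?case by (intro exI[of _ "\<lambda>_. a"]) (simp add: legendre_def)
next
  case (Suc n)
  define c where "c = coeff g (Suc n) / coeff (legendre (Suc n)) (Suc n)"
  have nz: "coeff (legendre (Suc n)) (Suc n) \<noteq> 0"
    using degree_legendre[of "Suc n"] by (metis leading_coeff_0_iff degree_0 nat.distinct(1))
  have "degree (g - smult c (legendre (Suc n))) \<le> n"
  proof (rule degree_le, intro allI impI)
    fix i assume "n < i"
    then show "coeff (g - smult c (legendre (Suc n))) i = 0"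
      using Suc.prems nz degree_legendre[of "Suc n"] by (cases "i = Suc n") (auto simp: c_def coeff_eq_0)
  qed
  from Suc.IH[OF this] obtain d where "g - smult c (legendre (Suc n)) = (\<Sum>k\<le>n. smult (d k) (legendre k))" by blast
  then have "g = (\<Sum>k\<le>n. smult (d k) (legendre k)) + smult c (legendre (Suc n))" by (simp add: algebra_simps)
  then show ?case by (intro exI[of _ "d(Suc n := c)"]) (auto intro!: sum.cong)
qed

text \<open>Green's formula makes the Laplace operator symmetric, and the eigenvalues \<open>l (l + 1)\<close> are distinct.\<close>

lemma legendre_orthogonal:
  assumes "l \<noteq> k" "x \<in> unit_sphere" "a \<in> unit_sphere"
  shows "sint (\<lambda>w. poly (legendre l) (w \<bullet> x) * poly (legendre k) (w \<bullet> a)) = 0"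
proof -
  let ?P = "legendre l" and ?Q = "legendre k"
  let ?I = "sint (\<lambda>w. poly ?P (w \<bullet> x) * poly ?Q (w \<bullet> a))"
  let ?g = "\<lambda>p a w. poly (pderiv p) (w \<bullet> a) *\<^sub>R (a - (w \<bullet> a) *\<^sub>R w) :: real^3"
  have "- sint (\<lambda>w. poly ?P (w \<bullet> x) * poly (legendre_op ?Q) (w \<bullet> a)) =
      - sint (\<lambda>w. poly ?Q (w \<bullet> a) * poly (legendre_op ?P) (w \<bullet> x))"
    unfolding Green_zonal[OF sphere_C1_zonal assms(3), symmetric] Green_zonal[OF sphere_C1_zonal assms(2), symmetric]
    by (simp add: inner_commute)
  moreover have "sint (\<lambda>w. poly ?P (w \<bullet> x) * poly (legendre_op ?Q) (w \<bullet> a)) = - (eigval k) * ?I"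
    by (subst integral_mult_right_zero[symmetric], rule sint_cong) (simp add: legendre_ode)
  moreover have "sint (\<lambda>w. poly ?Q (w \<bullet> a) * poly (legendre_op ?P) (w \<bullet> x)) = - (eigval l) * ?I"
    by (subst integral_mult_right_zero[symmetric], rule sint_cong) (simp add: legendre_ode)
  ultimately have "eigval k * ?I = eigval l * ?I"
    by simp
  moreover have "eigval k \<noteq> eigval l"
  proof
    assume "eigval k = eigval l"
    then have "(real k - real l) * (real k + real l + 1) = 0" by (simp add: algebra_simps)
    then show False using assms(1) by simp
  qed
  ultimately show ?thesis by simp
qed

lemma poly_eq_sum_upto:
  fixes p :: "'a::comm_semiring_1 poly"
  assumes "degree p \<le> n"
  shows "poly p t = (\<Sum>i\<le>n. coeff p i * t ^ i)"
  unfolding poly_altdef using assms by (intro sum.mono_neutral_left) (auto simp: coeff_eq_0)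

text \<open>Archimedes' hat-box theorem in differentiated form: \<open>w \<bullet> a\<close> is uniformly distributed on \<open>[-1,1]\<close>.\<close>

lemma integral_zonal_pderiv:
  assumes a: "a \<in> unit_sphere"
  shows "sint (\<lambda>w. poly (pderiv p) (w \<bullet> a)) = 2 * pi * (poly p 1 - poly p (- 1))"
proof -
  have I: "(n + 1) * sint (\<lambda>w. (w \<bullet> a) ^ n) = 2 * pi * (1 - (-1) ^ Suc n)" for n
  proof (induction n rule: less_induct)
    case (less n)
    consider "n = 0" | "n = 1" | m where "n = Suc (Suc m)" by (metis One_nat_def nat.exhaust)
    then show ?case
    proof cases
      case 1
      then show ?thesis
        using surface_measure_unit_sphere by (simp add: measure_restrict_space area_on_def)
    next
      case 2
      then show ?thesis using moment_recursion[OF a a, of 0 0] by simp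
    next
      case 3
      then show ?thesis using moment_recursion[OF a a, of 0 "Suc m"] less[of m] by (simp add: algebra_simps)
    qed
  qed
  have I': "(real i + 1) * sint (\<lambda>w. (w \<bullet> a) ^ i) = 2 * pi * (1 - (-1) ^ Suc i)" for i
    using I[of i] by (simp add: add.commute)
  let ?n = "degree p"
  have i: "integrable (area_on unit_sphere) (\<lambda>w. c * (w \<bullet> a) ^ j)" for c j
    by (intro integrable_sphere continuous_intros)
  have "sint (\<lambda>w. poly (pderiv p) (w \<bullet> a)) = sint (\<lambda>w. \<Sum>i\<le>?n. coeff (pderiv p) i * (w \<bullet> a) ^ i)"
    by (subst poly_eq_sum_upto[of _ ?n]) (auto simp: degree_pderiv)
  also have "\<dots> = (\<Sum>i\<le>?n. coeff p (Suc i) * ((real i + 1) * sint (\<lambda>w. (w \<bullet> a) ^ i)))"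
    using i by (simp add: coeff_pderiv algebra_simps)
  also have "\<dots> = 2 * pi * (\<Sum>i\<le>?n. coeff p (Suc i) * (1 - (-1) ^ Suc i))"
    unfolding I' sum_distrib_left by (simp add: algebra_simps)
  also have "(\<Sum>i\<le>?n. coeff p (Suc i) * (1 - (-1) ^ Suc i)) = (\<Sum>i\<le>Suc ?n. coeff p i * (1 - (-1) ^ i))"
    unfolding sum.atMost_Suc_shift by simp
  also have "\<dots> = (\<Sum>i\<le>?n. coeff p i * (1 - (-1) ^ i))" by (simp add: coeff_eq_0)
  also have "\<dots> = poly p 1 - poly p (- 1)"
    by (simp add: poly_altdef sum_subtractf[symmetric] right_diff_distrib)
  finally show ?thesis .
qed


definition legendre_sqnorm :: "nat \<Rightarrow> real" where
  "legendre_sqnorm l = 4 * pi * (poly (legendre l) 1)\<^sup>2 / (2 * l + 1)"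

lemma legendre_sqnorm_pos: "legendre_sqnorm l > 0"
  using legendre_at_1[of l] by (simp add: legendre_sqnorm_def)

lemma legendre_orthogonal_lower_degree:
  assumes "degree r < l" "a \<in> unit_sphere" "x \<in> unit_sphere"
  shows "sint (\<lambda>w. poly (legendre l) (w \<bullet> x) * poly r (w \<bullet> a)) = 0"
proof -
  obtain c where r: "r = (\<Sum>k\<le>degree r. smult (c k) (legendre k))"
    using legendre_basis[of r "degree r"] by auto
  have i: "integrable (area_on unit_sphere) (\<lambda>w. c k * (poly (legendre l) (w \<bullet> x) * poly (legendre k) (w \<bullet> a)))" for k
    by (intro integrable_sphere continuous_intros)
  have "sint (\<lambda>w. poly (legendre l) (w \<bullet> x) * poly r (w \<bullet> a)) =
     sint (\<lambda>w. \<Sum>k\<le>degree r. c k * (poly (legendre l) (w \<bullet> x) * poly (legendre k) (w \<bullet> a)))"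
    by (subst (1) r) (simp add: poly_sum sum_distrib_left mult.left_commute)
  also have "\<dots> = (\<Sum>k\<le>degree r. c k * sint (\<lambda>w. poly (legendre l) (w \<bullet> x) * poly (legendre k) (w \<bullet> a)))"
    using i by simp
  also have "\<dots> = 0" using assms by (intro sum.neutral) (auto simp: legendre_orthogonal)
  finally show ?thesis .
qed

text \<open>Integrating \<open>(t P\<^sup>2)' = P\<^sup>2 + 2 P (t P')\<close>, where \<open>t P' = l P + r\<close> with \<open>r\<close> of lower degree and hence
  orthogonal to \<open>P\<close>.\<close>

lemma integral_legendre_square:
  assumes a: "a \<in> unit_sphere"
  shows "sint (\<lambda>w. poly (legendre l) (w \<bullet> a) * poly (legendre l) (w \<bullet> a)) = legendre_sqnorm l"
proof -
  let ?P = "legendre l"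
  let ?N = "sint (\<lambda>w. poly ?P (w \<bullet> a) * poly ?P (w \<bullet> a))"
  define r where "r = pCons 0 (pderiv ?P) - smult (real l) ?P"
  have orth: "sint (\<lambda>w. poly ?P (w \<bullet> a) * poly r (w \<bullet> a)) = 0"
  proof (cases "l = 0")
    case True
    then show ?thesis by (simp add: r_def legendre_def)
  next
    case False
    have "coeff r i = 0" if "i \<ge> l" for i
    proof (cases "i = l")
      case True
      then show ?thesis using False by (cases l) (auto simp: r_def coeff_pderiv)
    next
      case F: False
      then have "coeff ?P i = 0" "coeff (pCons 0 (pderiv ?P)) i = 0"
        using that degree_legendre[of l] by (auto simp: coeff_eq_0 coeff_pCons coeff_pderiv split: nat.split)
      then show ?thesis by (simp add: r_def)
    qed
    then have "degree r \<le> l - 1" by (intro degree_le) auto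
    then show ?thesis using False by (intro legendre_orthogonal_lower_degree a) auto
  qed
  have i: "integrable (area_on unit_sphere) (\<lambda>w. poly ?P (w \<bullet> a) * poly ?P (w \<bullet> a))"
     "integrable (area_on unit_sphere) (\<lambda>w. poly ?P (w \<bullet> a) * poly r (w \<bullet> a))"
    by (intro integrable_sphere continuous_intros)+
  have "sint (\<lambda>w. poly (pderiv (pCons 0 (?P * ?P))) (w \<bullet> a)) = 2 * pi * (2 * (poly ?P 1)\<^sup>2)"
    unfolding integral_zonal_pderiv[OF a] using legendre_uminus[of l 1]
    by (simp add: power2_eq_square algebra_simps flip: power_add)
  moreover have "poly (pderiv (pCons 0 (?P * ?P))) t = (2 * real l + 1) * (poly ?P t * poly ?P t) + 2 * (poly ?P t * poly r t)" for t
    by (simp add: pderiv_pCons pderiv_mult r_def algebra_simps)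
  ultimately have "(2 * real l + 1) * ?N = 4 * pi * (poly ?P 1)\<^sup>2"
    using i orth by simp
  then show ?thesis by (simp add: legendre_sqnorm_def field_simps)
qed

text \<open>The kernel \<open>Z (x \<bullet> y)\<close> of the orthogonal projection of \<open>L\<^sup>2\<close> of the sphere onto the spherical harmonics
  of degree \<open>l\<close>.\<close>

definition harmonic_kernel :: "nat \<Rightarrow> real poly" where
  "harmonic_kernel l = smult (poly (legendre l) 1 / legendre_sqnorm l) (legendre l)"

text \<open>The addition theorem at coinciding points: the value is constant, so the trace of the projection
  compressed to a region is proportional to the area of the region.\<close>

lemma harmonic_kernel_1: "poly (harmonic_kernel l) 1 = (2 * l + 1) / (4 * pi)"
  using legendre_at_1[of l] by (simp add: harmonic_kernel_def legendre_sqnorm_def power2_eq_square)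

lemma harmonic_kernel_uminus: "poly (harmonic_kernel l) (- t) = (-1) ^ l * poly (harmonic_kernel l) t"
  by (simp add: harmonic_kernel_def legendre_uminus)

lemma legendre_op_harmonic_kernel: "legendre_op (harmonic_kernel l) = smult (- (eigval l)) (harmonic_kernel l)"
proof -
  have "legendre_op (smult c p) = smult c (legendre_op p)" for c p
    by (simp add: legendre_op_def pderiv_smult smult_diff_right)
  then show ?thesis by (simp add: harmonic_kernel_def legendre_ode mult.commute)
qed

text \<open>As a function of \<open>x \<bullet> a\<close> the convolution is a polynomial of degree at most \<open>l\<close>, hence a combination
  of Legendre polynomials. Integrating against the lower ones and exchanging the integrals shows that
  only the one of degree \<open>l\<close> occurs, and \<open>x = a\<close> gives its coefficient.\<close>

lemma legendre_convolution:
  assumes "x \<in> unit_sphere" "a \<in> unit_sphere"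
  shows "sint (\<lambda>w. poly (legendre l) (w \<bullet> x) * poly (legendre l) (w \<bullet> a)) = legendre_sqnorm l / poly (legendre l) 1 * poly (legendre l) (x \<bullet> a)"
proof -
  let ?P = "legendre l"
  obtain m where deg: "degree m \<le> degree (legendre l)" and m: "\<And>x a. x \<in> unit_sphere \<Longrightarrow> a \<in> unit_sphere \<Longrightarrow>
      sint (\<lambda>w. poly ?P (w \<bullet> x) * poly ?P (w \<bullet> a)) = poly m (x \<bullet> a)"
    using zonal_convolution_exists[of "legendre l" "legendre l"] by blast
  obtain c where c: "m = (\<Sum>k\<le>l. smult (c k) (legendre k))"
    using legendre_basis[of m l] deg degree_legendre by auto
  have "c k = 0" if k: "k < l" for k
  proof -
    let ?Q = "legendre k"
    define a :: "real^3" where "a = axis 1 1"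
    have a: "a \<in> unit_sphere" by (simp add: a_def)
    have "sint (\<lambda>x. poly ?Q (x \<bullet> a) * poly m (x \<bullet> a)) = (\<Sum>j\<le>l. c j * sint (\<lambda>x. poly ?Q (x \<bullet> a) * poly (legendre j) (x \<bullet> a)))"
    proof -
      have i: "integrable (area_on unit_sphere) (\<lambda>x. c j * (poly ?Q (x \<bullet> a) * poly (legendre j) (x \<bullet> a)))" for j
        by (intro integrable_sphere continuous_intros)
      show ?thesis using i by (simp add: c poly_sum sum_distrib_left mult.left_commute)
    qed
    also have "\<dots> = (\<Sum>j\<le>l. if j = k then c k * legendre_sqnorm k else 0)"
      by (intro sum.cong) (auto simp: legendre_orthogonal[OF _ a a] integral_legendre_square[OF a])
    also have "\<dots> = c k * legendre_sqnorm k" using k by simp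
    finally have 1: "sint (\<lambda>x. poly ?Q (x \<bullet> a) * poly m (x \<bullet> a)) = c k * legendre_sqnorm k" .
    have "sint (\<lambda>x. poly ?Q (x \<bullet> a) * poly m (x \<bullet> a)) =
       sint (\<lambda>x. sint (\<lambda>w. poly ?P (w \<bullet> x) * (poly ?Q (x \<bullet> a) * poly ?P (w \<bullet> a))))"
      by (rule sint_cong) (simp add: m[OF _ a, symmetric] mult.left_commute)
    also have "\<dots> = sint (\<lambda>w. sint (\<lambda>x. poly ?P (w \<bullet> x) * (poly ?Q (x \<bullet> a) * poly ?P (w \<bullet> a))))"
      by (rule Fubini_area_on) (auto simp: case_prod_unfold intro!: integrable_sphere continuous_intros)
    also have "\<dots> = sint (\<lambda>w. poly ?P (w \<bullet> a) * sint (\<lambda>x. poly ?P (x \<bullet> w) * poly ?Q (x \<bullet> a)))"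
      by (rule sint_cong) (simp add: inner_commute mult.assoc[symmetric] mult.commute[of "poly ?P (_ \<bullet> a)"])
    also have "\<dots> = sint (\<lambda>w. 0)" using legendre_orthogonal[of l k _ a] k a by (intro sint_cong) auto
    finally show "c k = 0" using 1 legendre_sqnorm_pos[of k] by simp
  qed
  then have "m = (\<Sum>k\<le>l. if k = l then smult (c l) (legendre l) else 0)"
    unfolding c by (intro sum.cong) auto
  then have m': "m = smult (c l) (legendre l)" by simp
  have "c l * poly ?P 1 = legendre_sqnorm l"
    using m[OF assms(2) assms(2)] integral_legendre_square[OF assms(2)] assms(2) by (simp add: m' dot_square_norm)
  then have "c l = legendre_sqnorm l / poly ?P 1"
    using legendre_at_1[of l] by (simp add: field_simps)
  then show ?thesis using m[OF assms] by (simp add: m')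
qed

text \<open>The kernels represent mutually orthogonal projections. This replaces an orthonormal basis of
  spherical harmonics throughout.\<close>

lemma harmonic_kernel_convolution:
  assumes "x \<in> unit_sphere" "a \<in> unit_sphere"
  shows "sint (\<lambda>w. poly (harmonic_kernel l) (w \<bullet> x) * poly (harmonic_kernel k) (w \<bullet> a)) = (if l = k then poly (harmonic_kernel l) (x \<bullet> a) else 0)"
proof -
  let ?H = "harmonic_kernel l" and ?Q = "legendre k"
  let ?c = "\<lambda>l. poly (legendre l) 1 / legendre_sqnorm l"
  have "sint (\<lambda>w. poly ?H (w \<bullet> x) * poly (harmonic_kernel k) (w \<bullet> a)) =
     sint (\<lambda>w. (?c l * ?c k) * (poly (legendre l) (w \<bullet> x) * poly ?Q (w \<bullet> a)))"
    by (rule sint_cong) (simp add: harmonic_kernel_def)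
  also have "\<dots> = (?c l * ?c k) * sint (\<lambda>w. poly (legendre l) (w \<bullet> x) * poly ?Q (w \<bullet> a))"
    by (rule integral_mult_right_zero)
  also have "\<dots> = (if l = k then poly ?H (x \<bullet> a) else 0)"
  proof (cases "l = k")
    case True
    have "?c l * ?c l * (legendre_sqnorm l / poly (legendre l) 1 * t) = ?c l * t" for t
      using legendre_at_1[of l] legendre_sqnorm_pos[of l] by (simp add: field_simps)
    then show ?thesis by (simp only: True legendre_convolution[OF assms]) (simp add: harmonic_kernel_def)
  qed (simp add: legendre_orthogonal[OF _ assms])
  finally show ?thesis .
qed

section \<open>Completeness of the harmonic projections\<close>

definition zonal_transform :: "real poly \<Rightarrow> (real^3 \<Rightarrow> real) \<Rightarrow> real^3 \<Rightarrow> real" where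
  "zonal_transform p v x = sint (\<lambda>y. poly p (x \<bullet> y) * v y)"

definition zonal_form :: "real poly \<Rightarrow> (real^3 \<Rightarrow> real) \<Rightarrow> real" where
  "zonal_form p v = sint (\<lambda>x. v x * zonal_transform p v x)"

lemma continuous_on_zonal_transform:
  assumes "continuous_on unit_sphere v"
  shows "continuous_on unit_sphere (zonal_transform p v)"
proof -
  have "continuous_on unit_sphere (\<lambda>x. \<integral>y. poly p (x \<bullet> y) *\<^sub>R v y \<partial>area_on unit_sphere)"
    using assms by (intro continuous_on_kernel_integral) (auto simp: case_prod_unfold intro!: continuous_intros)
  then show ?thesis by (simp add: zonal_transform_def[abs_def])
qed

lemma zonal_transform_add:
  assumes "continuous_on unit_sphere u" "continuous_on unit_sphere v"
  shows "zonal_transform p (\<lambda>x. u x + c * v x) x = zonal_transform p u x + c * zonal_transform p v x"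
proof -
  have "integrable (area_on unit_sphere) (\<lambda>y. poly p (x \<bullet> y) * u y)" "integrable (area_on unit_sphere) (\<lambda>y. poly p (x \<bullet> y) * v y)"
    by (intro integrable_sphere continuous_intros assms)+
  then show ?thesis by (simp add: zonal_transform_def distrib_left mult.left_commute)
qed

lemma zonal_transform_kernel_sum:
  assumes "continuous_on unit_sphere v"
  shows "zonal_transform (\<Sum>l\<in>I. smult (c l) (p l)) v x = (\<Sum>l\<in>I. c l * zonal_transform (p l) v x)"
proof -
  have "integrable (area_on unit_sphere) (\<lambda>y. c l * (poly (p l) (x \<bullet> y) * v y))" for l
    using assms by (intro integrable_sphere continuous_intros)
  then show ?thesis by (simp add: zonal_transform_def poly_sum sum_distrib_right mult.assoc)
qed

lemma zonal_form_kernel_sum: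
  assumes "continuous_on unit_sphere v"
  shows "zonal_form (\<Sum>l\<in>I. smult (c l) (p l)) v = (\<Sum>l\<in>I. c l * zonal_form (p l) v)"
proof -
  have "integrable (area_on unit_sphere) (\<lambda>x. c l * (v x * zonal_transform (p l) v x))" for l
    using assms by (intro integrable_sphere continuous_intros continuous_on_zonal_transform)
  then show ?thesis by (simp add: zonal_form_def zonal_transform_kernel_sum[OF assms] sum_distrib_left mult.left_commute)
qed

lemma integral_zonal_transform_mult:
  assumes v: "continuous_on unit_sphere v"
    and r: "\<And>x y. x \<in> unit_sphere \<Longrightarrow> y \<in> unit_sphere \<Longrightarrow> sint (\<lambda>w. poly p (w \<bullet> x) * poly q (w \<bullet> y)) = poly r (x \<bullet> y)"
  shows "sint (\<lambda>w. zonal_transform p v w * zonal_transform q v w) = zonal_form r v"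
proof -
  note cQ = continuous_on_zonal_transform[OF v, of q]
  have "sint (\<lambda>w. zonal_transform p v w * zonal_transform q v w) = sint (\<lambda>w. sint (\<lambda>x. poly p (w \<bullet> x) * (zonal_transform q v w * v x)))"
    by (simp add: zonal_transform_def[of p] mult.left_commute[of _ "zonal_transform q v _"] mult.commute[of _ "zonal_transform q v _"])
  also have "\<dots> = sint (\<lambda>x. sint (\<lambda>w. poly p (w \<bullet> x) * (zonal_transform q v w * v x)))"
    using v cQ by (intro Fubini_area_on) (auto simp: case_prod_unfold intro!: continuous_intros)
  also have "\<dots> = sint (\<lambda>x. v x * zonal_transform r v x)"
  proof (rule sint_cong)
    fix x :: "real^3" assume x: "x \<in> unit_sphere"
    have "sint (\<lambda>w. poly p (w \<bullet> x) * zonal_transform q v w) = sint (\<lambda>w. sint (\<lambda>y. (poly p (w \<bullet> x) * poly q (w \<bullet> y)) * (1 * v y)))"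
      by (simp add: zonal_transform_def mult.assoc)
    also have "\<dots> = sint (\<lambda>y. sint (\<lambda>w. (poly p (w \<bullet> x) * poly q (w \<bullet> y)) * (1 * v y)))"
      using v by (intro Fubini_area_on) (auto simp: case_prod_unfold intro!: continuous_intros integrable_sphere)
    also have "\<dots> = sint (\<lambda>y. poly r (x \<bullet> y) * v y)"
      by (rule sint_cong) (simp add: r[OF x])
    finally have e: "sint (\<lambda>w. poly p (w \<bullet> x) * zonal_transform q v w) = zonal_transform r v x"
      by (simp add: zonal_transform_def)
    have "sint (\<lambda>w. poly p (w \<bullet> x) * (zonal_transform q v w * v x)) = sint (\<lambda>w. (poly p (w \<bullet> x) * zonal_transform q v w) * v x)"
      by (simp add: mult.assoc)
    then show "sint (\<lambda>w. poly p (w \<bullet> x) * (zonal_transform q v w * v x)) = v x * zonal_transform r v x"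
      unfolding e[symmetric] by (simp add: mult.commute)
  qed
  finally show ?thesis by (simp add: zonal_form_def)
qed

text \<open>The kernel of the projection onto all degrees up to \<open>M\<close>. The factors 1 give it the shape of the linear
  combinations in the following lemma.\<close>

definition low_kernel :: "nat \<Rightarrow> real poly" where
  "low_kernel M = (\<Sum>l\<le>M. smult 1 (harmonic_kernel l))"

lemma low_kernel_convolution_sum:
  assumes "x \<in> unit_sphere" "y \<in> unit_sphere"
  shows "sint (\<lambda>w. poly (low_kernel M) (w \<bullet> x) * poly (\<Sum>l\<le>M. smult (c l) (harmonic_kernel l)) (w \<bullet> y)) =
    poly (\<Sum>l\<le>M. smult (c l) (harmonic_kernel l)) (x \<bullet> y)"
proof -
  have i: "integrable (area_on unit_sphere) (\<lambda>w. c k * (poly (harmonic_kernel l) (w \<bullet> x) * poly (harmonic_kernel k) (w \<bullet> y)))" for l k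
    by (intro integrable_sphere continuous_intros)
  have "sint (\<lambda>w. poly (low_kernel M) (w \<bullet> x) * poly (\<Sum>l\<le>M. smult (c l) (harmonic_kernel l)) (w \<bullet> y)) =
    sint (\<lambda>w. \<Sum>l\<le>M. \<Sum>k\<le>M. c k * (poly (harmonic_kernel l) (w \<bullet> x) * poly (harmonic_kernel k) (w \<bullet> y)))"
    by (simp add: low_kernel_def poly_sum sum_product mult.left_commute)
  also have "\<dots> = (\<Sum>l\<le>M. \<Sum>k\<le>M. c k * (if l = k then poly (harmonic_kernel l) (x \<bullet> y) else 0))"
    using i by (simp add: harmonic_kernel_convolution[OF assms])
  also have "\<dots> = (\<Sum>l\<le>M. c l * poly (harmonic_kernel l) (x \<bullet> y))"
    by (intro sum.cong) (simp_all add: if_distrib[of "(*) _"] cong: if_cong)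
  finally show ?thesis by (simp add: poly_sum)
qed

lemma harmonic_kernel_basis:
  assumes "degree q \<le> M"
  obtains c where "q = (\<Sum>l\<le>M. smult (c l) (harmonic_kernel l))"
proof -
  obtain c where c: "q = (\<Sum>k\<le>M. smult (c k) (legendre k))" using legendre_basis[OF assms] by blast
  have e: "smult (c k) (legendre k) = smult (c k * legendre_sqnorm k / poly (legendre k) 1) (harmonic_kernel k)" for k
    using legendre_at_1[of k] legendre_sqnorm_pos[of k] by (simp add: harmonic_kernel_def)
  show ?thesis by (rule that[of "\<lambda>k. c k * legendre_sqnorm k / poly (legendre k) 1"]) (simp only: c e)
qed

lemma zonal_form_harmonic_kernel:
  assumes "continuous_on unit_sphere v"
  shows "zonal_form (harmonic_kernel l) v = sint (\<lambda>x. (zonal_transform (harmonic_kernel l) v x)\<^sup>2)"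
  by (subst integral_zonal_transform_mult[OF assms, symmetric, of "harmonic_kernel l" "harmonic_kernel l"])
    (simp_all add: harmonic_kernel_convolution power2_eq_square)

lemma zonal_form_harmonic_kernel_nonneg:
  "continuous_on unit_sphere v \<Longrightarrow> 0 \<le> zonal_form (harmonic_kernel l) v"
  by (simp add: zonal_form_harmonic_kernel)

text \<open>Pythagoras for the projection onto degrees up to \<open>M\<close>.\<close>

lemma low_kernel_residual:
  assumes v: "continuous_on unit_sphere v"
  shows "sint (\<lambda>x. (v x - zonal_transform (low_kernel M) v x)\<^sup>2) = sint (\<lambda>x. (v x)\<^sup>2) - (\<Sum>l\<le>M. zonal_form (harmonic_kernel l) v)"
proof -
  let ?T = "zonal_transform (low_kernel M) v"
  have cT: "continuous_on unit_sphere ?T" by (rule continuous_on_zonal_transform[OF v])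
  have f: "zonal_form (low_kernel M) v = (\<Sum>l\<le>M. zonal_form (harmonic_kernel l) v)"
    unfolding low_kernel_def by (subst zonal_form_kernel_sum[OF v]) simp
  have 1: "sint (\<lambda>x. ?T x * ?T x) = zonal_form (low_kernel M) v"
    by (rule integral_zonal_transform_mult[OF v])
      (use low_kernel_convolution_sum[of _ _ M "\<lambda>_. 1"] in \<open>simp add: low_kernel_def\<close>)
  have i: "integrable (area_on unit_sphere) (\<lambda>x. (v x)\<^sup>2)" "integrable (area_on unit_sphere) (\<lambda>x. v x * ?T x)" "integrable (area_on unit_sphere) (\<lambda>x. ?T x * ?T x)"
    by (intro integrable_sphere continuous_intros v cT)+
  have "sint (\<lambda>x. (v x - ?T x)\<^sup>2) = sint (\<lambda>x. (v x)\<^sup>2 - 2 * (v x * ?T x) + ?T x * ?T x)"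
    by (simp add: power2_eq_square algebra_simps)
  also have "\<dots> = sint (\<lambda>x. (v x)\<^sup>2) - 2 * sint (\<lambda>x. v x * ?T x) + sint (\<lambda>x. ?T x * ?T x)"
    using i by simp
  finally show ?thesis using 1 f by (simp add: zonal_form_def)
qed

text \<open>Finite sums of spherical harmonics, described through the projections that reproduce them.\<close>

definition band_limited :: "(real^3 \<Rightarrow> real) \<Rightarrow> bool" where
  "band_limited w \<longleftrightarrow> continuous_on unit_sphere w \<and> (\<exists>N. \<forall>M\<ge>N. \<forall>x\<in>unit_sphere. zonal_transform (low_kernel M) w x = w x)"

lemma band_limited_add:
  assumes "band_limited u" "band_limited v" shows "band_limited (\<lambda>x. u x + v x)"
proof -
  obtain N1 N2 where "\<forall>M\<ge>N1. \<forall>x\<in>unit_sphere. zonal_transform (low_kernel M) u x = u x"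
    "\<forall>M\<ge>N2. \<forall>x\<in>unit_sphere. zonal_transform (low_kernel M) v x = v x"
    using assms unfolding band_limited_def by blast
  then have "\<forall>M\<ge>max N1 N2. \<forall>x\<in>unit_sphere. zonal_transform (low_kernel M) (\<lambda>x. u x + v x) x = u x + v x"
    using zonal_transform_add[of u v _ 1] assms by (auto simp: band_limited_def)
  then show ?thesis using assms unfolding band_limited_def by (blast intro: continuous_on_add)
qed

lemma band_limited_zonal:
  assumes a: "a \<in> unit_sphere" shows "band_limited (\<lambda>x. poly q (x \<bullet> a))"
  unfolding band_limited_def
proof (intro conjI exI[of _ "degree q"] allI impI ballI)
  fix M x assume "degree q \<le> M" and x: "x \<in> (unit_sphere :: (real^3) set)"
  then obtain c where q: "q = (\<Sum>l\<le>M. smult (c l) (harmonic_kernel l))" using harmonic_kernel_basis by blast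
  have "zonal_transform (low_kernel M) (\<lambda>x. poly q (x \<bullet> a)) x = sint (\<lambda>w. poly (low_kernel M) (w \<bullet> x) * poly q (w \<bullet> a))"
    by (simp add: zonal_transform_def inner_commute)
  then show "zonal_transform (low_kernel M) (\<lambda>x. poly q (x \<bullet> a)) x = poly q (x \<bullet> a)"
    unfolding q by (simp only: low_kernel_convolution_sum[OF x a])
qed (intro continuous_intros)

definition uniform_closure_band_limited :: "(real^3 \<Rightarrow> real) \<Rightarrow> bool" where
  "uniform_closure_band_limited f \<longleftrightarrow> (\<forall>e>0. \<exists>w. band_limited w \<and> (\<forall>x\<in>unit_sphere. \<bar>f x - w x\<bar> < e))"

lemma uniform_closure_add:
  assumes "uniform_closure_band_limited f" "uniform_closure_band_limited g"
  shows "uniform_closure_band_limited (\<lambda>x. f x + g x)"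
  unfolding uniform_closure_band_limited_def
proof (intro allI impI)
  fix e :: real assume "e > 0"
  then have e2: "e / 2 > 0" by simp
  obtain u where u: "band_limited u" "\<forall>x\<in>unit_sphere. \<bar>f x - u x\<bar> < e / 2"
    using assms(1) e2 unfolding uniform_closure_band_limited_def by blast
  obtain v where v: "band_limited v" "\<forall>x\<in>unit_sphere. \<bar>g x - v x\<bar> < e / 2"
    using assms(2) e2 unfolding uniform_closure_band_limited_def by blast
  have "\<forall>x\<in>unit_sphere. \<bar>f x + g x - (u x + v x)\<bar> < e"
  proof
    fix x :: "real^3" assume "x \<in> unit_sphere"
    then have "\<bar>f x - u x\<bar> < e / 2" "\<bar>g x - v x\<bar> < e / 2" using u v by blast+
    then show "\<bar>f x + g x - (u x + v x)\<bar> < e" by linarith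
  qed
  then show "\<exists>w. band_limited w \<and> (\<forall>x\<in>unit_sphere. \<bar>f x + g x - w x\<bar> < e)"
    using band_limited_add[OF u(1) v(1)] by blast
qed

text \<open>The Taylor polynomials of the exponential make \<open>exp (x \<bullet> a)\<close> a uniform limit of zonal polynomials
  around the axis of \<open>a\<close>.\<close>

lemma uniform_closure_exp: "uniform_closure_band_limited (\<lambda>x. c * exp (x \<bullet> a))"
  unfolding uniform_closure_band_limited_def
proof (intro allI impI)
  fix e :: real assume e: "e > 0"
  obtain b :: "real^3" where b: "b \<in> unit_sphere" "a = norm a *\<^sub>R b"
  proof (cases "a = 0")
    case True
    then show ?thesis using that[of "axis 1 1"] by simp
  next
    case False
    then show ?thesis using that[of "a /\<^sub>R norm a"] by simp
  qed
  let ?R = "norm a"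
  have "(\<lambda>n. \<bar>c\<bar> * exp ?R * (inverse (fact n) * ?R ^ n)) \<longlonglongrightarrow> \<bar>c\<bar> * exp ?R * 0"
    by (intro tendsto_mult_left summable_LIMSEQ_zero summable_exp)
  then have "\<forall>\<^sub>F n in sequentially. \<bar>c\<bar> * exp ?R * (inverse (fact n) * ?R ^ n) < e"
    using e by (intro order_tendstoD) auto
  then obtain n where n: "\<bar>c\<bar> * exp ?R * (inverse (fact n) * ?R ^ n) < e"
    by (auto simp: eventually_sequentially)
  define q where "q = (\<Sum>m<n. monom (c * ?R ^ m / fact m) m)"
  have q: "poly q (x \<bullet> b) = c * (\<Sum>m<n. (x \<bullet> a) ^ m / fact m)" for x
    by (subst b(2)) (simp add: q_def poly_sum poly_monom sum_distrib_left power_mult_distrib field_simps)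
  have "\<bar>c * exp (x \<bullet> a) - poly q (x \<bullet> b)\<bar> < e" if x: "x \<in> unit_sphere" for x
  proof -
    have xa: "\<bar>x \<bullet> a\<bar> \<le> ?R" using Cauchy_Schwarz_ineq2[of x a] x by simp
    obtain t where t: "\<bar>t\<bar> \<le> \<bar>x \<bullet> a\<bar>" "exp (x \<bullet> a) = (\<Sum>m<n. (x \<bullet> a) ^ m / fact m) + (exp t / fact n) * (x \<bullet> a) ^ n"
      using Maclaurin_exp_le[of "x \<bullet> a" n] by blast
    have "\<bar>c * exp (x \<bullet> a) - poly q (x \<bullet> b)\<bar> = \<bar>c\<bar> * exp t * (inverse (fact n) * \<bar>x \<bullet> a\<bar> ^ n)"
      unfolding q t(2) by (simp add: algebra_simps abs_mult power_abs divide_inverse)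
    also have "\<dots> \<le> \<bar>c\<bar> * exp ?R * (inverse (fact n) * ?R ^ n)"
      using t(1) xa by (intro mult_mono power_mono) auto
    finally show ?thesis using n by simp
  qed
  then show "\<exists>w. band_limited w \<and> (\<forall>x\<in>unit_sphere. \<bar>c * exp (x \<bullet> a) - w x\<bar> < e)"
    using band_limited_zonal[OF b(1), of q] by blast
qed

text \<open>Unlike zonal polynomials with different axes, exponentials of linear forms are closed under products,
  so their span is an algebra to which the Stone-Weierstrass theorem applies.\<close>

inductive_set exp_span :: "(real^3 \<Rightarrow> real) set" where
  exp_span_exp: "(\<lambda>x. c * exp (x \<bullet> a)) \<in> exp_span"
| exp_span_add: "f \<in> exp_span \<Longrightarrow> g \<in> exp_span \<Longrightarrow> (\<lambda>x. f x + g x) \<in> exp_span"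

lemma exp_span_mult_exp: "f \<in> exp_span \<Longrightarrow> (\<lambda>x. f x * (c * exp (x \<bullet> a))) \<in> exp_span"
proof (induction rule: exp_span.induct)
  case (exp_span_exp d b)
  have "(\<lambda>x. d * exp (x \<bullet> b) * (c * exp (x \<bullet> a))) = (\<lambda>x. d * c * exp (x \<bullet> (b + a)))"
    by (simp add: fun_eq_iff inner_right_distrib exp_add)
  then show ?case by (simp only: exp_span.exp_span_exp)
next
  case (exp_span_add f g)
  then show ?case using exp_span.exp_span_add by (simp add: distrib_right)
qed

lemma exp_span_mult: "g \<in> exp_span \<Longrightarrow> f \<in> exp_span \<Longrightarrow> (\<lambda>x. f x * g x) \<in> exp_span"
proof (induction rule: exp_span.induct)
  case (exp_span_exp c a)
  then show ?case by (rule exp_span_mult_exp)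
next
  case (exp_span_add g h)
  then show ?case using exp_span.exp_span_add by (simp add: distrib_left)
qed

lemma exp_span_approximable: "f \<in> exp_span \<Longrightarrow> uniform_closure_band_limited f"
  by (induction rule: exp_span.induct) (auto intro: uniform_closure_exp uniform_closure_add)

lemma continuous_uniform_closure:
  assumes v: "continuous_on unit_sphere v"
  shows "uniform_closure_band_limited v"
  unfolding uniform_closure_band_limited_def
proof (intro allI impI)
  fix e :: real assume e: "e > 0"
  interpret function_ring_on exp_span "unit_sphere :: (real^3) set"
  proof
    show "continuous_on unit_sphere f" if "f \<in> exp_span" for f
      using that by (induction rule: exp_span.induct) (auto intro!: continuous_intros)
    show "(\<lambda>_. c) \<in> exp_span" for c
      using exp_span_exp[of c 0] by simp
    show "\<exists>f\<in>exp_span. f x \<noteq> f y" if "x \<noteq> y" for x y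
    proof (rule bexI[of _ "\<lambda>z. 1 * exp (z \<bullet> (x - y))"])
      have "x \<bullet> (x - y) - y \<bullet> (x - y) = (norm (x - y))\<^sup>2" by (simp add: power2_norm_eq_inner inner_diff_left)
      then show "1 * exp (x \<bullet> (x - y)) \<noteq> 1 * exp (y \<bullet> (x - y))" using that by auto
    qed (rule exp_span_exp)
  qed (auto intro: exp_span_add exp_span_mult)
  obtain F where F: "F \<in> UNIV \<rightarrow> exp_span" "LIM n sequentially. F n :> uniformly_on unit_sphere v"
    using Stone_Weierstrass[OF v] by blast
  have "\<forall>\<^sub>F n in sequentially. \<forall>x\<in>unit_sphere. dist (F n x) (v x) < e / 2"
    using F(2) half_gt_zero[OF e] unfolding uniform_limit_iff by blast
  then obtain n where n: "\<forall>x\<in>unit_sphere. dist (F n x) (v x) < e / 2" by (auto simp: eventually_sequentially)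
  have "uniform_closure_band_limited (F n)" using F(1) exp_span_approximable by auto
  then obtain w where w: "band_limited w" "\<forall>x\<in>unit_sphere. \<bar>F n x - w x\<bar> < e / 2"
    using e unfolding uniform_closure_band_limited_def by (metis half_gt_zero)
  have "\<bar>v x - w x\<bar> < e" if "x \<in> unit_sphere" for x
  proof -
    have "\<bar>F n x - v x\<bar> < e / 2" "\<bar>F n x - w x\<bar> < e / 2" using n w(2) that by (auto simp: dist_real_def)
    then show ?thesis by linarith
  qed
  then show "\<exists>w. band_limited w \<and> (\<forall>x\<in>unit_sphere. \<bar>v x - w x\<bar> < e)" using w(1) by blast
qed


text \<open>Half of Parseval's identity. If \<open>w\<close> is band-limited and uniformly close to \<open>v\<close>, then \<open>v\<close> and \<open>v - w\<close> have
  the same residual under the projection onto high enough degrees.\<close>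

lemma parseval_le:
  assumes v: "continuous_on unit_sphere v" and e: "e > 0"
  obtains N where "\<And>M. M \<ge> N \<Longrightarrow> sint (\<lambda>x. (v x)\<^sup>2) \<le> (\<Sum>l\<le>M. zonal_form (harmonic_kernel l) v) + e"
proof -
  define d where "d = sqrt (e / (4 * pi))"
  have d: "d > 0" "d\<^sup>2 * (4 * pi) = e" using e by (auto simp: d_def)
  obtain w where w: "band_limited w" "\<And>x. x \<in> unit_sphere \<Longrightarrow> \<bar>v x - w x\<bar> < d"
    using continuous_uniform_closure[OF v] d(1) unfolding uniform_closure_band_limited_def by blast
  obtain N where N: "\<And>M x. M \<ge> N \<Longrightarrow> x \<in> unit_sphere \<Longrightarrow> zonal_transform (low_kernel M) w x = w x"
    and cw: "continuous_on unit_sphere w"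
    using w(1) unfolding band_limited_def by blast
  define u where "u x = v x + (-1) * w x" for x
  have cu: "continuous_on unit_sphere u" unfolding u_def by (intro continuous_intros v cw)
  have "sint (\<lambda>x. (v x)\<^sup>2) \<le> (\<Sum>l\<le>M. zonal_form (harmonic_kernel l) v) + e" if M: "M \<ge> N" for M
  proof -
    have "zonal_transform (low_kernel M) u x = zonal_transform (low_kernel M) v x - w x" if "x \<in> unit_sphere" for x
      unfolding u_def zonal_transform_add[OF v cw] using N[OF M that] by simp
    then have "sint (\<lambda>x. (v x - zonal_transform (low_kernel M) v x)\<^sup>2) = sint (\<lambda>x. (u x - zonal_transform (low_kernel M) u x)\<^sup>2)"
      by (intro sint_cong) (simp add: u_def)
    also have "\<dots> \<le> sint (\<lambda>x. (u x)\<^sup>2)"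
      unfolding low_kernel_residual[OF cu] using zonal_form_harmonic_kernel_nonneg[OF cu] by (simp add: sum_nonneg)
    also have "\<dots> \<le> sint (\<lambda>x. d\<^sup>2)"
    proof (rule integral_mono)
      show "(u x)\<^sup>2 \<le> d\<^sup>2" if "x \<in> space (area_on unit_sphere)" for x
        using w(2)[of x] that d(1) by (auto simp: u_def intro!: power2_le_iff_abs_le[THEN iffD2])
    qed (intro integrable_sphere continuous_intros cu)+
    also have "\<dots> = e"
      using surface_measure_unit_sphere d(2) by (simp add: measure_restrict_space area_on_def mult.commute)
    finally show ?thesis unfolding low_kernel_residual[OF v] by simp
  qed
  then show ?thesis by (rule that)
qed

section \<open>The spectral inequality\<close>

definition zonal_gradient :: "real poly \<Rightarrow> real^3 \<Rightarrow> real^3 \<Rightarrow> real^3" where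
  "zonal_gradient p y x = poly (pderiv p) (x \<bullet> y) *\<^sub>R (y - (x \<bullet> y) *\<^sub>R x)"

lemma continuous_on_zonal_gradient:
  "continuous_on A f \<Longrightarrow> continuous_on A g \<Longrightarrow> continuous_on A (\<lambda>z. zonal_gradient p (f z) (g z))" for f g :: "'a::topological_space \<Rightarrow> real^3"
  unfolding zonal_gradient_def by (intro continuous_intros)

text \<open>The gradient of the zonal transform of \<open>v\<close>, written as an integral of the gradients of the kernel.\<close>

definition transform_gradient :: "real poly \<Rightarrow> (real^3 \<Rightarrow> real) \<Rightarrow> real^3 \<Rightarrow> real^3" where
  "transform_gradient p v x = (\<integral>y. v y *\<^sub>R zonal_gradient p y x \<partial>area_on unit_sphere)"

lemma transform_gradient_inner:
  assumes "continuous_on unit_sphere v"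
  shows "a \<bullet> transform_gradient p v x = sint (\<lambda>y. (a \<bullet> zonal_gradient p y x) * v y)"
proof -
  have "integrable (area_on unit_sphere) (\<lambda>y. v y *\<^sub>R zonal_gradient p y x)"
    by (intro integrable_sphere continuous_intros continuous_on_zonal_gradient assms)
  then show ?thesis
    unfolding transform_gradient_def by (subst integral_inner_right[symmetric]) (simp_all add: mult.commute)
qed

lemma continuous_on_transform_gradient:
  assumes "continuous_on unit_sphere v"
  shows "continuous_on unit_sphere (transform_gradient p v)"
proof -
  have "continuous_on unit_sphere (\<lambda>x. b \<bullet> transform_gradient p v x)" for b
  proof -
    have "continuous_on unit_sphere (\<lambda>x. \<integral>y. (b \<bullet> zonal_gradient p y x) *\<^sub>R v y \<partial>area_on unit_sphere)"
      using assms by (intro continuous_on_kernel_integral) (auto simp: case_prod_unfold intro!: continuous_intros continuous_on_zonal_gradient)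
    then show ?thesis by (simp add: transform_gradient_inner[OF assms])
  qed
  then have "continuous_on unit_sphere (\<lambda>x. \<Sum>b\<in>Basis. (b \<bullet> transform_gradient p v x) *\<^sub>R b)"
    by (intro continuous_on_sum continuous_on_scaleR continuous_on_const)
  then show ?thesis by (simp add: inner_commute[of _ "transform_gradient p v _"] euclidean_representation)
qed

lemma integral_inner_transform_gradient:
  assumes V: "continuous_on unit_sphere V" and v: "continuous_on unit_sphere v"
  shows "sint (\<lambda>x. V x \<bullet> transform_gradient p v x) = sint (\<lambda>y. v y * sint (\<lambda>x. V x \<bullet> zonal_gradient p y x))"
proof -
  have "sint (\<lambda>x. V x \<bullet> transform_gradient p v x) = sint (\<lambda>x. sint (\<lambda>y. (V x \<bullet> zonal_gradient p y x) * (1 * v y)))"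
    by (simp add: transform_gradient_inner[OF v])
  also have "\<dots> = sint (\<lambda>y. sint (\<lambda>x. (V x \<bullet> zonal_gradient p y x) * (1 * v y)))"
    using v by (intro Fubini_area_on)
      (auto simp: case_prod_unfold intro!: integrable_sphere continuous_intros continuous_on_zonal_gradient continuous_on_compose2[OF V])
  finally show ?thesis by (simp add: mult.commute)
qed

lemma legendre_op_low_kernel: "legendre_op (low_kernel M) = (\<Sum>l\<le>M. smult (- (eigval l)) (harmonic_kernel l))"
proof -
  have add: "legendre_op (p + q) = legendre_op p + legendre_op q" for p q
    by (simp add: legendre_op_def pderiv_add smult_add_right algebra_simps)
  have "legendre_op (\<Sum>l\<in>I. f l) = (\<Sum>l\<in>I. legendre_op (f l))" if "finite I" for I and f :: "nat \<Rightarrow> real poly"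
    using that by induction (simp_all add: add, simp add: legendre_op_def)
  then show ?thesis by (simp add: low_kernel_def legendre_op_harmonic_kernel)
qed

text \<open>Bessel's inequality for the Dirichlet energy: expand the square of the distance from \<open>G\<close> to the
  gradient of the projection of \<open>v\<close>. By Green's formula and the eigenvalue equation of the kernels, the
  mixed term and the energy of the projection are both the sum on the left.\<close>

lemma energy_ge:
  assumes v: "sphere_C1 v G"
  shows "(\<Sum>l\<le>M. eigval l * zonal_form (harmonic_kernel l) v) \<le> sint (\<lambda>x. G x \<bullet> G x)"
proof -
  let ?K = "low_kernel M"
  let ?W = "transform_gradient ?K v"
  have cv: "continuous_on unit_sphere v" and cG: "continuous_on unit_sphere G"
    using v sphere_C1_imp_continuous_on by (auto simp: sphere_C1_def)
  have cW: "continuous_on unit_sphere ?W" by (rule continuous_on_transform_gradient[OF cv])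
  have LK: "zonal_form (legendre_op ?K) v = - (\<Sum>l\<le>M. eigval l * zonal_form (harmonic_kernel l) v)"
    unfolding legendre_op_low_kernel zonal_form_kernel_sum[OF cv] by (simp add: sum_negf)
  have GW: "sint (\<lambda>x. G x \<bullet> ?W x) = - zonal_form (legendre_op ?K) v"
  proof -
    have "sint (\<lambda>x. G x \<bullet> ?W x) = sint (\<lambda>y. v y * (- zonal_transform (legendre_op ?K) v y))"
      unfolding integral_inner_transform_gradient[OF cG cv]
    proof (rule sint_cong)
      fix y :: "real^3" assume y: "y \<in> unit_sphere"
      show "v y * sint (\<lambda>x. G x \<bullet> zonal_gradient ?K y x) = v y * (- zonal_transform (legendre_op ?K) v y)"
        using Green_zonal[OF v y, of ?K] by (simp add: zonal_gradient_def zonal_transform_def inner_commute[of y] mult.commute)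
    qed
    then show ?thesis by (simp add: zonal_form_def)
  qed
  have WW: "sint (\<lambda>x. ?W x \<bullet> ?W x) = - zonal_form (legendre_op ?K) v"
  proof -
    have "sint (\<lambda>x. ?W x \<bullet> zonal_gradient ?K y x) = - zonal_transform (legendre_op ?K) v y" if y: "y \<in> unit_sphere" for y
    proof -
      have "sint (\<lambda>x. ?W x \<bullet> zonal_gradient ?K y x) = sint (\<lambda>z. v z * sint (\<lambda>x. zonal_gradient ?K y x \<bullet> zonal_gradient ?K z x))"
        unfolding inner_commute[of "?W _"]
        by (intro integral_inner_transform_gradient cv continuous_on_zonal_gradient continuous_on_const continuous_on_id)
      also have "\<dots> = sint (\<lambda>z. v z * (- poly (legendre_op ?K) (y \<bullet> z)))"
      proof (rule sint_cong)
        fix z :: "real^3" assume z: "z \<in> unit_sphere"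
        have "sint (\<lambda>x. zonal_gradient ?K y x \<bullet> zonal_gradient ?K z x) = - sint (\<lambda>x. poly ?K (x \<bullet> y) * poly (legendre_op ?K) (x \<bullet> z))"
          unfolding zonal_gradient_def by (rule Green_zonal[OF sphere_C1_zonal z])
        then show "v z * sint (\<lambda>x. zonal_gradient ?K y x \<bullet> zonal_gradient ?K z x) = v z * (- poly (legendre_op ?K) (y \<bullet> z))"
          unfolding legendre_op_low_kernel low_kernel_convolution_sum[OF y z] by simp
      qed
      finally show ?thesis by (simp add: zonal_transform_def mult.commute)
    qed
    then have "sint (\<lambda>x. ?W x \<bullet> ?W x) = sint (\<lambda>y. v y * (- zonal_transform (legendre_op ?K) v y))"
      unfolding integral_inner_transform_gradient[OF cW cv] by (intro sint_cong) simp
    then show ?thesis by (simp add: zonal_form_def)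
  qed
  have i: "integrable (area_on unit_sphere) (\<lambda>x. G x \<bullet> G x)" "integrable (area_on unit_sphere) (\<lambda>x. G x \<bullet> ?W x)" "integrable (area_on unit_sphere) (\<lambda>x. ?W x \<bullet> ?W x)"
    by (intro integrable_sphere continuous_intros cG cW)+
  have "0 \<le> sint (\<lambda>x. (G x - ?W x) \<bullet> (G x - ?W x))" by (rule integral_nonneg_AE) simp
  also have "\<dots> = sint (\<lambda>x. G x \<bullet> G x - 2 * (G x \<bullet> ?W x) + ?W x \<bullet> ?W x)"
    by (simp add: inner_diff_left inner_diff_right inner_commute algebra_simps)
  also have "\<dots> = sint (\<lambda>x. G x \<bullet> G x) - 2 * sint (\<lambda>x. G x \<bullet> ?W x) + sint (\<lambda>x. ?W x \<bullet> ?W x)"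
    using i by simp
  finally show ?thesis using GW WW LK by simp
qed

text \<open>The projections diagonalise both terms on the left; the degrees from \<open>L\<close> on only lower their
  difference.\<close>

lemma spectral_inequality:
  assumes v: "sphere_C1 v G" and z: "0 \<le> z" "\<And>l. l \<ge> L \<Longrightarrow> z \<le> eigval l"
  shows "z * sint (\<lambda>x. (v x)\<^sup>2) - sint (\<lambda>x. G x \<bullet> G x) \<le> (\<Sum>l<L. (z - eigval l) * zonal_form (harmonic_kernel l) v)"
proof (rule field_le_epsilon)
  fix e :: real assume e: "e > 0"
  have cv: "continuous_on unit_sphere v" by (rule sphere_C1_imp_continuous_on[OF v])
  let ?a = "\<lambda>l. zonal_form (harmonic_kernel l) v"
  have a: "0 \<le> ?a l" for l by (rule zonal_form_harmonic_kernel_nonneg[OF cv])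
  have "e / (z + 1) > 0" using e z by simp
  then obtain N where N: "\<And>M. M \<ge> N \<Longrightarrow> sint (\<lambda>x. (v x)\<^sup>2) \<le> (\<Sum>l\<le>M. ?a l) + e / (z + 1)"
    using parseval_le[OF cv] by blast
  define M where "M = max N L"
  have "z * sint (\<lambda>x. (v x)\<^sup>2) \<le> z * ((\<Sum>l\<le>M. ?a l) + e / (z + 1))"
    using N[of M] z(1) by (intro mult_left_mono) (auto simp: M_def)
  moreover have "z * (e / (z + 1)) \<le> e" using z(1) e by (simp add: field_simps)
  moreover note energy_ge[OF v, of M]
  ultimately have "z * sint (\<lambda>x. (v x)\<^sup>2) - sint (\<lambda>x. G x \<bullet> G x) \<le> (\<Sum>l\<le>M. (z - eigval l) * ?a l) + e"
    by (simp add: left_diff_distrib sum_subtractf sum_distrib_left distrib_left)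
  also have "(\<Sum>l\<le>M. (z - eigval l) * ?a l) \<le> (\<Sum>l<L. (z - eigval l) * ?a l)"
  proof -
    have "(\<Sum>l\<le>M. (z - eigval l) * ?a l) = (\<Sum>l<L. (z - eigval l) * ?a l) + (\<Sum>l\<in>{L..M}. (z - eigval l) * ?a l)"
      by (subst sum.union_disjoint[symmetric]) (auto simp: M_def intro!: sum.cong)
    also have "(\<Sum>l\<in>{L..M}. (z - eigval l) * ?a l) \<le> 0"
      using z(2) a by (intro sum_nonpos mult_nonpos_nonneg) auto
    finally show ?thesis by simp
  qed
  finally show "z * sint (\<lambda>x. (v x)\<^sup>2) - sint (\<lambda>x. G x \<bullet> G x) \<le> (\<Sum>l<L. (z - eigval l) * ?a l) + e" by simp
qed

text \<open>The antipodal map sends the support of \<open>f\<close> to a set disjoint from it, hence \<open>v x = f x \<plusminus> f (- x)\<close> has twice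
  the mass and twice the energy of \<open>f\<close>. With the sign of the parity of \<open>L\<close>, only the degrees of this parity
  occur in \<open>v\<close>, each with four times the contribution of \<open>f\<close>. Compared with the spectral inequality for
  \<open>f\<close> itself, half of the degrees are lost and the others count twice, which is favourable
  because the threshold \<open>L (L + 1)\<close> is itself an eigenvalue of the parity that is kept.\<close>

lemma spectral_inequality_antipodal:
  fixes L :: nat
  assumes f: "sphere_C1 f G"
    and disj: "\<And>x. x \<in> unit_sphere \<Longrightarrow> f x * f (- x) = 0" "\<And>x. x \<in> unit_sphere \<Longrightarrow> G x \<bullet> G (- x) = 0"
  defines "z \<equiv> eigval L"
  shows "z * sint (\<lambda>x. (f x)\<^sup>2) - sint (\<lambda>x. G x \<bullet> G x) \<le>
    (\<Sum>l<L. if even (l + L) then 2 * (z - eigval l) * sint (\<lambda>x. (zonal_transform (harmonic_kernel l) f x)\<^sup>2) else 0)"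
proof -
  define s :: real where "s = (-1) ^ L"
  have ss: "s * s = 1" by (simp add: s_def flip: power_add)
  define v where "v x = f x + s * f (- x)" for x
  define V where "V x = G x + s *\<^sub>R (- G (- x))" for x
  have vV: "sphere_C1 v V"
    using sphere_C1_add_cmult[OF f sphere_C1_uminus[OF f], of s] by (simp add: v_def[abs_def] V_def[abs_def])
  have cf: "continuous_on unit_sphere f" and cG: "continuous_on unit_sphere G"
    using f sphere_C1_imp_continuous_on by (auto simp: sphere_C1_def)
  have cfm: "continuous_on unit_sphere (\<lambda>x. f (- x))"
    by (rule continuous_on_compose2[OF cf]) (auto intro!: continuous_intros)
  have cGm: "continuous_on unit_sphere (\<lambda>x. G (- x))"
    by (rule continuous_on_compose2[OF cG]) (auto intro!: continuous_intros)
  have cv: "continuous_on unit_sphere v" by (rule sphere_C1_imp_continuous_on[OF vV])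
  have i: "integrable (area_on unit_sphere) (\<lambda>x. (f x)\<^sup>2)" "integrable (area_on unit_sphere) (\<lambda>x. (f (- x))\<^sup>2)"
    "integrable (area_on unit_sphere) (\<lambda>x. G x \<bullet> G x)" "integrable (area_on unit_sphere) (\<lambda>x. G (- x) \<bullet> G (- x))"
    by (intro integrable_sphere continuous_intros cf cfm cG cGm)+
  have "sint (\<lambda>x. (v x)\<^sup>2) = sint (\<lambda>x. (f x)\<^sup>2 + (f (- x))\<^sup>2)"
  proof (rule sint_cong)
    fix x :: "real^3" assume "x \<in> unit_sphere"
    have "(v x)\<^sup>2 = (f x)\<^sup>2 + 2 * s * (f x * f (- x)) + (s * s) * (f (- x))\<^sup>2"
      by (simp add: v_def power2_eq_square algebra_simps)
    then show "(v x)\<^sup>2 = (f x)\<^sup>2 + (f (- x))\<^sup>2" using disj(1)[OF \<open>x \<in> unit_sphere\<close>] ss by simp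
  qed
  also have "\<dots> = 2 * sint (\<lambda>x. (f x)\<^sup>2)"
    using i integral_unit_sphere_uminus[of "\<lambda>x. (f x)\<^sup>2"] cf by (simp add: continuous_on_power)
  finally have v2: "sint (\<lambda>x. (v x)\<^sup>2) = 2 * sint (\<lambda>x. (f x)\<^sup>2)" .
  have "sint (\<lambda>x. V x \<bullet> V x) = sint (\<lambda>x. G x \<bullet> G x + G (- x) \<bullet> G (- x))"
  proof (rule sint_cong)
    fix x :: "real^3" assume "x \<in> unit_sphere"
    have "V x \<bullet> V x = G x \<bullet> G x - 2 * s * (G x \<bullet> G (- x)) + (s * s) * (G (- x) \<bullet> G (- x))"
      by (simp add: V_def inner_add_left inner_add_right inner_diff_left inner_diff_right inner_commute[of "G (- x)" "G x"] algebra_simps)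
    then show "V x \<bullet> V x = G x \<bullet> G x + G (- x) \<bullet> G (- x)" using disj(2)[OF \<open>x \<in> unit_sphere\<close>] ss by simp
  qed
  also have "\<dots> = 2 * sint (\<lambda>x. G x \<bullet> G x)"
    using i integral_unit_sphere_uminus[of "\<lambda>x. G x \<bullet> G x"] cG by (simp add: continuous_on_inner)
  finally have V2: "sint (\<lambda>x. V x \<bullet> V x) = 2 * sint (\<lambda>x. G x \<bullet> G x)" .
  have T: "zonal_transform (harmonic_kernel l) v x = (1 + (-1) ^ (l + L)) * zonal_transform (harmonic_kernel l) f x" for l x
  proof -
    have "zonal_transform (harmonic_kernel l) (\<lambda>x. f (- x)) x = sint (\<lambda>y. (-1) ^ l * (poly (harmonic_kernel l) (x \<bullet> (- y)) * f (- y)))"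
      by (simp add: zonal_transform_def harmonic_kernel_uminus mult.assoc[symmetric] flip: power_add)
    also have "\<dots> = sint (\<lambda>y. (-1) ^ l * (poly (harmonic_kernel l) (x \<bullet> y) * f y))"
      by (rule integral_unit_sphere_uminus) (intro continuous_intros cf)
    finally have "zonal_transform (harmonic_kernel l) (\<lambda>x. f (- x)) x = (-1) ^ l * zonal_transform (harmonic_kernel l) f x"
      by (simp add: zonal_transform_def)
    then show ?thesis unfolding v_def zonal_transform_add[OF cf cfm] by (simp add: s_def power_add algebra_simps)
  qed
  have a: "zonal_form (harmonic_kernel l) v = (if even (l + L) then 4 * sint (\<lambda>x. (zonal_transform (harmonic_kernel l) f x)\<^sup>2) else 0)" for l
    unfolding zonal_form_harmonic_kernel[OF cv] T by (auto simp: power_mult_distrib)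
  have "z \<le> eigval l" if "l \<ge> L" for l
    unfolding z_def using that by (intro mult_mono) auto
  then have "z * sint (\<lambda>x. (v x)\<^sup>2) - sint (\<lambda>x. V x \<bullet> V x) \<le> (\<Sum>l<L. (z - eigval l) * zonal_form (harmonic_kernel l) v)"
    by (intro spectral_inequality[OF vV]) (auto simp: z_def)
  also have "\<dots> = 2 * (\<Sum>l<L. if even (l + L) then 2 * (z - eigval l) * sint (\<lambda>x. (zonal_transform (harmonic_kernel l) f x)\<^sup>2) else 0)"
    unfolding sum_distrib_left by (intro sum.cong) (auto simp: a)
  finally show ?thesis unfolding v2 V2 by simp
qed

section \<open>Gradients of test functions are test fields\<close>

lemma frechet_derivative_cong_open:
  assumes "open S" "x \<in> S" "\<And>y. y \<in> S \<Longrightarrow> f y = g y"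
  shows "frechet_derivative f (at x) = frechet_derivative g (at x)" "f differentiable (at x) \<longleftrightarrow> g differentiable (at x)"
proof -
  have "(f has_derivative D) (at x) \<longleftrightarrow> (g has_derivative D) (at x)" for D
    using has_derivative_transform_within_open[of f D x UNIV S g] has_derivative_transform_within_open[of g D x UNIV S f] assms by auto
  then show "frechet_derivative f (at x) = frechet_derivative g (at x)" "f differentiable (at x) \<longleftrightarrow> g differentiable (at x)"
    by (auto simp: frechet_derivative_def differentiable_def)
qed

lemma times_differentiable_on_cong:
  assumes "open S" "\<And>x. x \<in> S \<Longrightarrow> f x = g x"
  shows "times_differentiable_on k S f \<longleftrightarrow> times_differentiable_on k S g"
  using assms(2)
proof (induction k arbitrary: f g)
  case 0
  then show ?case by (simp cong: continuous_on_cong)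
next
  case (Suc k)
  have "times_differentiable_on k S (\<lambda>x. frechet_derivative f (at x) v) \<longleftrightarrow> times_differentiable_on k S (\<lambda>x. frechet_derivative g (at x) v)" for v
    by (rule Suc.IH) (use frechet_derivative_cong_open(1)[OF assms(1) _ Suc.prems] in simp)
  then show ?case using frechet_derivative_cong_open(2)[OF assms(1) _ Suc.prems] by auto
qed

lemma times_differentiable_on_SucD: "times_differentiable_on (Suc k) S f \<Longrightarrow> times_differentiable_on k S f"
proof (induction k arbitrary: f)
  case 0
  then show ?case by (auto intro!: continuous_at_imp_continuous_on differentiable_imp_continuous_within)
next
  case (Suc k)
  then have "\<forall>x\<in>S. f differentiable (at x)" "times_differentiable_on (Suc k) S (\<lambda>x. frechet_derivative f (at x) v)" for v
    by (subst (asm) times_differentiable_on.simps(2), blast)+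
  then show ?case using Suc.IH by (subst times_differentiable_on.simps(2)) blast
qed

lemma times_differentiable_on_SucI:
  assumes "open S" "\<And>x. x \<in> S \<Longrightarrow> (f has_derivative D x) (at x)" "\<And>v. times_differentiable_on k S (\<lambda>x. D x v)"
  shows "times_differentiable_on (Suc k) S f"
proof -
  have "times_differentiable_on k S (\<lambda>x. frechet_derivative f (at x) v)" for v
    using times_differentiable_on_cong[OF assms(1), of "\<lambda>x. frechet_derivative f (at x) v" "\<lambda>x. D x v" k]
      frechet_derivative_at[OF assms(2)] assms(3)[of v] by simp
  then show ?thesis using assms(2) by (auto simp: differentiable_def)
qed

lemma times_differentiable_on_has_derivative:
  assumes "times_differentiable_on (Suc k) S f" "x \<in> S"
  shows "(f has_derivative frechet_derivative f (at x)) (at x)"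
  using assms by (auto simp: frechet_derivative_works)

lemma times_differentiable_on_const: "open S \<Longrightarrow> times_differentiable_on k S (\<lambda>_. c)"
proof (induction k arbitrary: c)
  case (Suc k)
  then show ?case by (intro times_differentiable_on_SucI[where D = "\<lambda>_ _. 0"]) auto
qed simp

lemma times_differentiable_on_add:
  assumes "open S"
  shows "times_differentiable_on k S f \<Longrightarrow> times_differentiable_on k S g \<Longrightarrow> times_differentiable_on k S (\<lambda>x. f x + g x)"
proof (induction k arbitrary: f g)
  case (Suc k)
  show ?case
    by (rule times_differentiable_on_SucI[OF assms has_derivative_add[OF times_differentiable_on_has_derivative[OF Suc.prems(1)] times_differentiable_on_has_derivative[OF Suc.prems(2)]]])
      (use Suc in auto)
qed (simp add: continuous_on_add)

lemma times_differentiable_on_scaleR: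
  assumes "open S"
  shows "times_differentiable_on k S f \<Longrightarrow> times_differentiable_on k S g \<Longrightarrow> times_differentiable_on k S (\<lambda>x. f x *\<^sub>R g x)"
proof (induction k arbitrary: f g)
  case (Suc k)
  have "times_differentiable_on k S (\<lambda>x. f x *\<^sub>R frechet_derivative g (at x) v + frechet_derivative f (at x) v *\<^sub>R g x)" for v
    using Suc.prems by (intro times_differentiable_on_add[OF assms] Suc.IH) (auto intro: times_differentiable_on_SucD simp del: times_differentiable_on.simps(2), auto)
  then show ?case
    by (intro times_differentiable_on_SucI[OF assms has_derivative_scaleR[OF times_differentiable_on_has_derivative[OF Suc.prems(1)] times_differentiable_on_has_derivative[OF Suc.prems(2)]]])
qed (simp add: continuous_on_scaleR)

lemma times_differentiable_on_sum:
  assumes "open S" "finite I" "\<And>i. i \<in> I \<Longrightarrow> times_differentiable_on k S (f i)"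
  shows "times_differentiable_on k S (\<lambda>x. \<Sum>i\<in>I. f i x)"
  using assms(2,3) by induction (auto intro: times_differentiable_on_const times_differentiable_on_add assms(1))

lemma times_differentiable_on_inner_const: "open S \<Longrightarrow> times_differentiable_on k S (\<lambda>x. x \<bullet> v)"
proof (cases k)
  case (Suc n)
  assume "open S"
  then show ?thesis unfolding Suc
    by (intro times_differentiable_on_SucI[where D = "\<lambda>_ h. h \<bullet> v"]) (auto intro!: derivative_eq_intros times_differentiable_on_const)
qed (auto intro!: continuous_intros)

text \<open>The induction closes up because the derivative of \<open>1 / \<bar>y\<bar>\<close> is a linear function times \<open>1 / \<bar>y\<bar>\<^sup>3\<close>.\<close>

lemma times_differentiable_on_inverse_norm:
  "times_differentiable_on k (- {0}) (\<lambda>y::'a::real_inner. inverse (norm y))"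
proof (induction k)
  case (Suc k)
  have o: "open (- {0::'a})" by auto
  show ?case
  proof (rule times_differentiable_on_SucI[OF o])
    show "((\<lambda>y. inverse (norm y)) has_derivative (\<lambda>v. inverse (norm y) *\<^sub>R (inverse (norm y) *\<^sub>R (inverse (norm y) *\<^sub>R (- 1 *\<^sub>R (y \<bullet> v)))))) (at y)" if "y \<in> - {0}" for y :: 'a
      using that has_derivative_norm[of y]
      by (auto intro!: derivative_eq_intros simp: sgn_div_norm inner_commute field_simps)
    show "times_differentiable_on k (- {0}) (\<lambda>y::'a. inverse (norm y) *\<^sub>R (inverse (norm y) *\<^sub>R (inverse (norm y) *\<^sub>R (- 1 *\<^sub>R (y \<bullet> v)))))" for v
      by (intro times_differentiable_on_scaleR[OF o] Suc times_differentiable_on_const[OF o] times_differentiable_on_inner_const[OF o])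
  qed
qed (auto intro!: continuous_intros)

lemma times_differentiable_on_norm:
  "times_differentiable_on k (- {0}) (\<lambda>y::'a::real_inner. norm y)"
proof (cases k)
  case (Suc n)
  have o: "open (- {0::'a})" by auto
  show ?thesis unfolding Suc
  proof (rule times_differentiable_on_SucI[OF o])
    show "(norm has_derivative (\<lambda>v. inverse (norm y) *\<^sub>R (y \<bullet> v))) (at y)" if "y \<in> - {0}" for y :: 'a
      using that has_derivative_norm[of y] by (auto simp: sgn_div_norm inner_commute)
    show "times_differentiable_on n (- {0}) (\<lambda>y::'a. inverse (norm y) *\<^sub>R (y \<bullet> v))" for v
      by (intro times_differentiable_on_scaleR[OF o] times_differentiable_on_inverse_norm times_differentiable_on_inner_const[OF o])
  qed
qed (auto intro!: continuous_intros)

lemma unit_sphere_subset: "unit_sphere \<subseteq> - {0::real^3}"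
  by auto

lemma sphere_C1_sphere_grad:
  assumes "sphere_C1 h G" "x \<in> unit_sphere" shows "sphere_grad h x = G x"
proof -
  have "((\<lambda>y. h (sgn y)) has_derivative (\<lambda>v. G x \<bullet> v)) (at x)" using assms by (auto simp: sphere_C1_def)
  then have "frechet_derivative (\<lambda>y. h (sgn y)) (at x) = (\<lambda>v. G x \<bullet> v)"
    using frechet_derivative_at by metis
  then show ?thesis by (simp add: sphere_grad_def euclidean_representation)
qed

lemma test_function_sphere_C1:
  assumes "\<phi> \<in> test_functions \<Omega>"
  shows "sphere_C1 \<phi> (sphere_grad \<phi>)"
proof -
  let ?F = "\<lambda>y. \<phi> (sgn y)"
  have T: "times_differentiable_on (Suc 0) (- {0}) ?F"
    using assms by (auto simp: test_functions_def smooth_on_def simp del: times_differentiable_on.simps)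
  have d: "(?F has_derivative frechet_derivative ?F (at x)) (at x)" if "x \<in> unit_sphere" for x
    using times_differentiable_on_has_derivative[OF T, of x] that unit_sphere_subset by blast
  have "frechet_derivative ?F (at x) = (\<lambda>v. sphere_grad \<phi> x \<bullet> v)" if "x \<in> unit_sphere" for x
  proof
    fix v
    interpret linear "frechet_derivative ?F (at x)" using has_derivative_linear[OF d[OF that]] .
    have "frechet_derivative ?F (at x) v = frechet_derivative ?F (at x) (\<Sum>b\<in>Basis. (v \<bullet> b) *\<^sub>R b)"
      by (simp add: euclidean_representation)
    also have "\<dots> = (\<Sum>b\<in>Basis. (v \<bullet> b) *\<^sub>R frechet_derivative ?F (at x) b)" by (simp add: sum scale)
    finally show "frechet_derivative ?F (at x) v = sphere_grad \<phi> x \<bullet> v"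
      by (simp add: sphere_grad_def inner_sum_left inner_commute[of v] mult.commute)
  qed
  moreover have "continuous_on unit_sphere (sphere_grad \<phi>)"
    unfolding sphere_grad_def using T
    by (intro continuous_intros) (auto intro: continuous_on_subset[OF _ unit_sphere_subset])
  ultimately show ?thesis using d by (auto simp: sphere_C1_def)
qed

lemma test_function_vanishes:
  assumes "\<phi> \<in> test_functions \<Omega>"
  shows "x \<in> unit_sphere - \<Omega> \<Longrightarrow> \<phi> x = 0"
  using assms by (auto simp: test_functions_def)

text \<open>Off the origin, \<open>sphere_grad \<phi> (y / \<bar>y\<bar>)\<close> is \<open>\<bar>y\<bar>\<close> times the Euclidean gradient of the homogeneous
  extension of \<open>\<phi>\<close> at \<open>y\<close>, so it is smooth because the norm is.\<close>

lemma sphere_grad_test_field: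
  assumes "\<phi> \<in> test_functions \<Omega>"
  shows "sphere_grad \<phi> \<in> test_fields \<Omega>"
proof -
  let ?F = "\<lambda>y. \<phi> (sgn y)" and ?G = "sphere_grad \<phi>"
  have o: "open (- {0::real^3})" by auto
  have T: "times_differentiable_on k (- {0}) ?F" for k
    using assms by (auto simp: test_functions_def smooth_on_def)
  have C1: "sphere_C1 \<phi> ?G" by (rule test_function_sphere_C1[OF assms])
  have eq: "?G (sgn y) = (\<Sum>b\<in>Basis. (norm y *\<^sub>R frechet_derivative ?F (at y) b) *\<^sub>R b)" if "y \<noteq> 0" for y
  proof -
    have "frechet_derivative ?F (at y) = (\<lambda>v. ?G (sgn y) \<bullet> v / norm y)"
      using frechet_derivative_at[OF sphere_C1_has_derivative[OF C1 that]] by simp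
    then have "(\<Sum>b\<in>Basis. (norm y *\<^sub>R frechet_derivative ?F (at y) b) *\<^sub>R b) = (\<Sum>b\<in>Basis. (?G (sgn y) \<bullet> b) *\<^sub>R b)"
      using that by simp
    then show ?thesis by (simp add: euclidean_representation)
  qed
  have "times_differentiable_on k (- {0}) (\<lambda>y. ?G (sgn y))" for k
  proof -
    have "times_differentiable_on k (- {0}) (\<lambda>y. frechet_derivative ?F (at y) b)" for b
      using T[of "Suc k"] by auto
    then have "times_differentiable_on k (- {0}) (\<lambda>y. \<Sum>b\<in>Basis. (norm y *\<^sub>R frechet_derivative ?F (at y) b) *\<^sub>R b)"
      by (intro times_differentiable_on_sum[OF o] times_differentiable_on_scaleR[OF o] times_differentiable_on_norm times_differentiable_on_const[OF o]) auto
    then show ?thesis using times_differentiable_on_cong[OF o, of "\<lambda>y. ?G (sgn y)"] eq by simp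
  qed
  moreover obtain K where K: "compact K" "K \<subseteq> \<Omega>" "\<And>x. x \<in> unit_sphere - K \<Longrightarrow> \<phi> x = 0"
    using assms by (auto simp: test_functions_def)
  moreover have "?G x = 0" if x: "x \<in> unit_sphere - K" for x
  proof -
    define U where "U = {y \<in> - {0}. sgn y \<in> - K}"
    have "continuous_on (- {0::real^3}) sgn" unfolding sgn_div_norm[abs_def] by (intro continuous_intros) auto
    then have "open (- {0} \<inter> sgn -` (- K))"
      using K(1) by (intro continuous_open_preimage[OF _ o] open_Compl compact_imp_closed)
    moreover have "U = - {0} \<inter> sgn -` (- K)" by (auto simp: U_def)
    ultimately have "open U" by simp
    have z: "?F y = 0" if "y \<in> U" for y
      using K(3)[of "sgn y"] that by (auto simp: U_def norm_sgn)
    have "x \<in> U" using x by (auto simp: U_def sgn_div_norm)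
    have "frechet_derivative ?F (at x) = frechet_derivative (\<lambda>_. 0) (at x)"
      by (rule frechet_derivative_cong_open[OF \<open>open U\<close> \<open>x \<in> U\<close> z])
    then show ?thesis by (simp add: sphere_grad_def)
  qed
  ultimately show ?thesis
    using sphere_C1_tangential[OF C1] by (auto simp: test_fields_def test_functions_def smooth_on_def)
qed

lemma test_functions_add_cmult:
  assumes "\<phi> \<in> test_functions \<Omega>" "\<psi> \<in> test_functions \<Omega>"
  shows "(\<lambda>x. \<phi> x + c *\<^sub>R \<psi> x) \<in> test_functions \<Omega>"
proof -
  have o: "open (- {0::real^3})" by auto
  obtain K1 where K1: "compact K1" "K1 \<subseteq> \<Omega>" "\<forall>x\<in>unit_sphere - K1. \<phi> x = 0"
    using assms(1) by (auto simp: test_functions_def)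
  obtain K2 where K2: "compact K2" "K2 \<subseteq> \<Omega>" "\<forall>x\<in>unit_sphere - K2. \<psi> x = 0"
    using assms(2) by (auto simp: test_functions_def)
  have "smooth_on (- {0}) (\<lambda>y. \<phi> (sgn y) + c *\<^sub>R \<psi> (sgn y))"
    using assms unfolding test_functions_def smooth_on_def
    by (auto intro!: times_differentiable_on_add[OF o] times_differentiable_on_scaleR[OF o] times_differentiable_on_const[OF o])
  moreover have "compact (K1 \<union> K2)" "K1 \<union> K2 \<subseteq> \<Omega>" "\<forall>x\<in>unit_sphere - (K1 \<union> K2). \<phi> x + c *\<^sub>R \<psi> x = 0"
    using K1 K2 by auto
  ultimately show ?thesis unfolding test_functions_def by blast
qed

lemma continuous_on_sphere_div:
  assumes "X \<in> test_fields \<Omega>"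
  shows "continuous_on unit_sphere (sphere_div X)" "continuous_on unit_sphere X"
proof -
  let ?F = "\<lambda>y. X (sgn y)"
  have T: "times_differentiable_on k (- {0}) ?F" for k
    using assms by (auto simp: test_fields_def test_functions_def smooth_on_def)
  have "continuous_on (- {0}) (\<lambda>x. frechet_derivative ?F (at x) b)" for b
    using T[of "Suc 0"] by auto
  then show "continuous_on unit_sphere (sphere_div X)"
    unfolding sphere_div_def[abs_def] by (intro continuous_intros) (auto intro: continuous_on_subset[OF _ unit_sphere_subset])
  have "continuous_on unit_sphere ?F"
    using T[of 0] by (auto intro: continuous_on_subset[OF _ unit_sphere_subset])
  moreover have "sgn y = y" if "y \<in> unit_sphere" for y :: "real^3"
    using that by (simp add: sgn_div_norm)
  ultimately show "continuous_on unit_sphere X" by (metis (no_types, lifting) continuous_on_eq)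
qed

section \<open>Square-integrable functions\<close>

definition L2 :: "'a measure \<Rightarrow> ('a \<Rightarrow> 'b::euclidean_space) \<Rightarrow> bool" where
  "L2 M f \<longleftrightarrow> f \<in> borel_measurable M \<and> integrable M (\<lambda>x. f x \<bullet> f x)"

lemma L2_inner_integrable:
  assumes "L2 M f" "L2 M g" shows "integrable M (\<lambda>x. f x \<bullet> g x)"
proof (rule Bochner_Integration.integrable_bound)
  show "integrable M (\<lambda>x. f x \<bullet> f x + g x \<bullet> g x)" using assms by (auto simp: L2_def)
  show "(\<lambda>x. f x \<bullet> g x) \<in> borel_measurable M" using assms by (auto simp: L2_def)
  have "\<bar>a \<bullet> b\<bar> \<le> a \<bullet> a + b \<bullet> b" for a b :: 'b
  proof -
    have "0 \<le> (a + b) \<bullet> (a + b)" "0 \<le> (a - b) \<bullet> (a - b)" by simp_all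
    then show ?thesis
      using inner_ge_zero[of a] inner_ge_zero[of b]
      by (simp add: inner_add_left inner_add_right inner_diff_left inner_diff_right inner_commute[of b a])
  qed
  then show "AE x in M. norm (f x \<bullet> g x) \<le> norm (f x \<bullet> f x + g x \<bullet> g x)"
    by (intro AE_I2) (simp add: abs_of_nonneg)
qed

lemma L2_add_cmult:
  assumes "L2 M f" "L2 M g" shows "L2 M (\<lambda>x. f x + c *\<^sub>R g x)"
  unfolding L2_def
proof
  show "(\<lambda>x. f x + c *\<^sub>R g x) \<in> borel_measurable M" using assms by (auto simp: L2_def)
  have "integrable M (\<lambda>x. f x \<bullet> f x + 2 * c * (f x \<bullet> g x) + c * c * (g x \<bullet> g x))"
    by (intro Bochner_Integration.integrable_add integrable_mult_right L2_inner_integrable assms)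
  moreover have "(\<lambda>x. f x \<bullet> f x + 2 * c * (f x \<bullet> g x) + c * c * (g x \<bullet> g x)) = (\<lambda>x. (f x + c *\<^sub>R g x) \<bullet> (f x + c *\<^sub>R g x))"
    by (auto simp: fun_eq_iff inner_add_left inner_add_right inner_commute[of "g _" "f _"] algebra_simps)
  ultimately show "integrable M (\<lambda>x. (f x + c *\<^sub>R g x) \<bullet> (f x + c *\<^sub>R g x))" by simp
qed

lemma L2_diff: "L2 M f \<Longrightarrow> L2 M g \<Longrightarrow> L2 M (\<lambda>x. f x - g x)"
  using L2_add_cmult[of M f g "-1"] by simp

lemma L2_norm_expand:
  assumes "L2 M f" "L2 M g"
  shows "(\<integral>x. (f x + c *\<^sub>R g x) \<bullet> (f x + c *\<^sub>R g x) \<partial>M) = (\<integral>x. f x \<bullet> f x \<partial>M) + 2 * c * (\<integral>x. f x \<bullet> g x \<partial>M) + c * c * (\<integral>x. g x \<bullet> g x \<partial>M)"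
proof -
  have "(\<integral>x. (f x + c *\<^sub>R g x) \<bullet> (f x + c *\<^sub>R g x) \<partial>M) = (\<integral>x. f x \<bullet> f x + 2 * c * (f x \<bullet> g x) + c * c * (g x \<bullet> g x) \<partial>M)"
    by (intro Bochner_Integration.integral_cong) (auto simp: inner_add_left inner_add_right inner_commute[of "g _" "f _"] algebra_simps)
  then show ?thesis using L2_inner_integrable[OF assms] L2_inner_integrable[OF assms(1,1)] L2_inner_integrable[OF assms(2,2)] by simp
qed

lemma L2_Cauchy_Schwarz:
  assumes "L2 M f" "L2 M g"
  shows "\<bar>\<integral>x. f x \<bullet> g x \<partial>M\<bar> \<le> sqrt (\<integral>x. f x \<bullet> f x \<partial>M) * sqrt (\<integral>x. g x \<bullet> g x \<partial>M)"
proof -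
  define a b c where "a = (\<integral>x. f x \<bullet> f x \<partial>M)" and "b = (\<integral>x. f x \<bullet> g x \<partial>M)" and "c = (\<integral>x. g x \<bullet> g x \<partial>M)"
  have q: "0 \<le> a + 2 * t * b + t * t * c" for t
    unfolding a_def b_def c_def L2_norm_expand[OF assms, symmetric] by (rule integral_nonneg_AE) simp
  have ac: "0 \<le> a" "0 \<le> c" unfolding a_def c_def by (intro integral_nonneg_AE; simp)+
  have "b\<^sup>2 \<le> a * c"
  proof (cases "c = 0")
    case True
    have "b = 0"
    proof (rule ccontr)
      assume "b \<noteq> 0"
      then have "2 * (- (a + 1) / b) * b = - 2 * (a + 1)" by simp
      then show False using q[of "- (a + 1) / b"] True ac by simp
    qed
    then show ?thesis using True by simp
  next
    case False
    then have "0 < c" using ac by simp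
    then show ?thesis using q[of "- b / c"] by (simp add: field_simps power2_eq_square)
  qed
  then have "sqrt (b\<^sup>2) \<le> sqrt (a * c)" by (rule real_sqrt_le_mono)
  then show ?thesis by (simp add: a_def b_def c_def real_sqrt_mult)
qed

definition L2_lim :: "'a measure \<Rightarrow> (nat \<Rightarrow> 'a \<Rightarrow> 'b::euclidean_space) \<Rightarrow> ('a \<Rightarrow> 'b) \<Rightarrow> bool" where
  "L2_lim M F f \<longleftrightarrow> (\<forall>n. L2 M (F n)) \<and> L2 M f \<and> (\<lambda>n. \<integral>x. (f x - F n x) \<bullet> (f x - F n x) \<partial>M) \<longlonglongrightarrow> 0"

lemma L2_lim_const: "L2 M f \<Longrightarrow> L2_lim M (\<lambda>_. f) f"
  by (simp add: L2_lim_def)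

lemma L2_lim_inner:
  assumes F: "L2_lim M F f" and G: "L2_lim M G g"
  shows "(\<lambda>n. \<integral>x. F n x \<bullet> G n x \<partial>M) \<longlonglongrightarrow> (\<integral>x. f x \<bullet> g x \<partial>M)"
proof -
  have L: "L2 M (F n)" "L2 M f" "L2 M (G n)" "L2 M g" for n using F G by (auto simp: L2_lim_def)
  define A B where "A n x = f x - F n x" and "B n x = g x - G n x" for n x
  have LA: "L2 M (A n)" "L2 M (B n)" for n unfolding A_def[abs_def] B_def[abs_def] by (intro L2_diff L)+
  have sA: "(\<lambda>n. sqrt (\<integral>x. A n x \<bullet> A n x \<partial>M)) \<longlonglongrightarrow> 0" "(\<lambda>n. sqrt (\<integral>x. B n x \<bullet> B n x \<partial>M)) \<longlonglongrightarrow> 0"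
    using F G tendsto_real_sqrt[of _ 0 sequentially] by (auto simp: L2_lim_def A_def B_def)
  have nn: "0 \<le> (\<integral>x. h x \<bullet> h x \<partial>M)" for h :: "'a \<Rightarrow> 'b" by (rule integral_nonneg_AE) simp
  have 1: "(\<lambda>n. \<integral>x. A n x \<bullet> g x \<partial>M) \<longlonglongrightarrow> 0"
  proof (rule tendsto_0_le[OF sA(1), where K = "sqrt (\<integral>x. g x \<bullet> g x \<partial>M)"])
    show "\<forall>\<^sub>F n in sequentially. norm (\<integral>x. A n x \<bullet> g x \<partial>M) \<le> norm (sqrt (\<integral>x. A n x \<bullet> A n x \<partial>M)) * sqrt (\<integral>x. g x \<bullet> g x \<partial>M)"
      using L2_Cauchy_Schwarz[OF LA(1) L(4)] nn by (intro always_eventually allI) simp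
  qed
  have 2: "(\<lambda>n. \<integral>x. f x \<bullet> B n x \<partial>M) \<longlonglongrightarrow> 0"
  proof (rule tendsto_0_le[OF sA(2), where K = "sqrt (\<integral>x. f x \<bullet> f x \<partial>M)"])
    show "\<forall>\<^sub>F n in sequentially. norm (\<integral>x. f x \<bullet> B n x \<partial>M) \<le> norm (sqrt (\<integral>x. B n x \<bullet> B n x \<partial>M)) * sqrt (\<integral>x. f x \<bullet> f x \<partial>M)"
      using L2_Cauchy_Schwarz[OF L(2) LA(2)] nn by (intro always_eventually allI) (simp add: mult.commute)
  qed
  have 3: "(\<lambda>n. \<integral>x. A n x \<bullet> B n x \<partial>M) \<longlonglongrightarrow> 0"
  proof (rule tendsto_0_le[OF tendsto_mult[OF sA, simplified], where K = 1])
    show "\<forall>\<^sub>F n in sequentially. norm (\<integral>x. A n x \<bullet> B n x \<partial>M) \<le> norm (sqrt (\<integral>x. A n x \<bullet> A n x \<partial>M) * sqrt (\<integral>x. B n x \<bullet> B n x \<partial>M)) * 1"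
      using L2_Cauchy_Schwarz[OF LA(1) LA(2)] nn by (intro always_eventually allI) (simp add: abs_mult)
  qed
  have "(\<integral>x. F n x \<bullet> G n x \<partial>M) = (\<integral>x. f x \<bullet> g x - A n x \<bullet> g x - f x \<bullet> B n x + A n x \<bullet> B n x \<partial>M)" for n
    by (simp add: A_def B_def inner_diff_left inner_diff_right)
  also have "\<dots> n = (\<integral>x. f x \<bullet> g x \<partial>M) - (\<integral>x. A n x \<bullet> g x \<partial>M) - (\<integral>x. f x \<bullet> B n x \<partial>M) + (\<integral>x. A n x \<bullet> B n x \<partial>M)" for n
    using L2_inner_integrable[OF L(2) L(4)] L2_inner_integrable[OF LA(1) L(4), of n] L2_inner_integrable[OF L(2) LA(2), of n] L2_inner_integrable[OF LA(1) LA(2), of n n] by simp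
  finally have "(\<lambda>n. \<integral>x. F n x \<bullet> G n x \<partial>M) = (\<lambda>n. (\<integral>x. f x \<bullet> g x \<partial>M) - (\<integral>x. A n x \<bullet> g x \<partial>M) - (\<integral>x. f x \<bullet> B n x \<partial>M) + (\<integral>x. A n x \<bullet> B n x \<partial>M))"
    by blast
  then show ?thesis using tendsto_add[OF tendsto_diff[OF tendsto_diff[OF tendsto_const 1] 2] 3, of "\<integral>x. f x \<bullet> g x \<partial>M"] by simp
qed

lemma L2_lim_add_cmult:
  assumes F: "L2_lim M F f" and G: "L2_lim M G g"
  shows "L2_lim M (\<lambda>n x. F n x + c *\<^sub>R G n x) (\<lambda>x. f x + c *\<^sub>R g x)"
  unfolding L2_lim_def
proof (intro conjI allI)
  have L: "L2 M (F n)" "L2 M f" "L2 M (G n)" "L2 M g" for n using F G by (auto simp: L2_lim_def)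
  then show "L2 M (\<lambda>x. F n x + c *\<^sub>R G n x)" "L2 M (\<lambda>x. f x + c *\<^sub>R g x)" for n by (auto intro: L2_add_cmult)
  define A B where "A n x = f x - F n x" and "B n x = g x - G n x" for n x
  have LA: "L2 M (A n)" "L2 M (B n)" for n unfolding A_def[abs_def] B_def[abs_def] by (intro L2_diff L)+
  have z: "L2 M (\<lambda>_. 0 :: 'b)" by (simp add: L2_def)
  have "(\<lambda>n. \<integral>x. A n x \<bullet> A n x \<partial>M) \<longlonglongrightarrow> 0" "(\<lambda>n. \<integral>x. B n x \<bullet> B n x \<partial>M) \<longlonglongrightarrow> 0"
    using F G by (auto simp: L2_lim_def A_def B_def)
  then have lA: "L2_lim M A (\<lambda>_. 0)" "L2_lim M B (\<lambda>_. 0)"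
    using LA z by (auto simp: L2_lim_def)
  have "(\<lambda>n. (\<integral>x. A n x \<bullet> A n x \<partial>M) + 2 * c * (\<integral>x. A n x \<bullet> B n x \<partial>M) + c * c * (\<integral>x. B n x \<bullet> B n x \<partial>M)) \<longlonglongrightarrow> 0 + 2 * c * 0 + c * c * 0"
    using L2_lim_inner[OF lA(1) lA(1)] L2_lim_inner[OF lA(1) lA(2)] L2_lim_inner[OF lA(2) lA(2)]
    by (intro tendsto_add tendsto_mult_left) auto
  moreover have "(\<integral>x. (f x + c *\<^sub>R g x - (F n x + c *\<^sub>R G n x)) \<bullet> (f x + c *\<^sub>R g x - (F n x + c *\<^sub>R G n x)) \<partial>M) =
     (\<integral>x. A n x \<bullet> A n x \<partial>M) + 2 * c * (\<integral>x. A n x \<bullet> B n x \<partial>M) + c * c * (\<integral>x. B n x \<bullet> B n x \<partial>M)" for n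
    unfolding L2_norm_expand[OF LA, symmetric] by (simp add: A_def B_def algebra_simps)
  ultimately show "(\<lambda>n. \<integral>x. (f x + c *\<^sub>R g x - (F n x + c *\<^sub>R G n x)) \<bullet> (f x + c *\<^sub>R g x - (F n x + c *\<^sub>R G n x)) \<partial>M) \<longlonglongrightarrow> 0"
    by simp
qed

section \<open>Eigenfunctions and Riesz means on a region of the sphere\<close>

text \<open>Multiplicity times distance to the threshold, over half of the degrees. All degrees below \<open>L\<close> together
  would give \<open>z\<^sup>2 / 2\<close>, which exceeds twice this value by \<open>z\<close>; this is what restricting the parity gains.\<close>

lemma weighted_degree_sum:
  fixes L :: nat
  defines "z \<equiv> eigval L"
  shows "(\<Sum>l<L. if even (l + L) then (2 * real l + 1) * (z - eigval l) else 0) = z * (z - 2) / 4"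
proof -
  have A: "(\<Sum>l<L. if even (l + L) then 2 * real l + 1 else 0) = real L * (real L - 1) / 2" for L
    by (induction L rule: induct_nat_012) (simp_all add: field_simps)
  have B: "(\<Sum>l<L. if even (l + L) then (2 * real l + 1) * (eigval l) else 0) = eigval L * (real L - 1) * (real L - 2) / 4" for L
    by (induction L rule: induct_nat_012) (simp_all add: field_simps)
  have "(\<Sum>l<L. if even (l + L) then (2 * real l + 1) * (z - eigval l) else 0) =
    z * (\<Sum>l<L. if even (l + L) then 2 * real l + 1 else 0) - (\<Sum>l<L. if even (l + L) then (2 * real l + 1) * (eigval l) else 0)"
    unfolding sum_distrib_left sum_subtractf[symmetric] by (intro sum.cong) (auto simp: algebra_simps)
  then show ?thesis unfolding A B by (simp add: z_def field_simps)
qed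

locale sphere_region =
  fixes \<Omega> :: "(real^3) set"
  assumes subset_sphere: "\<Omega> \<subseteq> unit_sphere" and borel: "\<Omega> \<in> sets borel"
begin

abbreviation \<mu> :: "(real^3) measure" where "\<mu> \<equiv> area_on \<Omega>"

abbreviation ip :: "(real^3 \<Rightarrow> 'b::euclidean_space) \<Rightarrow> (real^3 \<Rightarrow> 'b) \<Rightarrow> real" where
  "ip f g \<equiv> \<integral>x. f x \<bullet> g x \<partial>\<mu>"

abbreviation E :: "real \<Rightarrow> (real^3 \<Rightarrow> real) set" where "E \<equiv> dirichlet_eigenspace \<Omega>"

abbreviation area :: real where "area \<equiv> measure surface_measure \<Omega>"

lemma square_integrable_on_iff: "square_integrable_on \<Omega> f \<longleftrightarrow> L2 \<mu> f" for f :: "real^3 \<Rightarrow> 'b::euclidean_space"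
  by (simp add: square_integrable_on_def L2_def set_borel_measurable_iff_area_on[OF borel] set_integrable_iff_area_on[OF borel] power2_norm_eq_inner)

lemma L2_continuous:
  fixes f :: "real^3 \<Rightarrow> 'b::euclidean_space"
  assumes "continuous_on unit_sphere f" shows "L2 \<mu> f"
  unfolding L2_def using assms subset_sphere borel
  by (auto intro!: measurable_area_on_continuous[where S = unit_sphere] integrable_area_on_continuous continuous_intros)

lemma sobolev_iff: "sobolev \<Omega> u g \<longleftrightarrow> L2 \<mu> u \<and> L2 \<mu> g \<and> (\<forall>x\<in>\<Omega>. g x \<bullet> x = 0) \<and>
    (\<forall>X\<in>test_fields \<Omega>. ip u (sphere_div X) = - ip g X)"
  by (simp add: sobolev_def has_weak_gradient_def square_integrable_on_iff set_integral_eq_area_on[OF borel])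

lemma sobolev_add_cmult:
  assumes "sobolev \<Omega> u g" "sobolev \<Omega> v h"
  shows "sobolev \<Omega> (\<lambda>x. u x + c * v x) (\<lambda>x. g x + c *\<^sub>R h x)"
proof -
  have L: "L2 \<mu> u" "L2 \<mu> g" "L2 \<mu> v" "L2 \<mu> h" using assms by (auto simp: sobolev_iff)
  have "ip (\<lambda>x. u x + c * v x) (sphere_div X) = - ip (\<lambda>x. g x + c *\<^sub>R h x) X" if X: "X \<in> test_fields \<Omega>" for X
  proof -
    have LX: "L2 \<mu> X" "L2 \<mu> (sphere_div X)" by (intro L2_continuous continuous_on_sphere_div[OF X])+
    have "ip (\<lambda>x. u x + c * v x) (sphere_div X) = ip u (sphere_div X) + c * ip v (sphere_div X)"
      using L2_inner_integrable[OF L(1) LX(2)] L2_inner_integrable[OF L(3) LX(2)] by (simp add: inner_add_left algebra_simps)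
    moreover have "ip (\<lambda>x. g x + c *\<^sub>R h x) X = ip g X + c * ip h X"
      using L2_inner_integrable[OF L(2) LX(1)] L2_inner_integrable[OF L(4) LX(1)] by (simp add: inner_add_left)
    moreover have "ip u (sphere_div X) = - ip g X" "ip v (sphere_div X) = - ip h X"
      using assms X by (auto simp: sobolev_iff)
    ultimately show ?thesis by simp
  qed
  moreover have "L2 \<mu> (\<lambda>x. u x + c * v x)" "L2 \<mu> (\<lambda>x. g x + c *\<^sub>R h x)"
    using L2_add_cmult[OF L(1,3), of c] L2_add_cmult[OF L(2,4), of c] by simp_all
  ultimately show ?thesis using assms by (auto simp: sobolev_iff inner_add_left)
qed

lemma test_function_L2:
  assumes "\<phi> \<in> test_functions \<Omega>"
  shows "L2 \<mu> \<phi>" "L2 \<mu> (sphere_grad \<phi>)"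
  using test_function_sphere_C1[OF assms] sphere_C1_imp_continuous_on
  by (auto simp: sphere_C1_def intro!: L2_continuous)

text \<open>Membership in terms of sequences of test functions, which lends itself to linear combinations and
  to limits of quadratic forms.\<close>

lemma H10_iff: "u \<in> H10 \<Omega> \<longleftrightarrow> (\<exists>g \<phi>. sobolev \<Omega> u g \<and> (\<forall>n. \<phi> n \<in> test_functions \<Omega>) \<and> L2_lim \<mu> \<phi> u \<and> L2_lim \<mu> (\<lambda>n. sphere_grad (\<phi> n)) g)"
proof
  define D where "D u g \<phi> = (LINT x:\<Omega>|surface_measure. (u x - \<phi> x)\<^sup>2) + (LINT x:\<Omega>|surface_measure. (norm (g x - sphere_grad \<phi> x))\<^sup>2)" for u \<phi> g
  have D: "D u g \<phi> = ip (\<lambda>x. u x - \<phi> x) (\<lambda>x. u x - \<phi> x) + ip (\<lambda>x. g x - sphere_grad \<phi> x) (\<lambda>x. g x - sphere_grad \<phi> x)" for u g \<phi>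
    by (simp add: D_def set_integral_eq_area_on[OF borel] power2_norm_eq_inner) (simp add: power2_eq_square)
  have nn: "0 \<le> ip f f" for f :: "real^3 \<Rightarrow> 'b::euclidean_space" by (rule integral_nonneg_AE) simp
  {
    assume "u \<in> H10 \<Omega>"
    then obtain g where g: "sobolev \<Omega> u g" and e: "\<And>e. e > 0 \<Longrightarrow> \<exists>\<phi>\<in>test_functions \<Omega>. D u g \<phi> < e"
      by (auto simp: H10_def D_def)
    have "\<exists>\<phi>\<in>test_functions \<Omega>. D u g \<phi> < inverse (real (Suc n))" for n by (rule e) simp
    then obtain \<phi> where \<phi>: "\<And>n. \<phi> n \<in> test_functions \<Omega>" "\<And>n. D u g (\<phi> n) < inverse (real (Suc n))"
      by metis
    let ?d = "\<lambda>n. ip (\<lambda>x. u x - \<phi> n x) (\<lambda>x. u x - \<phi> n x)" and ?e = "\<lambda>n. ip (\<lambda>x. g x - sphere_grad (\<phi> n) x) (\<lambda>x. g x - sphere_grad (\<phi> n) x)"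
    have lim0: "f \<longlonglongrightarrow> 0" if "\<And>n. 0 \<le> f n" "\<And>n. f n \<le> inverse (real (Suc n))" for f :: "nat \<Rightarrow> real"
      by (rule tendsto_sandwich[OF _ _ tendsto_const LIMSEQ_inverse_real_of_nat]) (simp_all only: that eventually_True)
    have nd: "0 \<le> ?d n" "0 \<le> ?e n" for n by (rule nn)+
    have "?d n \<le> inverse (real (Suc n))" "?e n \<le> inverse (real (Suc n))" for n
      using \<phi>(2)[of n] nd[of n] unfolding D by linarith+
    then have 1: "?d \<longlonglongrightarrow> 0" and 2: "?e \<longlonglongrightarrow> 0" using nd by (intro lim0; blast)+
    have "L2_lim \<mu> \<phi> u" "L2_lim \<mu> (\<lambda>n. sphere_grad (\<phi> n)) g"
      using 1 2 g \<phi>(1) test_function_L2 by (auto simp: L2_lim_def sobolev_iff)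
    then show "\<exists>g \<phi>. sobolev \<Omega> u g \<and> (\<forall>n. \<phi> n \<in> test_functions \<Omega>) \<and> L2_lim \<mu> \<phi> u \<and> L2_lim \<mu> (\<lambda>n. sphere_grad (\<phi> n)) g"
      using g \<phi>(1) by blast
  }
  {
    assume "\<exists>g \<phi>. sobolev \<Omega> u g \<and> (\<forall>n. \<phi> n \<in> test_functions \<Omega>) \<and> L2_lim \<mu> \<phi> u \<and> L2_lim \<mu> (\<lambda>n. sphere_grad (\<phi> n)) g"
    then obtain g \<phi> where g: "sobolev \<Omega> u g" and \<phi>: "\<And>n. \<phi> n \<in> test_functions \<Omega>" and l: "L2_lim \<mu> \<phi> u" "L2_lim \<mu> (\<lambda>n. sphere_grad (\<phi> n)) g"
      by blast
    have "(\<lambda>n. D u g (\<phi> n)) \<longlonglongrightarrow> 0 + 0"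
      unfolding D using l by (intro tendsto_add) (auto simp: L2_lim_def)
    then have "\<exists>\<phi>\<in>test_functions \<Omega>. D u g \<phi> < e" if "e > 0" for e
      using order_tendstoD(2)[of "\<lambda>n. D u g (\<phi> n)" 0 sequentially e] that \<phi> by (auto simp: eventually_sequentially)
    then show "u \<in> H10 \<Omega>" using g by (auto simp: H10_def D_def)
  }
qed

lemma H10_add_cmult:
  assumes "u \<in> H10 \<Omega>" "v \<in> H10 \<Omega>"
  shows "(\<lambda>x. u x + c * v x) \<in> H10 \<Omega>"
proof -
  obtain g \<phi> where g: "sobolev \<Omega> u g" and \<phi>: "\<And>n. \<phi> n \<in> test_functions \<Omega>" and l: "L2_lim \<mu> \<phi> u" "L2_lim \<mu> (\<lambda>n. sphere_grad (\<phi> n)) g"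
    using assms(1) by (auto simp: H10_iff)
  obtain h \<psi> where h: "sobolev \<Omega> v h" and \<psi>: "\<And>n. \<psi> n \<in> test_functions \<Omega>" and m: "L2_lim \<mu> \<psi> v" "L2_lim \<mu> (\<lambda>n. sphere_grad (\<psi> n)) h"
    using assms(2) by (auto simp: H10_iff)
  define \<theta> where "\<theta> n x = \<phi> n x + c * \<psi> n x" for n x
  have \<theta>: "\<theta> n \<in> test_functions \<Omega>" for n
    using test_functions_add_cmult[OF \<phi> \<psi>, of n c n] by (simp add: \<theta>_def[abs_def])
  have "sphere_C1 (\<theta> n) (\<lambda>x. sphere_grad (\<phi> n) x + c *\<^sub>R sphere_grad (\<psi> n) x)" for n
    unfolding \<theta>_def[abs_def] by (intro sphere_C1_add_cmult test_function_sphere_C1[OF \<phi>] test_function_sphere_C1[OF \<psi>])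
  then have gr: "sphere_grad (\<theta> n) x = sphere_grad (\<phi> n) x + c *\<^sub>R sphere_grad (\<psi> n) x" if "x \<in> \<Omega>" for n x
    using sphere_C1_sphere_grad subset_sphere that by blast
  have "L2_lim \<mu> \<theta> (\<lambda>x. u x + c * v x)"
    using L2_lim_add_cmult[OF l(1) m(1), of c] by (simp add: \<theta>_def[abs_def])
  moreover have "L2_lim \<mu> (\<lambda>n. sphere_grad (\<theta> n)) (\<lambda>x. g x + c *\<^sub>R h x)"
  proof -
    have "(\<lambda>n. ip (\<lambda>x. g x + c *\<^sub>R h x - sphere_grad (\<theta> n) x) (\<lambda>x. g x + c *\<^sub>R h x - sphere_grad (\<theta> n) x)) =
      (\<lambda>n. ip (\<lambda>x. g x + c *\<^sub>R h x - (sphere_grad (\<phi> n) x + c *\<^sub>R sphere_grad (\<psi> n) x)) (\<lambda>x. g x + c *\<^sub>R h x - (sphere_grad (\<phi> n) x + c *\<^sub>R sphere_grad (\<psi> n) x)))"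
      by (intro ext Bochner_Integration.integral_cong) (auto simp: gr)
    then show ?thesis
      using L2_lim_add_cmult[OF l(2) m(2), of c] test_function_L2(2)[OF \<theta>] by (simp add: L2_lim_def)
  qed
  ultimately show ?thesis unfolding H10_iff using sobolev_add_cmult[OF g h, of c] \<theta> by blast
qed

lemma eigenspace_iff: "u \<in> E k \<longleftrightarrow> u \<in> H10 \<Omega> \<and> (\<exists>g. sobolev \<Omega> u g \<and>
     (\<forall>\<phi>\<in>H10 \<Omega>. \<forall>h. sobolev \<Omega> \<phi> h \<longrightarrow> ip g h = k * ip u \<phi>))"
  by (simp add: dirichlet_eigenspace_def set_integral_eq_area_on[OF borel])

lemma eigenspace_L2: "u \<in> E k \<Longrightarrow> L2 \<mu> u"
  by (auto simp: eigenspace_iff sobolev_iff)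

lemma eigenspace_add_cmult:
  assumes "u \<in> E k" "v \<in> E k"
  shows "(\<lambda>x. u x + c * v x) \<in> E k"
proof -
  obtain g where g: "sobolev \<Omega> u g" "\<And>\<phi> h. \<phi> \<in> H10 \<Omega> \<Longrightarrow> sobolev \<Omega> \<phi> h \<Longrightarrow> ip g h = k * ip u \<phi>"
    using assms(1) by (auto simp: eigenspace_iff)
  obtain f where f: "sobolev \<Omega> v f" "\<And>\<phi> h. \<phi> \<in> H10 \<Omega> \<Longrightarrow> sobolev \<Omega> \<phi> h \<Longrightarrow> ip f h = k * ip v \<phi>"
    using assms(2) by (auto simp: eigenspace_iff)
  have "ip (\<lambda>x. g x + c *\<^sub>R f x) h = k * ip (\<lambda>x. u x + c * v x) \<phi>" if "\<phi> \<in> H10 \<Omega>" "sobolev \<Omega> \<phi> h" for \<phi> h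
  proof -
    have L: "L2 \<mu> \<phi>" "L2 \<mu> h" "L2 \<mu> u" "L2 \<mu> v" "L2 \<mu> g" "L2 \<mu> f"
      using that g(1) f(1) by (auto simp: sobolev_iff)
    have "ip (\<lambda>x. g x + c *\<^sub>R f x) h = ip g h + c * ip f h"
      using L2_inner_integrable[OF L(5,2)] L2_inner_integrable[OF L(6,2)] by (simp add: inner_add_left)
    moreover have "ip (\<lambda>x. u x + c * v x) \<phi> = ip u \<phi> + c * ip v \<phi>"
      using L2_inner_integrable[OF L(3,1)] L2_inner_integrable[OF L(4,1)] by (simp add: inner_add_left algebra_simps)
    ultimately show ?thesis using g(2)[OF that] f(2)[OF that] by (simp add: algebra_simps)
  qed
  then show ?thesis
    using assms H10_add_cmult sobolev_add_cmult[OF g(1) f(1), of c] by (auto simp: eigenspace_iff)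
qed

lemma eigenspaces_orthogonal:
  assumes u: "u \<in> E k" and v: "v \<in> E l" and "k \<noteq> l"
  shows "ip u v = 0"
proof -
  obtain g where g: "sobolev \<Omega> u g" "\<And>\<phi> h. \<phi> \<in> H10 \<Omega> \<Longrightarrow> sobolev \<Omega> \<phi> h \<Longrightarrow> ip g h = k * ip u \<phi>"
    using u by (auto simp: eigenspace_iff)
  obtain f where f: "sobolev \<Omega> v f" "\<And>\<phi> h. \<phi> \<in> H10 \<Omega> \<Longrightarrow> sobolev \<Omega> \<phi> h \<Longrightarrow> ip f h = l * ip v \<phi>"
    using v by (auto simp: eigenspace_iff)
  have "ip g f = k * ip u v" "ip f g = l * ip v u"
    using g f u v by (auto simp: eigenspace_iff)
  moreover have "ip f g = ip g f" "ip v u = ip u v"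
    by (intro Bochner_Integration.integral_cong refl inner_commute)+
  ultimately have "k * ip u v = l * ip u v" by metis
  then show ?thesis using assms(3) by simp
qed

text \<open>The gradient \<open>f\<close> in the weak equation and the gradient \<open>g\<close> approximated by test functions are a priori
  two weak gradients of \<open>u\<close>. They agree when tested against gradients of test functions, because these are
  test fields, and hence in the limit against \<open>g\<close>; this is enough for the energy of the approximants
  to tend to that of the eigenvalue equation.\<close>

lemma eigenfunction_approximation:
  assumes u: "u \<in> E k"
  obtains \<phi> where "\<And>n. \<phi> n \<in> test_functions \<Omega>" "L2_lim \<mu> \<phi> u" "(\<lambda>n. ip (sphere_grad (\<phi> n)) (sphere_grad (\<phi> n))) \<longlonglongrightarrow> k * ip u u"
proof -
  obtain f where f: "sobolev \<Omega> u f" "\<And>\<phi> h. \<phi> \<in> H10 \<Omega> \<Longrightarrow> sobolev \<Omega> \<phi> h \<Longrightarrow> ip f h = k * ip u \<phi>"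
    using u by (auto simp: eigenspace_iff)
  obtain g \<phi> where g: "sobolev \<Omega> u g" and \<phi>: "\<And>n. \<phi> n \<in> test_functions \<Omega>" and l: "L2_lim \<mu> \<phi> u" "L2_lim \<mu> (\<lambda>n. sphere_grad (\<phi> n)) g"
    using u by (auto simp: eigenspace_iff H10_iff)
  have Lf: "L2 \<mu> f" using f(1) by (simp add: sobolev_iff)
  have Lg: "L2 \<mu> g" using g by (simp add: sobolev_iff)
  have fg: "ip f g = k * ip u u" using f(2)[OF _ g] u by (simp add: eigenspace_iff)
  have "ip f (sphere_grad (\<phi> n)) = ip g (sphere_grad (\<phi> n))" for n
    using f(1) g sphere_grad_test_field[OF \<phi>[of n]] by (force simp: sobolev_iff)
  then have "(\<lambda>n. ip f (sphere_grad (\<phi> n))) \<longlonglongrightarrow> ip g g"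
    using L2_lim_inner[OF L2_lim_const[OF Lg] l(2)] by simp
  moreover have "(\<lambda>n. ip f (sphere_grad (\<phi> n))) \<longlonglongrightarrow> ip f g"
    by (rule L2_lim_inner[OF L2_lim_const[OF Lf] l(2)])
  ultimately have "ip g g = ip f g" by (rule LIMSEQ_unique)
  moreover have "(\<lambda>n. ip (sphere_grad (\<phi> n)) (sphere_grad (\<phi> n))) \<longlonglongrightarrow> ip g g"
    by (rule L2_lim_inner[OF l(2) l(2)])
  ultimately have "(\<lambda>n. ip (sphere_grad (\<phi> n)) (sphere_grad (\<phi> n))) \<longlonglongrightarrow> k * ip u u" using fg by simp
  then show ?thesis by (rule that[OF \<phi> l(1)])
qed

lemma L2_integrable:
  fixes u :: "real^3 \<Rightarrow> real"
  assumes "L2 \<mu> u" shows "integrable \<mu> u"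
  using L2_inner_integrable[OF assms L2_continuous[of "\<lambda>_. 1"]] by simp

lemma sint_restrict:
  fixes f :: "real^3 \<Rightarrow> real"
  assumes "\<And>x. x \<in> unit_sphere - \<Omega> \<Longrightarrow> f x = 0"
  shows "sint f = integral\<^sup>L \<mu> f"
proof -
  have "(\<lambda>x. indicator unit_sphere x *\<^sub>R f x) = (\<lambda>x. indicator \<Omega> x *\<^sub>R f x)"
    using assms subset_sphere by (auto simp: fun_eq_iff indicator_def)
  then show ?thesis
    by (simp add: set_integral_eq_area_on[symmetric] borel set_lebesgue_integral_def)
qed

text \<open>The zonal transform of the extension of \<open>u\<close> by zero.\<close>

definition region_transform :: "real poly \<Rightarrow> (real^3 \<Rightarrow> real) \<Rightarrow> real^3 \<Rightarrow> real" where
  "region_transform p u w = ip (\<lambda>y. poly p (w \<bullet> y)) u"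

lemma L2_zonal: "L2 \<mu> (\<lambda>y. poly p (w \<bullet> y))"
  by (intro L2_continuous continuous_intros)

lemma continuous_on_region_transform:
  assumes "L2 \<mu> u" shows "continuous_on unit_sphere (region_transform p u)"
proof -
  have "continuous_on unit_sphere (\<lambda>x. \<integral>y. poly p (x \<bullet> y) *\<^sub>R u y \<partial>\<mu>)"
    using subset_sphere borel L2_integrable[OF assms]
    by (intro continuous_on_kernel_integral) (auto simp: case_prod_unfold intro!: continuous_intros)
  then show ?thesis by (simp add: region_transform_def[abs_def])
qed

lemma region_transform_limit:
  assumes lim: "L2_lim \<mu> \<phi> u"
  shows "(\<lambda>n. sint (\<lambda>w. (region_transform p (\<phi> n) w)\<^sup>2)) \<longlonglongrightarrow> sint (\<lambda>w. (region_transform p u w)\<^sup>2)"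
proof -
  have L: "L2 \<mu> u" "L2 \<mu> (\<phi> n)" for n using lim by (auto simp: L2_lim_def)
  have nn: "0 \<le> ip h h" for h :: "real^3 \<Rightarrow> real" by (rule integral_nonneg_AE) simp
  have "continuous_on {-1..1} (poly p)" by (intro continuous_intros)
  then obtain B where B: "\<And>t. t \<in> {-1..1} \<Longrightarrow> norm (poly p t) \<le> B"
    using continuous_on_compact_bound[OF compact_Icc] by metis
  define C where "C = B * B * measure \<mu> \<Omega>"
  have C: "ip (\<lambda>y. poly p (w \<bullet> y)) (\<lambda>y. poly p (w \<bullet> y)) \<le> C" if w: "w \<in> unit_sphere" for w
  proof -
    interpret finite_measure \<mu> using borel by simp
    have "ip (\<lambda>y. poly p (w \<bullet> y)) (\<lambda>y. poly p (w \<bullet> y)) \<le> (\<integral>y. B * B \<partial>\<mu>)"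
    proof (rule integral_mono)
      show "integrable \<mu> (\<lambda>y. poly p (w \<bullet> y) \<bullet> poly p (w \<bullet> y))"
        using L2_inner_integrable[OF L2_zonal L2_zonal] .
      fix y assume "y \<in> space \<mu>"
      then have "\<bar>w \<bullet> y\<bar> \<le> 1" using Cauchy_Schwarz_ineq2[of w y] w subset_sphere by auto
      then have "\<bar>poly p (w \<bullet> y)\<bar> \<le> B" using B[of "w \<bullet> y"] by (auto simp: abs_le_iff)
      then have "\<bar>poly p (w \<bullet> y)\<bar> * \<bar>poly p (w \<bullet> y)\<bar> \<le> B * B" by (intro mult_mono) auto
      then show "poly p (w \<bullet> y) \<bullet> poly p (w \<bullet> y) \<le> B * B" by (simp flip: abs_mult)
    qed simp
    then show ?thesis by (simp add: C_def mult.commute)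
  qed
  have "convergent (\<lambda>n. ip (\<phi> n) (\<phi> n))"
    using L2_lim_inner[OF lim lim] by (auto simp: convergent_def)
  from convergent_imp_Bseq[OF this] obtain D where D: "\<And>n. norm (ip (\<phi> n) (\<phi> n)) \<le> D"
    unfolding Bseq_def by blast
  show ?thesis
  proof (rule integral_dominated_convergence[where w = "\<lambda>_. C * D"])
    show "AE w in area_on unit_sphere. (\<lambda>n. (region_transform p (\<phi> n) w)\<^sup>2) \<longlonglongrightarrow> (region_transform p u w)\<^sup>2"
      unfolding region_transform_def by (intro AE_I2 tendsto_power L2_lim_inner[OF L2_lim_const[OF L2_zonal] lim])
    show "AE w in area_on unit_sphere. norm ((region_transform p (\<phi> n) w)\<^sup>2) \<le> C * D" for n
    proof (rule AE_I2)
      fix w :: "real^3" assume "w \<in> space (area_on unit_sphere)"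
      then have w: "w \<in> unit_sphere" by simp
      have C0: "0 \<le> C" by (rule order_trans[OF nn C[OF w]])
      have D0: "0 \<le> D" by (rule order_trans[OF norm_ge_zero D])
      have "\<bar>region_transform p (\<phi> n) w\<bar> \<le> sqrt (ip (\<lambda>y. poly p (w \<bullet> y)) (\<lambda>y. poly p (w \<bullet> y))) * sqrt (ip (\<phi> n) (\<phi> n))"
        unfolding region_transform_def by (rule L2_Cauchy_Schwarz[OF L2_zonal L(2)])
      also have "\<dots> \<le> sqrt C * sqrt D"
        using C[OF w] D[of n] nn C0 by (intro mult_mono real_sqrt_le_mono) (auto simp: abs_le_iff)
      finally have "\<bar>region_transform p (\<phi> n) w\<bar>\<^sup>2 \<le> (sqrt C * sqrt D)\<^sup>2" by (intro power_mono) auto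
      then show "norm ((region_transform p (\<phi> n) w)\<^sup>2) \<le> C * D" using C0 D0 by (simp add: power_mult_distrib)
    qed
    show "integrable (area_on unit_sphere) (\<lambda>_. C * D)" by (intro integrable_sphere continuous_intros)
  qed (intro measurable_area_on_continuous[where S = unit_sphere] continuous_intros continuous_on_region_transform L order_refl)+
qed

text \<open>The antipodal spectral inequality passes from test functions to eigenfunctions: every term is a
  continuous quadratic form along the approximating sequence.\<close>

lemma eigenfunction_inequality:
  assumes hemi: "\<Omega> \<subseteq> open_hemisphere" and u: "u \<in> E k"
  fixes L :: nat
  defines "z \<equiv> eigval L"
  shows "(z - k) * ip u u \<le> (\<Sum>l<L. if even (l + L) then 2 * (z - eigval l) * sint (\<lambda>w. (region_transform (harmonic_kernel l) u w)\<^sup>2) else 0)" (is "_ \<le> ?R u")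
proof -
  obtain \<phi> where \<phi>: "\<And>n. \<phi> n \<in> test_functions \<Omega>" and lim: "L2_lim \<mu> \<phi> u" and en: "(\<lambda>n. ip (sphere_grad (\<phi> n)) (sphere_grad (\<phi> n))) \<longlonglongrightarrow> k * ip u u"
    using eigenfunction_approximation[OF u] by blast
  have "z * ip (\<phi> n) (\<phi> n) - ip (sphere_grad (\<phi> n)) (sphere_grad (\<phi> n)) \<le>
     ?R (\<phi> n)" for n
  proof -
    have v: "\<phi> n x = 0" "sphere_grad (\<phi> n) x = 0" if "x \<in> unit_sphere - \<Omega>" for x
      using test_function_vanishes[OF \<phi> that] test_function_vanishes[OF _ that, of "sphere_grad (\<phi> n)"] sphere_grad_test_field[OF \<phi>, of n]
      by (auto simp: test_fields_def)
    have anti: "x \<in> unit_sphere - \<Omega> \<or> - x \<in> unit_sphere - \<Omega>" if "x \<in> unit_sphere" for x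
    proof (rule ccontr)
      assume "\<not> ?thesis"
      then have "x \<in> open_hemisphere" "- x \<in> open_hemisphere" using that hemi by auto
      then show False by (simp add: open_hemisphere_def)
    qed
    have "z * sint (\<lambda>x. (\<phi> n x)\<^sup>2) - sint (\<lambda>x. sphere_grad (\<phi> n) x \<bullet> sphere_grad (\<phi> n) x) \<le>
     (\<Sum>l<L. if even (l + L) then 2 * (z - eigval l) * sint (\<lambda>w. (zonal_transform (harmonic_kernel l) (\<phi> n) w)\<^sup>2) else 0)"
      unfolding z_def
    proof (rule spectral_inequality_antipodal[OF test_function_sphere_C1[OF \<phi>]])
      fix x :: "real^3" assume x: "x \<in> unit_sphere"
      show "\<phi> n x * \<phi> n (- x) = 0" "sphere_grad (\<phi> n) x \<bullet> sphere_grad (\<phi> n) (- x) = 0"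
        using anti[OF x] v by fastforce+
    qed
    moreover have "sint (\<lambda>x. (\<phi> n x)\<^sup>2) = ip (\<phi> n) (\<phi> n)"
      by (subst sint_restrict) (auto simp: v power2_eq_square)
    moreover have "sint (\<lambda>x. sphere_grad (\<phi> n) x \<bullet> sphere_grad (\<phi> n) x) = ip (sphere_grad (\<phi> n)) (sphere_grad (\<phi> n))"
      by (rule sint_restrict) (simp add: v)
    moreover have "zonal_transform p (\<phi> n) = region_transform p (\<phi> n)" for p
      unfolding zonal_transform_def region_transform_def inner_real_def
      by (intro ext sint_restrict) (simp add: v)
    ultimately show ?thesis by (simp only:)
  qed
  moreover have "(\<lambda>n. z * ip (\<phi> n) (\<phi> n) - ip (sphere_grad (\<phi> n)) (sphere_grad (\<phi> n))) \<longlonglongrightarrow> z * ip u u - k * ip u u"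
    by (intro tendsto_diff tendsto_mult_left L2_lim_inner lim en)
  moreover have "(\<lambda>n. ?R (\<phi> n))
     \<longlonglongrightarrow> ?R u"
  proof (rule tendsto_sum)
    fix l
    show "(\<lambda>n. if even (l + L) then 2 * (z - eigval l) * sint (\<lambda>w. (region_transform (harmonic_kernel l) (\<phi> n) w)\<^sup>2) else 0)
     \<longlonglongrightarrow> (if even (l + L) then 2 * (z - eigval l) * sint (\<lambda>w. (region_transform (harmonic_kernel l) u w)\<^sup>2) else 0)"
      using tendsto_mult_left[OF region_transform_limit[OF lim, of "harmonic_kernel l"], of "2 * (z - eigval l)"]
      by (cases "even (l + L)") simp_all
  qed
  ultimately have "z * ip u u - k * ip u u \<le> ?R u"
    by (intro LIMSEQ_le) auto
  then show ?thesis by (simp add: left_diff_distrib)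
qed

lemma Bessel_inequality:
  fixes u :: "'i \<Rightarrow> real^3 \<Rightarrow> real"
  assumes J: "finite J" and Lu: "\<And>j. j \<in> J \<Longrightarrow> L2 \<mu> (u j)" and Lb: "L2 \<mu> b"
    and on: "\<And>i j. i \<in> J \<Longrightarrow> j \<in> J \<Longrightarrow> ip (u i) (u j) = (if i = j then 1 else 0)"
  shows "(\<Sum>j\<in>J. (ip b (u j))\<^sup>2) \<le> ip b b"
proof -
  define c where "c j = ip b (u j)" for j
  have i: "integrable \<mu> (\<lambda>x. b x * b x)" "\<And>j. j \<in> J \<Longrightarrow> integrable \<mu> (\<lambda>x. c j * (b x * u j x))"
    "\<And>i j. i \<in> J \<Longrightarrow> j \<in> J \<Longrightarrow> integrable \<mu> (\<lambda>x. c i * c j * (u i x * u j x))"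
    using L2_inner_integrable[OF Lb Lb] L2_inner_integrable[OF Lb Lu] L2_inner_integrable[OF Lu Lu] by auto
  have "0 \<le> (\<integral>x. (b x - (\<Sum>j\<in>J. c j * u j x)) * (b x - (\<Sum>j\<in>J. c j * u j x)) \<partial>\<mu>)"
    by (rule integral_nonneg_AE) simp
  also have "\<dots> = (\<integral>x. b x * b x - 2 * (\<Sum>j\<in>J. c j * (b x * u j x)) + (\<Sum>i\<in>J. \<Sum>j\<in>J. c i * c j * (u i x * u j x)) \<partial>\<mu>)"
  proof (intro Bochner_Integration.integral_cong refl)
    fix x
    have "(\<Sum>j\<in>J. c j * (b x * u j x)) = b x * (\<Sum>j\<in>J. c j * u j x)"
      by (simp add: sum_distrib_left mult.left_commute)
    moreover have "(\<Sum>i\<in>J. \<Sum>j\<in>J. c i * c j * (u i x * u j x)) = (\<Sum>j\<in>J. c j * u j x) * (\<Sum>j\<in>J. c j * u j x)"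
      by (simp add: sum_product algebra_simps)
    ultimately show "(b x - (\<Sum>j\<in>J. c j * u j x)) * (b x - (\<Sum>j\<in>J. c j * u j x)) = b x * b x - 2 * (\<Sum>j\<in>J. c j * (b x * u j x)) + (\<Sum>i\<in>J. \<Sum>j\<in>J. c i * c j * (u i x * u j x))"
      by (simp add: algebra_simps)
  qed
  also have "\<dots> = (\<integral>x. b x * b x \<partial>\<mu>) - 2 * (\<Sum>j\<in>J. c j * (\<integral>x. b x * u j x \<partial>\<mu>)) + (\<Sum>i\<in>J. \<Sum>j\<in>J. c i * c j * (\<integral>x. u i x * u j x \<partial>\<mu>))"
    using i by (simp add: Bochner_Integration.integral_sum)
  also have "(\<Sum>i\<in>J. \<Sum>j\<in>J. c i * c j * (\<integral>x. u i x * u j x \<partial>\<mu>)) = (\<Sum>i\<in>J. c i * c i)"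
  proof (rule sum.cong[OF refl])
    fix i assume "i \<in> J"
    have "(\<Sum>j\<in>J. c i * c j * (\<integral>x. u i x * u j x \<partial>\<mu>)) = (\<Sum>j\<in>J. if i = j then c i * c j else 0)"
      using on[OF \<open>i \<in> J\<close>] by (intro sum.cong) auto
    then show "(\<Sum>j\<in>J. c i * c j * (\<integral>x. u i x * u j x \<partial>\<mu>)) = c i * c i"
      using J \<open>i \<in> J\<close> by simp
  qed
  finally show ?thesis by (simp add: c_def power2_eq_square)
qed

text \<open>For fixed \<open>w\<close>, Bessel's inequality bounds the left-hand integrands by the square integral of the
  kernel over the region; the integral over \<open>w\<close> of this square is the constant diagonal value of the kernel.\<close>

lemma trace_inequality:
  assumes J: "finite J" and Lu: "\<And>j. j \<in> J \<Longrightarrow> L2 \<mu> (u j)"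
    and on: "\<And>i j. i \<in> J \<Longrightarrow> j \<in> J \<Longrightarrow> ip (u i) (u j) = (if i = j then 1 else 0)"
  shows "(\<Sum>j\<in>J. sint (\<lambda>w. (region_transform (harmonic_kernel l) (u j) w)\<^sup>2)) \<le> (2 * real l + 1) / (4 * pi) * area"
proof -
  let ?H = "harmonic_kernel l"
  interpret finite_measure \<mu> using borel by simp
  have c2: "continuous_on unit_sphere (\<lambda>w. ip (\<lambda>y. poly ?H (w \<bullet> y)) (\<lambda>y. poly ?H (w \<bullet> y)))"
  proof -
    have "continuous_on unit_sphere (\<lambda>w. \<integral>y. (poly ?H (w \<bullet> y) * poly ?H (w \<bullet> y)) *\<^sub>R (1::real) \<partial>\<mu>)"
      using subset_sphere borel
      by (intro continuous_on_kernel_integral[where F = "\<lambda>w y. poly ?H (w \<bullet> y) * poly ?H (w \<bullet> y)" and u = "\<lambda>_. 1 :: real"])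
        (auto simp: case_prod_unfold intro!: continuous_intros)
    then show ?thesis by simp
  qed
  have "(\<Sum>j\<in>J. sint (\<lambda>w. (region_transform ?H (u j) w)\<^sup>2)) = sint (\<lambda>w. \<Sum>j\<in>J. (region_transform ?H (u j) w)\<^sup>2)"
    by (rule Bochner_Integration.integral_sum[symmetric])
      (intro integrable_sphere continuous_intros continuous_on_region_transform Lu)
  also have "\<dots> \<le> sint (\<lambda>w. ip (\<lambda>y. poly ?H (w \<bullet> y)) (\<lambda>y. poly ?H (w \<bullet> y)))"
  proof (rule integral_mono)
    show "(\<Sum>j\<in>J. (region_transform ?H (u j) w)\<^sup>2) \<le> ip (\<lambda>y. poly ?H (w \<bullet> y)) (\<lambda>y. poly ?H (w \<bullet> y))" for w
      unfolding region_transform_def by (rule Bessel_inequality[OF J Lu L2_zonal on])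
  qed (intro integrable_sphere continuous_intros continuous_on_region_transform Lu c2; assumption)+
  also have "\<dots> = sint (\<lambda>w. \<integral>y. (poly ?H (w \<bullet> y) * poly ?H (w \<bullet> y)) * (1 * 1) \<partial>\<mu>)" by simp
  also have "\<dots> = (\<integral>y. sint (\<lambda>w. (poly ?H (w \<bullet> y) * poly ?H (w \<bullet> y)) * (1 * 1)) \<partial>\<mu>)"
    using subset_sphere borel by (intro Fubini_area_on) (auto simp: case_prod_unfold intro!: continuous_intros)
  also have "\<dots> = (\<integral>y. (2 * real l + 1) / (4 * pi) \<partial>\<mu>)"
  proof (intro Bochner_Integration.integral_cong refl)
    fix y assume "y \<in> space \<mu>"
    then have y: "y \<in> unit_sphere" using subset_sphere by auto
    then show "sint (\<lambda>w. (poly ?H (w \<bullet> y) * poly ?H (w \<bullet> y)) * (1 * 1)) = (2 * real l + 1) / (4 * pi)"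
      using harmonic_kernel_convolution[OF y y, of l l] by (simp add: dot_square_norm harmonic_kernel_1)
  qed
  also have "\<dots> = (2 * real l + 1) / (4 * pi) * area"
    using borel by (simp add: area_on_def measure_restrict_space)
  finally show ?thesis .
qed

lemma eigenspace_cmult: "u \<in> E k \<Longrightarrow> (\<lambda>x. c * u x) \<in> E k"
  using eigenspace_add_cmult[of u k u "c - 1"] by (simp add: algebra_simps)

lemma eigenspace_add_sum:
  assumes "v \<in> E k" "finite I" "\<And>i. i \<in> I \<Longrightarrow> u i \<in> E k"
  shows "(\<lambda>x. v x + (\<Sum>i\<in>I. c i * u i x)) \<in> E k"
  using assms(2,3)
proof (induction I)
  case (insert i I)
  then have "(\<lambda>x. (v x + (\<Sum>i\<in>I. c i * u i x)) + c i * u i x) \<in> E k"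
    by (intro eigenspace_add_cmult) auto
  then show ?case using insert by (simp add: algebra_simps)
qed (use assms(1) in simp)

text \<open>The Gram-Schmidt process. The coefficients with respect to \<open>f\<close> are carried along, since linear
  independence of \<open>f\<close> is what keeps the new vector from vanishing.\<close>

lemma orthonormal_eigenbasis:
  fixes n :: nat
  assumes f: "\<And>i. i < n \<Longrightarrow> f i \<in> E k"
    and ind: "\<And>c. (AE x in surface_measure. x \<in> \<Omega> \<longrightarrow> (\<Sum>i<n. c i * f i x) = 0) \<Longrightarrow> \<forall>i<n. c i = 0"
  shows "\<exists>e. (\<forall>i<n. e i \<in> E k) \<and> (\<forall>i<n. \<forall>j<n. ip (e i) (e j) = (if i = j then 1 else 0))"
proof -
  have "\<exists>e c. (\<forall>i<m. e i \<in> E k \<and> (\<forall>x. e i x = (\<Sum>j<m. c i j * f j x))) \<and>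
     (\<forall>i<m. \<forall>j<m. ip (e i) (e j) = (if i = j then 1 else 0))" if "m \<le> n" for m
    using that
  proof (induction m)
    case (Suc m)
    then have "m \<le> n" by simp
    from Suc.IH[OF this] obtain e c where H: "\<forall>i<m. e i \<in> E k \<and> (\<forall>x. e i x = (\<Sum>j<m. c i j * f j x))"
      "\<forall>i<m. \<forall>j<m. ip (e i) (e j) = (if i = j then 1 else 0)"
      by blast
    have e: "e i \<in> E k" "e i x = (\<Sum>j<m. c i j * f j x)" if "i < m" for i x
      using H(1) that by blast+
    have on: "ip (e i) (e j) = (if i = j then 1 else 0)" if "i < m" "j < m" for i j
      using H(2) that by blast
    have fm: "f m \<in> E k" using f Suc.prems by simp
    have Le: "L2 \<mu> (e i)" if "i < m" for i using e(1)[OF that] by (rule eigenspace_L2)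
    have Lf: "L2 \<mu> (f m)" using fm by (rule eigenspace_L2)
    define a where "a i = - ip (f m) (e i)" for i
    define w where "w x = f m x + (\<Sum>i<m. a i * e i x)" for x
    have w: "w \<in> E k"
      unfolding w_def[abs_def] using e(1) by (intro eigenspace_add_sum fm) auto
    have Lw: "L2 \<mu> w" using w by (rule eigenspace_L2)
    have we: "ip w (e j) = 0" if j: "j < m" for j
    proof -
      have "ip w (e j) = (\<integral>x. f m x * e j x + (\<Sum>i<m. a i * (e i x * e j x)) \<partial>\<mu>)"
        by (simp add: w_def distrib_right sum_distrib_right mult.assoc)
      also have "\<dots> = ip (f m) (e j) + (\<Sum>i<m. a i * ip (e i) (e j))"
      proof -
        have i1: "integrable \<mu> (\<lambda>x. f m x * e j x)" using L2_inner_integrable[OF Lf Le[OF j]] by simp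
        have i2: "integrable \<mu> (\<lambda>x. a i * (e i x * e j x))" if "i \<in> {..<m}" for i
          using L2_inner_integrable[OF Le Le[OF j], of i] that by simp
        show ?thesis
          by (subst Bochner_Integration.integral_add[OF i1 Bochner_Integration.integrable_sum[OF i2]], assumption)
            (subst Bochner_Integration.integral_sum[OF i2], simp_all)
      qed
      also have "(\<Sum>i<m. a i * ip (e i) (e j)) = (\<Sum>i<m. if i = j then a i else 0)"
        using on j by (intro sum.cong) auto
      finally show ?thesis using j by (simp add: a_def)
    qed
    \<comment> \<open>The coefficient 1 of \<open>f m\<close> contradicts linear independence if \<open>w\<close> vanishes.\<close>
    define d where "d j = (if j = m then 1 else if j < m then (\<Sum>i<m. a i * c i j) else 0)" for j
    have wd: "w x = (\<Sum>j<Suc m. d j * f j x)" for x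
    proof -
      have "(\<Sum>i<m. a i * e i x) = (\<Sum>i<m. \<Sum>j<m. a i * c i j * f j x)"
        by (intro sum.cong) (auto simp: e(2) sum_distrib_left mult.assoc)
      also have "\<dots> = (\<Sum>j<m. d j * f j x)"
        by (subst sum.swap) (simp add: d_def sum_distrib_right)
      finally show ?thesis by (simp add: w_def d_def)
    qed
    have "ip w w \<noteq> 0"
    proof
      assume "ip w w = 0"
      moreover have "integrable \<mu> (\<lambda>x. w x \<bullet> w x)" by (rule L2_inner_integrable[OF Lw Lw])
      ultimately have "AE x in \<mu>. w x \<bullet> w x = 0"
        by (subst integral_nonneg_eq_0_iff_AE[symmetric]) auto
      then have "AE x in surface_measure. x \<in> \<Omega> \<longrightarrow> w x = 0"
        unfolding area_on_def using borel by (subst (asm) AE_restrict_space_iff) auto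
      moreover have "w x = (\<Sum>j<n. d j * f j x)" for x
        unfolding wd using Suc.prems by (intro sum.mono_neutral_left) (auto simp: d_def)
      ultimately have "\<forall>i<n. d i = 0" by (intro ind) simp
      then have "d m = 0" using Suc.prems by auto
      then show False by (simp add: d_def)
    qed
    moreover have "0 \<le> ip w w" by (rule integral_nonneg_AE) simp
    ultimately have N: "0 < ip w w" by (metis less_eq_real_def)
    define s where "s = 1 / sqrt (ip w w)"
    have ss: "s * s * ip w w = 1" using N by (simp add: s_def)
    define e' where "e' i = (if i < m then e i else (\<lambda>x. s * w x))" for i
    define c' where "c' i j = (if i < m then (if j < m then c i j else 0) else s * d j)" for i j
    have 1: "e' i \<in> E k" if "i < Suc m" for i
      using that e(1) eigenspace_cmult[OF w] by (auto simp: e'_def)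
    have 2: "e' i x = (\<Sum>j<Suc m. c' i j * f j x)" if "i < Suc m" for i x
    proof (cases "i < m")
      case True
      then show ?thesis by (simp add: e'_def c'_def e(2))
    next
      case False
      then have "e' i x = s * (\<Sum>j<Suc m. d j * f j x)" by (simp only: e'_def if_False wd)
      also have "\<dots> = (\<Sum>j<Suc m. c' i j * f j x)"
        unfolding sum_distrib_left using False by (intro sum.cong) (auto simp: c'_def)
      finally show ?thesis .
    qed
    have 3: "ip (e' i) (e' j) = (if i = j then 1 else 0)" if "i < Suc m" "j < Suc m" for i j
    proof -
      have ew: "ip (e j) w = 0" if "j < m" for j using we[OF that] by (simp add: mult.commute)
      have "i < m \<or> i = m" "j < m \<or> j = m" using that by auto
      then consider "i < m" "j < m" | "i < m" "j = m" | "i = m" "j < m" | "i = m" "j = m" by blast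
      then show ?thesis
      proof cases
        case 1 then show ?thesis using on by (simp add: e'_def)
      next
        case 2
        have "(\<integral>x. e i x * (s * w x) \<partial>\<mu>) = s * ip (e i) w" by (simp add: mult.left_commute)
        with 2 ew show ?thesis by (simp add: e'_def)
      next
        case 3
        then show ?thesis using we[of j] by (simp add: e'_def mult.assoc)
      next
        case 4
        have "(\<integral>x. s * w x * (s * w x) \<partial>\<mu>) = (\<integral>x. (s * s) * (w x * w x) \<partial>\<mu>)" by (simp add: algebra_simps)
        also have "\<dots> = 1" using ss by simp
        finally show ?thesis using 4 by (simp add: e'_def)
      qed
    qed
    from 1 2 3 show ?case by blast
  qed simp
  from this[of n] show ?thesis by blast
qed

lemma orthonormal_eigenfunctions:
  assumes ev: "dirichlet_eigenvalues \<Omega> ev"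
  obtains u where "\<And>j. j \<ge> 1 \<Longrightarrow> u j \<in> E (ev j)"
    "\<And>i j. i \<ge> 1 \<Longrightarrow> j \<ge> 1 \<Longrightarrow> ip (u i) (u j) = (if i = j then 1 else 0)"
proof -
  define S where "S k = {j \<in> {1..}. ev j = k}" for k
  have S: "finite (S k)" "has_multiplicity \<Omega> k (card (S k))" for k
    using ev by (auto simp: dirichlet_eigenvalues_def S_def)
  have "\<exists>e. (\<forall>i<card (S k). e i \<in> E k) \<and> (\<forall>i<card (S k). \<forall>j<card (S k). ip (e i) (e j) = (if i = j then 1 else 0))" for k
    using S(2)[of k] unfolding has_multiplicity_def by (blast intro: orthonormal_eigenbasis)
  then obtain e where e: "\<And>k i. i < card (S k) \<Longrightarrow> e k i \<in> E k"
    "\<And>k i j. i < card (S k) \<Longrightarrow> j < card (S k) \<Longrightarrow> ip (e k i) (e k j) = (if i = j then 1 else 0)"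
    by metis
  have "\<exists>h. bij_betw h (S k) {0..<card (S k)}" for k by (rule ex_bij_betw_finite_nat[OF S(1)])
  then obtain h where h: "\<And>k. bij_betw (h k) (S k) {0..<card (S k)}" by metis
  have hb: "h (ev j) j < card (S (ev j))" if "j \<ge> 1" for j
    using bij_betwE[OF h[of "ev j"]] that by (auto simp: S_def)
  define u where "u j = e (ev j) (h (ev j) j)" for j
  show ?thesis
  proof (rule that[of u])
    show *: "u j \<in> E (ev j)" if "j \<ge> 1" for j
      unfolding u_def by (rule e(1)[OF hb[OF that]])
    show "ip (u i) (u j) = (if i = j then 1 else 0)" if "i \<ge> 1" "j \<ge> 1" for i j
    proof (cases "ev i = ev j")
      case True
      have "h (ev j) i = h (ev j) j \<longleftrightarrow> i = j"
        using bij_betw_imp_inj_on[OF h[of "ev j"]] that True by (auto simp: inj_on_def S_def)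
      then show ?thesis using e(2)[OF hb[OF that(1), unfolded True] hb[OF that(2)]] True by (simp add: u_def)
    next
      case False
      then show ?thesis using eigenspaces_orthogonal[OF *[OF that(1)] *[OF that(2)]] by auto
    qed
  qed
qed

text \<open>Sum the eigenfunction inequality over the eigenvalues below \<open>z\<close>. The multiplicities \<open>2 l + 1\<close> enter
  through the trace inequality.\<close>

lemma riesz_mean_at_node:
  assumes hemi: "\<Omega> \<subseteq> open_hemisphere" and ev: "dirichlet_eigenvalues \<Omega> ev" and J: "finite J" "J \<subseteq> {1..}"
  fixes L :: nat
  defines "z \<equiv> eigval L"
  shows "(\<Sum>j\<in>J. max (z - ev j) 0) \<le> area / (8 * pi) * (z * (z - 2))"
proof -
  obtain u where u: "\<And>j. j \<ge> 1 \<Longrightarrow> u j \<in> E (ev j)"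
    "\<And>i j. i \<ge> 1 \<Longrightarrow> j \<ge> 1 \<Longrightarrow> ip (u i) (u j) = (if i = j then 1 else 0)"
    using orthonormal_eigenfunctions[OF ev] by blast
  define I where "I = {j\<in>J. ev j < z}"
  have I: "finite I" "\<And>j. j \<in> I \<Longrightarrow> j \<ge> 1" using J by (auto simp: I_def)
  let ?T = "\<lambda>l j. sint (\<lambda>w. (region_transform (harmonic_kernel l) (u j) w)\<^sup>2)"
  have "(\<Sum>j\<in>J. max (z - ev j) 0) = (\<Sum>j\<in>I. max (z - ev j) 0)"
    using J(1) by (intro sum.mono_neutral_right) (auto simp: I_def)
  also have "\<dots> = (\<Sum>j\<in>I. (z - ev j) * ip (u j) (u j))"
    using u(2) I(2) by (intro sum.cong) (auto simp: I_def)
  also have "\<dots> \<le> (\<Sum>j\<in>I. \<Sum>l<L. if even (l + L) then 2 * (z - eigval l) * ?T l j else 0)"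
    unfolding z_def by (intro sum_mono eigenfunction_inequality hemi u(1) I(2))
  also have "\<dots> = (\<Sum>l<L. if even (l + L) then 2 * (z - eigval l) * (\<Sum>j\<in>I. ?T l j) else 0)"
    by (subst sum.swap) (auto simp: sum_distrib_left intro!: sum.cong)
  also have "\<dots> \<le> (\<Sum>l<L. if even (l + L) then 2 * (z - eigval l) * ((2 * real l + 1) / (4 * pi) * area) else 0)"
  proof (rule sum_mono)
    fix l assume l: "l \<in> {..<L}"
    have "eigval l \<le> z" unfolding z_def using l by (intro mult_mono) auto
    moreover have "(\<Sum>j\<in>I. ?T l j) \<le> (2 * real l + 1) / (4 * pi) * area"
      by (rule trace_inequality[OF I(1) eigenspace_L2[OF u(1)[OF I(2)]] u(2)[OF I(2) I(2)]])
    ultimately show "(if even (l + L) then 2 * (z - eigval l) * (\<Sum>j\<in>I. ?T l j) else 0) \<le>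
       (if even (l + L) then 2 * (z - eigval l) * ((2 * real l + 1) / (4 * pi) * area) else 0)"
      by (cases "even (l + L)") (simp_all only: if_True if_False order_refl, intro mult_left_mono, auto)
  qed
  also have "\<dots> = area / (2 * pi) * (\<Sum>l<L. if even (l + L) then (2 * real l + 1) * (z - eigval l) else 0)"
    unfolding sum_distrib_left by (intro sum.cong) (auto simp: field_simps)
  also have "\<dots> = area / (8 * pi) * (z * (z - 2))"
    unfolding z_def weighted_degree_sum by (simp add: field_simps)
  finally show ?thesis .
qed

text \<open>The Riesz mean is convex in \<open>z\<close>, so between two consecutive eigenvalues \<open>a < b\<close> of the sphere it is at most
  \<open>\<bar>\<Omega>\<bar> / (8 \<pi>)\<close> times the chord of \<open>t (t - 2)\<close> over \<open>[a, b]\<close>. With \<open>m = (L + 1)\<^sup>2\<close>, this chord is the tangent of the parabola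
  \<open>(t - 1/2)\<^sup>2\<close> at the point \<open>t = m - 1/2\<close>.\<close>

lemma riesz_mean_finite:
  assumes hemi: "\<Omega> \<subseteq> open_hemisphere" and ev: "dirichlet_eigenvalues \<Omega> ev" and J: "finite J" "J \<subseteq> {1..}" and z: "z \<ge> 0"
  shows "(\<Sum>j\<in>J. max (z - ev j) 0) \<le> 1 / (8 * pi) * area * (z - 1/2)\<^sup>2"
proof -
  define P where "P n \<longleftrightarrow> z < (real n + 1) * (real n + 2)" for n :: nat
  obtain n0 :: nat where n0: "z < real n0" using reals_Archimedean2 by blast
  have "real n0 * 1 \<le> (real n0 + 1) * (real n0 + 2)" by (intro mult_mono) auto
  then have "P n0" using n0 by (simp add: P_def)
  \<comment> \<open>The index of the interval between consecutive eigenvalues of the sphere that contains \<open>z\<close>.\<close>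
  define L where "L = (LEAST n. P n)"
  have PL: "P L" unfolding L_def by (rule LeastI[of P n0, OF \<open>P n0\<close>])
  define a b where "a = eigval L" and "b = (real L + 1) * (real L + 2)"
  have zb: "z \<le> b" using PL by (simp add: P_def b_def)
  have za: "a \<le> z"
  proof (cases L)
    case (Suc m)
    then have "\<not> P m" using not_less_Least[of m P] by (simp add: L_def)
    then show ?thesis by (simp add: P_def a_def Suc algebra_simps)
  qed (use z in \<open>simp add: a_def\<close>)
  have ab: "a < b" by (simp add: a_def b_def algebra_simps)
  define M where "M = area / (8 * pi)"
  have M: "0 \<le> M" by (simp add: M_def)
  define R where "R t = (\<Sum>j\<in>J. max (t - ev j) 0)" for t
  have Ra: "R a \<le> M * (a * (a - 2))"
    using riesz_mean_at_node[OF hemi ev J, of L] by (simp add: R_def M_def a_def)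
  have Rb: "R b \<le> M * (b * (b - 2))"
    using riesz_mean_at_node[OF hemi ev J, of "Suc L"] by (simp add: R_def M_def b_def add.commute)
  have conv: "(b - a) * max (z - e) 0 \<le> (b - z) * max (a - e) 0 + (z - a) * max (b - e) 0" for e
  proof (cases "z \<le> e")
    case True
    then show ?thesis using za zb by simp
  next
    case False
    have "(b - a) * max (z - e) 0 = (b - z) * (a - e) + (z - a) * (b - e)" using False by (simp add: algebra_simps)
    also have "\<dots> \<le> (b - z) * max (a - e) 0 + (z - a) * max (b - e) 0"
      using za zb by (intro add_mono mult_left_mono) auto
    finally show ?thesis .
  qed
  have "(b - a) * R z \<le> (b - z) * R a + (z - a) * R b"
    unfolding R_def sum_distrib_left sum.distrib[symmetric] by (intro sum_mono conv)
  also have "\<dots> \<le> (b - z) * (M * (a * (a - 2))) + (z - a) * (M * (b * (b - 2)))"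
    using Ra Rb za zb by (intro add_mono mult_left_mono) auto
  also have "\<dots> = M * ((b - z) * (a * (a - 2)) + (z - a) * (b * (b - 2)))" by (simp add: algebra_simps)
  also have "\<dots> \<le> M * ((b - a) * (z - 1/2)\<^sup>2)"
  proof (rule mult_left_mono[OF _ M])
    define m where "m = (real L + 1)\<^sup>2"
    have "(b - a) * (z - 1/2)\<^sup>2 - ((b - z) * (a * (a - 2)) + (z - a) * (b * (b - 2))) = (b - a) * (z - (m - 1/2))\<^sup>2"
      unfolding a_def b_def m_def by (simp add: power2_eq_square algebra_simps)
    moreover have "0 \<le> (b - a) * (z - (m - 1/2))\<^sup>2" using ab by simp
    ultimately show "(b - z) * (a * (a - 2)) + (z - a) * (b * (b - 2)) \<le> (b - a) * (z - 1/2)\<^sup>2" by linarith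
  qed
  finally have "(b - a) * R z \<le> (b - a) * (M * (z - 1/2)\<^sup>2)" by (simp add: mult.left_commute)
  then have "R z \<le> M * (z - 1/2)\<^sup>2" using ab by simp
  then show ?thesis by (simp add: R_def M_def)
qed

end

section \<open>The bound for domains in the hemisphere\<close>

theorem theorem3p2p5:
  fixes \<Omega> :: "(real^3) set" and ev :: "nat \<Rightarrow> real" and z :: real
  assumes "\<Omega> \<subseteq> open_hemisphere"
    and "openin (top_of_set unit_sphere) \<Omega>"
    and "connected \<Omega>"
    and "dirichlet_eigenvalues \<Omega> ev"
    and "z \<ge> 0"
  shows "(\<lambda>j. max (z - ev j) 0) summable_on {1..} \<and>
    (\<Sum>\<^sub>\<infinity>j\<in>{1..}. max (z - ev j) 0) \<le> 1 / (8 * pi) * measure surface_measure \<Omega> * (z - 1/2)\<^sup>2"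
proof -
  obtain U where U: "open U" "\<Omega> = unit_sphere \<inter> U"
    using assms(2) by (auto simp: openin_open)
  interpret sphere_region \<Omega>
    by unfold_locales (use U in auto)
  note bound = riesz_mean_finite[OF assms(1,4) _ _ assms(5)]
  have s: "(\<lambda>j. max (z - ev j) 0) summable_on {1..}"
  proof (rule nonneg_bdd_above_summable_on)
    show "bdd_above (sum (\<lambda>j. max (z - ev j) 0) ` {F. F \<subseteq> {1..} \<and> finite F})"
      by (rule bdd_aboveI2) (use bound in blast)
  qed simp
  moreover have "(\<Sum>\<^sub>\<infinity>j\<in>{1..}. max (z - ev j) 0) \<le> 1 / (8 * pi) * measure surface_measure \<Omega> * (z - 1/2)\<^sup>2"
    by (rule infsum_le_finite_sums[OF s bound])
  ultimately show ?thesis by blast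
qed

end
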